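(* Let $X$ be a smooth affine algebraic curve over $k$, with coordinate ring $k[X]$. Then the algebra $\Pi^1(k[X])$ is canonically isomorphic, as a filtered algebra, to $\mathscr{D}(X,\Omega_X^{1/2})$, the filtered algebra of twisted differential operators acting on half-forms on $X$.
   Context: $k$ is an algebraically closed field of characteristic zero; $\otimes=\otimes_k$. Double derivations. For an associative unital $k$-algebra $A$ put $\mathbb{D}\mathrm{er}(A)=\mathrm{Der}(A,A\otimes A)$, the space of $k$-linear derivations $\Theta:A\to A\otimes A$, where $A\otimes A$ has the outer bimodule structure $a\cdot(x\otimes y)\cdot b=ax\otimes yb$. The space $\mathbb{D}\mathrm{er}(A)$ is an $A$-bimodule via the inner bimodule structure on $A\otimes A$: if $\Theta(x)=\sum x'\otimes x''$ then $(b\Theta c)(x)=\sum x'c\otimes bx''$. Let $\Delta\in\mathbb{D}\mathrm{er}(A)$ be the derivation $\Delta(a)=a\otimes 1-1\otimes a$. The algebra $\Pi^1(A)$. Let $T_A\mathbb{D}\mathrm{er}(A)=\bigoplus_{i\ge0}T^i_A\mathbb{D}\mathrm{er}(A)$ be the tensor algebra of this bimodule over $A$ (with $T^0_A=A$). Then $\Pi^1(A):=T_A\mathbb{D}\mathrm{er}(A)/\langle\langle \Delta-1\rangle\rangle$, the quotient by the two-sided ideal generated by $\Delta-1$, where $\Delta\in T^1_A$ and $1\in A=T^0_A$. It carries the increasing filtration induced by the grading of the tensor algebra. Half-forms. $\mathscr{D}(X,\Omega_X^{1/2})$ is the algebra of global sections of the sheaf of twisted differential operators attached to the (formal) square root of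 the canonical bundle $\Omega^1_X$. Explicitly, it is the $k$-algebra generated by $k[X]$ and symbols $\ell_\xi$, $k$-linear in $\xi\in\mathrm{Der}(k[X])$ (the Lie derivatives on half-forms), subject to $[\ell_\xi,f]=\xi(f)$, $[\ell_\xi,\ell_\eta]=\ell_{[\xi,\eta]}$, $\ell_{f\xi}=f\ell_\xi+\tfrac12\xi(f)$ for $f\in k[X]$, $\xi,\eta\in\mathrm{Der}(k[X])$, filtered by order of differential operator ($f$ has order $0$, $\ell_\xi$ has order $\le1$). *)

theory Defs
  imports
    "HOL-Algebra.Algebraic_Closure_Type"
    "HOL-Algebra.QuotRing"
    "HOL-Algebra.Ideal_Product"
    "HOL-Library.Poly_Mapping"
    "HOL-Library.Extended_Nat"
    "HOL-Library.FuncSet"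
begin

section \<open>Smooth affine curves\<close>

locale k_algebra = vector_space scale
  for scale :: "'k::field \<Rightarrow> 'a::ring_1 \<Rightarrow> 'a" +
  assumes scale_mult_left: "scale c x * y = scale c (x * y)"
    and scale_mult_right: "x * scale c y = scale c (x * y)"

inductive_set generated_subalgebra ::
  "('k::field \<Rightarrow> 'a::ring_1 \<Rightarrow> 'a) \<Rightarrow> 'a set \<Rightarrow> 'a set"
  for scale S where
  gen: "x \<in> S \<Longrightarrow> x \<in> generated_subalgebra scale S"
| const: "scale c 1 \<in> generated_subalgebra scale S"
| add: "\<lbrakk>x \<in> generated_subalgebra scale S; y \<in> generated_subalgebra scale S\<rbrakk>
    \<Longrightarrow> x + y \<in> generated_subalgebra scale S"
| mult: "\<lbrakk>x \<in> generated_subalgebra scale S; y \<in> generated_subalgebra scale S\<rbrakk>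
    \<Longrightarrow> x * y \<in> generated_subalgebra scale S"

definition ideal_height :: "('a, 'z) ring_scheme \<Rightarrow> 'a set \<Rightarrow> enat" where
  "ideal_height R P = Sup {enat n | n. \<exists>p. (\<forall>i\<le>n. primeideal (p i) R) \<and>
     (\<forall>i<n. p i \<subset> p (Suc i)) \<and> p n = P}"

text \<open>The cotangent space \<open>m/m\<^sup>2\<close> at a maximal ideal \<open>m\<close> is one-dimensional over the
  residue field: it has a basis consisting of the class of a single element \<open>t\<close>.\<close>

definition cotangent_line :: "('a, 'z) ring_scheme \<Rightarrow> 'a set \<Rightarrow> bool" where
  "cotangent_line R m \<longleftrightarrow> (\<exists>t\<in>m. t \<notin> m \<cdot>\<^bsub>R\<^esub> m \<and>
     (\<forall>x\<in>m. \<exists>a\<in>carrier R. x \<ominus>\<^bsub>R\<^esub> a \<otimes>\<^bsub>R\<^esub> t \<in> m \<cdot>\<^bsub>R\<^esub> m))"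

text \<open>A smooth affine curve, given by its coordinate ring \<open>A\<close>: a finitely generated
  commutative algebra all of whose local rings \<open>A\<^sub>m\<close> at maximal ideals are regular of
  dimension 1, i.e. \<open>dim m/m\<^sup>2 = dim A\<^sub>m = 1\<close>. Here \<open>m/m\<^sup>2\<close> is also the cotangent space of
  \<open>A\<^sub>m\<close>, and \<open>dim A\<^sub>m\<close> is the height of \<open>m\<close>. Connectedness is not assumed.\<close>

definition smooth_affine_curve ::
  "('k::field \<Rightarrow> 'a::comm_ring_1 \<Rightarrow> 'a) \<Rightarrow> bool" where
  "smooth_affine_curve scale \<longleftrightarrow>
     k_algebra scale \<and>
     (\<exists>S. finite S \<and> generated_subalgebra scale S = UNIV) \<and>
     (\<forall>m. maximalideal m (ring_of_type_algebra :: 'a ring) \<longrightarrow>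
        ideal_height (ring_of_type_algebra :: 'a ring) m = 1 \<and>
        cotangent_line (ring_of_type_algebra :: 'a ring) m)"

section \<open>Monoid algebras\<close>

text \<open>All algebras below are quotients of monoid algebras \<open>k[W]\<close> by two-sided ideals. The
  library's convolution product on \<^typ>\<open>'w \<Rightarrow>\<^sub>0 'k\<close> is not usable since it is tied to the
  type class of additive monoids.\<close>

definition monoid_algebra ::
  "('w, 'z) monoid_scheme \<Rightarrow> ('w \<Rightarrow>\<^sub>0 'k::field) ring" where
  "monoid_algebra W =
     \<lparr>carrier = {p. Poly_Mapping.keys p \<subseteq> carrier W},
      monoid.mult = (\<lambda>p q. \<Sum>u\<in>Poly_Mapping.keys p. \<Sum>v\<in>Poly_Mapping.keys q.
        Poly_Mapping.single (u \<otimes>\<^bsub>W\<^esub> v)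
          (Poly_Mapping.lookup p u * Poly_Mapping.lookup q v)),
      one = Poly_Mapping.single \<one>\<^bsub>W\<^esub> 1,
      ring.zero = 0,
      add = (+)\<rparr>"

abbreviation word :: "'w \<Rightarrow> ('w \<Rightarrow>\<^sub>0 'k::field)" where
  "word w \<equiv> Poly_Mapping.single w 1"

definition words_upto ::
  "('w, 'z) monoid_scheme \<Rightarrow> ('w \<Rightarrow> nat) \<Rightarrow> nat \<Rightarrow> ('w \<Rightarrow>\<^sub>0 'k::field) set" where
  "words_upto W len n = {p. \<forall>w\<in>Poly_Mapping.keys p. w \<in> carrier W \<and> len w \<le> n}"

section \<open>Tensor square and double derivations\<close>

type_synonym ('a, 'k) tensor = "('a \<times> 'a \<Rightarrow>\<^sub>0 'k) set"
type_synonym ('a, 'k) double_derivation = "'a \<Rightarrow> ('a, 'k) tensor"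

definition pair_monoid :: "('a::ring_1 \<times> 'a) monoid" where
  "pair_monoid = \<lparr>carrier = UNIV, monoid.mult = (\<lambda>(a, b) (c, d). (a * c, b * d)), one = (1, 1)\<rparr>"

definition tensor_rels ::
  "('k::field \<Rightarrow> 'a::ring_1 \<Rightarrow> 'a) \<Rightarrow> ('a \<times> 'a \<Rightarrow>\<^sub>0 'k) set" where
  "tensor_rels scale =
     {word (a + a', b) - word (a, b) - word (a', b) | a a' b. True} \<union>
     {word (a, b + b') - word (a, b) - word (a, b') | a b b'. True} \<union>
     {word (scale c a, b) - Poly_Mapping.single (a, b) c | c a b. True} \<union>
     {word (a, scale c b) - Poly_Mapping.single (a, b) c | c a b. True}"

text \<open>The relations are stable under multiplication by pairs, so the ideal they generate is
  just their linear span, and the quotient is \<open>A \<otimes>\<^sub>k A\<close> with its usual algebra structure.\<close>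

definition tensor_ideal ::
  "('k::field \<Rightarrow> 'a::ring_1 \<Rightarrow> 'a) \<Rightarrow> ('a \<times> 'a \<Rightarrow>\<^sub>0 'k) set" where
  "tensor_ideal scale = Idl\<^bsub>monoid_algebra pair_monoid\<^esub> (tensor_rels scale)"

definition tensor_square ::
  "('k::field \<Rightarrow> 'a::ring_1 \<Rightarrow> 'a) \<Rightarrow> ('a, 'k) tensor ring" where
  "tensor_square scale = monoid_algebra pair_monoid Quot tensor_ideal scale"

definition tensor ::
  "('k::field \<Rightarrow> 'a::ring_1 \<Rightarrow> 'a) \<Rightarrow> 'a \<Rightarrow> 'a \<Rightarrow> ('a, 'k) tensor" where
  "tensor scale a b = tensor_ideal scale +>\<^bsub>monoid_algebra pair_monoid\<^esub> word (a, b)"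

text \<open>\<open>outer_act a t b\<close> sends \<open>x \<otimes> y\<close> to \<open>a x \<otimes> y b\<close>; \<open>inner_act b t c\<close> sends \<open>x \<otimes> y\<close> to
  \<open>x c \<otimes> b y\<close>.\<close>

definition outer_act ::
  "('k::field \<Rightarrow> 'a::ring_1 \<Rightarrow> 'a) \<Rightarrow> 'a \<Rightarrow> ('a, 'k) tensor \<Rightarrow> 'a \<Rightarrow> ('a, 'k) tensor" where
  "outer_act scale a t b =
     tensor scale a 1 \<otimes>\<^bsub>tensor_square scale\<^esub> t \<otimes>\<^bsub>tensor_square scale\<^esub> tensor scale 1 b"

definition inner_act ::
  "('k::field \<Rightarrow> 'a::ring_1 \<Rightarrow> 'a) \<Rightarrow> 'a \<Rightarrow> ('a, 'k) tensor \<Rightarrow> 'a \<Rightarrow> ('a, 'k) tensor" where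
  "inner_act scale b t c =
     tensor scale 1 b \<otimes>\<^bsub>tensor_square scale\<^esub> t \<otimes>\<^bsub>tensor_square scale\<^esub> tensor scale c 1"

definition double_der ::
  "('k::field \<Rightarrow> 'a::ring_1 \<Rightarrow> 'a) \<Rightarrow> ('a, 'k) double_derivation set" where
  "double_der scale = {\<Theta>.
     (\<forall>x. \<Theta> x \<in> carrier (tensor_square scale)) \<and>
     (\<forall>x y. \<Theta> (x + y) = \<Theta> x \<oplus>\<^bsub>tensor_square scale\<^esub> \<Theta> y) \<and>
     (\<forall>c x. \<Theta> (scale c x) = tensor scale (scale c 1) 1 \<otimes>\<^bsub>tensor_square scale\<^esub> \<Theta> x) \<and>
     (\<forall>x y. \<Theta> (x * y) = outer_act scale x (\<Theta> y) 1 \<oplus>\<^bsub>tensor_square scale\<^esub> outer_act scale 1 (\<Theta> x) y)}"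

definition dd_Delta ::
  "('k::field \<Rightarrow> 'a::ring_1 \<Rightarrow> 'a) \<Rightarrow> ('a, 'k) double_derivation" where
  "dd_Delta scale a = tensor scale a 1 \<ominus>\<^bsub>tensor_square scale\<^esub> tensor scale 1 a"

record ('a, 'm) bimod = "'m partial_object" +
  madd :: "'m \<Rightarrow> 'm \<Rightarrow> 'm"
  lact :: "'a \<Rightarrow> 'm \<Rightarrow> 'm"
  ract :: "'m \<Rightarrow> 'a \<Rightarrow> 'm"

definition double_der_bimod ::
  "('k::field \<Rightarrow> 'a::ring_1 \<Rightarrow> 'a) \<Rightarrow> ('a, ('a, 'k) double_derivation) bimod" where
  "double_der_bimod scale =
     \<lparr>carrier = double_der scale,
      madd = (\<lambda>\<Theta> \<Psi> x. \<Theta> x \<oplus>\<^bsub>tensor_square scale\<^esub> \<Psi> x),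
      lact = (\<lambda>b \<Theta> x. inner_act scale b (\<Theta> x) 1),
      ract = (\<lambda>\<Theta> c x. inner_act scale 1 (\<Theta> x) c)\<rparr>"

section \<open>Tensor algebra of a bimodule\<close>

text \<open>The word \<open>(a, [m\<^sub>1, \<dots>, m\<^sub>n])\<close> stands for the element
  \<open>a \<otimes> m\<^sub>1 \<otimes> \<dots> \<otimes> m\<^sub>n\<close> of \<open>T\<^sup>n = A \<otimes>\<^sub>A M \<otimes>\<^sub>A \<dots> \<otimes>\<^sub>A M\<close> (\<open>n\<close> factors \<open>M\<close>). In a product of words
  the middle scalar is moved into the last factor on its left, which makes the words a monoid.
  The ideal generated by the relations is the span of all relations of multilinearity and
  \<open>A\<close>-balancedness; for instance \<open>m b \<otimes> m' = m \<otimes> b m'\<close> is obtained by multiplying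
  \<open>(b, [m']) - (1, [b m'])\<close> by \<open>(1, [m])\<close> on the left. The relations are homogeneous for the
  length \<open>n\<close>.\<close>

type_synonym ('a, 'm) tensor_word = "'a \<times> 'm list"

definition tensor_words ::
  "('a::ring_1, 'm) bimod \<Rightarrow> ('a, 'm) tensor_word monoid" where
  "tensor_words M =
     \<lparr>carrier = {(a, ms). set ms \<subseteq> carrier M},
      monoid.mult = (\<lambda>(a, ms) (b, ns).
        if ms = [] then (a * b, ns) else (a, butlast ms @ ract M (last ms) b # ns)),
      one = (1, [])\<rparr>"

definition tensor_algebra_rels ::
  "('k::field \<Rightarrow> 'a::ring_1 \<Rightarrow> 'a) \<Rightarrow> ('a, 'm) bimod \<Rightarrow> (('a, 'm) tensor_word \<Rightarrow>\<^sub>0 'k) set" where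
  "tensor_algebra_rels scale M =
     {word (a + b, []) - word (a, []) - word (b, []) | a b. True} \<union>
     {word (scale c a, []) - Poly_Mapping.single (a, []) c | c a. True} \<union>
     {word (1, [madd M m m']) - word (1, [m]) - word (1, [m']) | m m'. m \<in> carrier M \<and> m' \<in> carrier M} \<union>
     {word (a, [m]) - word (1, [lact M a m]) | a m. m \<in> carrier M}"

definition tensor_algebra_ideal ::
  "('k::field \<Rightarrow> 'a::ring_1 \<Rightarrow> 'a) \<Rightarrow> ('a, 'm) bimod \<Rightarrow> (('a, 'm) tensor_word \<Rightarrow>\<^sub>0 'k) set" where
  "tensor_algebra_ideal scale M =
     Idl\<^bsub>monoid_algebra (tensor_words M)\<^esub> (tensor_algebra_rels scale M)"

definition tensor_algebra ::
  "('k::field \<Rightarrow> 'a::ring_1 \<Rightarrow> 'a) \<Rightarrow> ('a, 'm) bimod \<Rightarrow> (('a, 'm) tensor_word \<Rightarrow>\<^sub>0 'k) set ring" where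
  "tensor_algebra scale M = monoid_algebra (tensor_words M) Quot tensor_algebra_ideal scale M"

definition tensor_algebra_class ::
  "('k::field \<Rightarrow> 'a::ring_1 \<Rightarrow> 'a) \<Rightarrow> ('a, 'm) bimod \<Rightarrow>
   (('a, 'm) tensor_word \<Rightarrow>\<^sub>0 'k) \<Rightarrow> (('a, 'm) tensor_word \<Rightarrow>\<^sub>0 'k) set" where
  "tensor_algebra_class scale M p =
     tensor_algebra_ideal scale M +>\<^bsub>monoid_algebra (tensor_words M)\<^esub> p"

text \<open>\<open>T\<^sup>0 \<oplus> \<dots> \<oplus> T\<^sup>n\<close>\<close>

definition tensor_algebra_filt ::
  "('k::field \<Rightarrow> 'a::ring_1 \<Rightarrow> 'a) \<Rightarrow> ('a, 'm) bimod \<Rightarrow> nat \<Rightarrow>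
   (('a, 'm) tensor_word \<Rightarrow>\<^sub>0 'k) set set" where
  "tensor_algebra_filt scale M n =
     tensor_algebra_class scale M ` words_upto (tensor_words M) (\<lambda>(a, ms). length ms) n"

section \<open>The algebra \<open>\<Pi>\<^sup>1(A)\<close>\<close>

type_synonym ('a, 'k) pi1 = "(('a, ('a, 'k) double_derivation) tensor_word \<Rightarrow>\<^sub>0 'k) set set"

definition pi1_ideal ::
  "('k::field \<Rightarrow> 'a::ring_1 \<Rightarrow> 'a) \<Rightarrow> ('a, 'k) pi1" where
  "pi1_ideal scale =
     (let M = double_der_bimod scale; T = tensor_algebra scale M in
      Idl\<^bsub>T\<^esub> {tensor_algebra_class scale M (word (1, [dd_Delta scale])) \<ominus>\<^bsub>T\<^esub> \<one>\<^bsub>T\<^esub>})"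

definition pi1 :: "('k::field \<Rightarrow> 'a::ring_1 \<Rightarrow> 'a) \<Rightarrow> ('a, 'k) pi1 ring" where
  "pi1 scale = tensor_algebra scale (double_der_bimod scale) Quot pi1_ideal scale"

definition pi1_class ::
  "('k::field \<Rightarrow> 'a::ring_1 \<Rightarrow> 'a) \<Rightarrow>
   (('a, ('a, 'k) double_derivation) tensor_word \<Rightarrow>\<^sub>0 'k) set \<Rightarrow> ('a, 'k) pi1" where
  "pi1_class scale x =
     pi1_ideal scale +>\<^bsub>tensor_algebra scale (double_der_bimod scale)\<^esub> x"

definition pi1_fun :: "('k::field \<Rightarrow> 'a::ring_1 \<Rightarrow> 'a) \<Rightarrow> 'a \<Rightarrow> ('a, 'k) pi1" where
  "pi1_fun scale a =
     pi1_class scale (tensor_algebra_class scale (double_der_bimod scale) (word (a, [])))"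

definition pi1_dd ::
  "('k::field \<Rightarrow> 'a::ring_1 \<Rightarrow> 'a) \<Rightarrow> ('a, 'k) double_derivation \<Rightarrow> ('a, 'k) pi1" where
  "pi1_dd scale \<Theta> =
     pi1_class scale (tensor_algebra_class scale (double_der_bimod scale) (word (1, [\<Theta>])))"

definition pi1_filt ::
  "('k::field \<Rightarrow> 'a::ring_1 \<Rightarrow> 'a) \<Rightarrow> nat \<Rightarrow> ('a, 'k) pi1 set" where
  "pi1_filt scale n =
     pi1_class scale ` tensor_algebra_filt scale (double_der_bimod scale) n"

section \<open>Differential operators on half-forms\<close>

definition der :: "('k::field \<Rightarrow> 'a::comm_ring_1 \<Rightarrow> 'a) \<Rightarrow> ('a \<Rightarrow> 'a) set" where
  "der scale = {\<xi>. Vector_Spaces.linear scale scale \<xi> \<and> (\<forall>x y. \<xi> (x * y) = x * \<xi> y + \<xi> x * y)}"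

text \<open>\<open>Lie \<xi>\<close> is the symbol \<open>\<ell>\<^sub>\<xi>\<close>.\<close>

datatype 'a half_gen = Fn 'a | Lie "'a \<Rightarrow> 'a"

definition half_words ::
  "('k::field \<Rightarrow> 'a::comm_ring_1 \<Rightarrow> 'a) \<Rightarrow> 'a half_gen list monoid" where
  "half_words scale =
     \<lparr>carrier = lists (range Fn \<union> Lie ` der scale), monoid.mult = (@), one = []\<rparr>"

definition half_rels ::
  "('k::field \<Rightarrow> 'a::comm_ring_1 \<Rightarrow> 'a) \<Rightarrow> ('a half_gen list \<Rightarrow>\<^sub>0 'k) set" where
  "half_rels scale =
     {word [Fn (f + g)] - word [Fn f] - word [Fn g] | f g. True} \<union>
     {word [Fn (scale c f)] - Poly_Mapping.single [Fn f] c | c f. True} \<union>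
     {word [Fn (f * g)] - word [Fn f, Fn g] | f g. True} \<union>
     {word [Fn 1] - word []} \<union>
     {word [Lie (\<lambda>x. \<xi> x + \<eta> x)] - word [Lie \<xi>] - word [Lie \<eta>] | \<xi> \<eta>. \<xi> \<in> der scale \<and> \<eta> \<in> der scale} \<union>
     {word [Lie (\<lambda>x. scale c (\<xi> x))] - Poly_Mapping.single [Lie \<xi>] c | c \<xi>. \<xi> \<in> der scale} \<union>
     {word [Lie \<xi>, Fn f] - word [Fn f, Lie \<xi>] - word [Fn (\<xi> f)] | \<xi> f. \<xi> \<in> der scale} \<union>
     {word [Lie \<xi>, Lie \<eta>] - word [Lie \<eta>, Lie \<xi>] - word [Lie (\<lambda>x. \<xi> (\<eta> x) - \<eta> (\<xi> x))]
        | \<xi> \<eta>. \<xi> \<in> der scale \<and> \<eta> \<in> der scale} \<union>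
     {word [Lie (\<lambda>x. f * \<xi> x)] - word [Fn f, Lie \<xi>] - Poly_Mapping.single [Fn (\<xi> f)] (1/2)
        | f \<xi>. \<xi> \<in> der scale}"

definition half_ideal ::
  "('k::field \<Rightarrow> 'a::comm_ring_1 \<Rightarrow> 'a) \<Rightarrow> ('a half_gen list \<Rightarrow>\<^sub>0 'k) set" where
  "half_ideal scale = Idl\<^bsub>monoid_algebra (half_words scale)\<^esub> (half_rels scale)"

definition half_diffop ::
  "('k::field \<Rightarrow> 'a::comm_ring_1 \<Rightarrow> 'a) \<Rightarrow> ('a half_gen list \<Rightarrow>\<^sub>0 'k) set ring" where
  "half_diffop scale = monoid_algebra (half_words scale) Quot half_ideal scale"

definition half_class ::
  "('k::field \<Rightarrow> 'a::comm_ring_1 \<Rightarrow> 'a) \<Rightarrow>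
   ('a half_gen list \<Rightarrow>\<^sub>0 'k) \<Rightarrow> ('a half_gen list \<Rightarrow>\<^sub>0 'k) set" where
  "half_class scale p = half_ideal scale +>\<^bsub>monoid_algebra (half_words scale)\<^esub> p"

definition half_fun ::
  "('k::field \<Rightarrow> 'a::comm_ring_1 \<Rightarrow> 'a) \<Rightarrow> 'a \<Rightarrow> ('a half_gen list \<Rightarrow>\<^sub>0 'k) set" where
  "half_fun scale f = half_class scale (word [Fn f])"

definition half_lie ::
  "('k::field \<Rightarrow> 'a::comm_ring_1 \<Rightarrow> 'a) \<Rightarrow> ('a \<Rightarrow> 'a) \<Rightarrow> ('a half_gen list \<Rightarrow>\<^sub>0 'k) set" where
  "half_lie scale \<xi> = half_class scale (word [Lie \<xi>])"

text \<open>Operators of order at most \<open>n\<close>: the span of the products of functions and at most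
  \<open>n\<close> Lie derivatives.\<close>

definition half_filt ::
  "('k::field \<Rightarrow> 'a::comm_ring_1 \<Rightarrow> 'a) \<Rightarrow> nat \<Rightarrow> ('a half_gen list \<Rightarrow>\<^sub>0 'k) set set" where
  "half_filt scale n =
     half_class scale ` words_upto (half_words scale)
       (\<lambda>w. length (filter (\<lambda>x. case x of Fn f \<Rightarrow> False | Lie \<xi> \<Rightarrow> True) w)) n"

section \<open>Filtered isomorphisms and the canonical normalization\<close>

text \<open>The algebra structures over \<open>k\<close> are given by the structure maps \<open>\<eta>\<close> and \<open>\<eta>'\<close> from \<open>k\<close>.\<close>

definition filtered_algebra_iso ::
  "('r, 'y) ring_scheme \<Rightarrow> ('k \<Rightarrow> 'r) \<Rightarrow> (nat \<Rightarrow> 'r set) \<Rightarrow>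
   ('s, 'z) ring_scheme \<Rightarrow> ('k \<Rightarrow> 's) \<Rightarrow> (nat \<Rightarrow> 's set) \<Rightarrow> ('r \<Rightarrow> 's) \<Rightarrow> bool" where
  "filtered_algebra_iso R \<eta> F S \<eta>' G \<phi> \<longleftrightarrow>
     \<phi> \<in> ring_iso R S \<and> (\<forall>c. \<phi> (\<eta> c) = \<eta>' c) \<and> (\<forall>n. \<phi> ` F n = G n)"

text \<open>Multiplication \<open>A \<otimes> A \<rightarrow> A\<close> and the flip of \<open>A \<otimes> A\<close>. The image in \<^const>\<open>the_elem\<close>
  is a singleton, and the flip maps cosets onto cosets.\<close>

definition tensor_mult ::
  "('k::field \<Rightarrow> 'a::ring_1 \<Rightarrow> 'a) \<Rightarrow> ('a, 'k) tensor \<Rightarrow> 'a" where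
  "tensor_mult scale t =
     the_elem ((\<lambda>p. \<Sum>(a, b)\<in>Poly_Mapping.keys p. scale (Poly_Mapping.lookup p (a, b)) (a * b)) ` t)"

definition tensor_flip :: "('a, 'k::field) tensor \<Rightarrow> ('a, 'k) tensor" where
  "tensor_flip t = Poly_Mapping.map_key prod.swap ` t"

text \<open>The canonical isomorphism is the one that is the identity on \<open>A\<close> and sends a
  flip-invariant double derivation \<open>\<Theta>\<close> to the Lie derivative along the vector field
  \<open>a \<mapsto> \<Theta>'(a) \<Theta>''(a)\<close>. Being the identity on \<open>A\<close> does not determine an isomorphism, since
  \<open>\<ell>\<^sub>\<xi> \<mapsto> \<ell>\<^sub>\<xi> + \<alpha>(\<xi>)\<close> is an automorphism for every closed 1-form \<open>\<alpha>\<close>.\<close>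

definition canonically_normalized ::
  "('k::field \<Rightarrow> 'a::comm_ring_1 \<Rightarrow> 'a) \<Rightarrow>
   (('a, 'k) pi1 \<Rightarrow> ('a half_gen list \<Rightarrow>\<^sub>0 'k) set) \<Rightarrow> bool" where
  "canonically_normalized scale \<phi> \<longleftrightarrow>
     (\<forall>f. \<phi> (pi1_fun scale f) = half_fun scale f) \<and>
     (\<forall>\<Theta>\<in>double_der scale. (\<forall>a. tensor_flip (\<Theta> a) = \<Theta> a) \<longrightarrow>
        \<phi> (pi1_dd scale \<Theta>) = half_lie scale (\<lambda>a. tensor_mult scale (\<Theta> a)))"

end

theory Submission imports Defs
begin

text \<open>
  Write \<open>I\<close> for the kernel of the multiplication \<open>A \<otimes> A \<rightarrow> A\<close>, the ideal of the diagonal. For a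
  commutative algebra a double derivation satisfies
  \<open>\<Theta>(a) (b \<otimes> 1 - 1 \<otimes> b) = \<Theta>(b) (a \<otimes> 1 - 1 \<otimes> a)\<close>, so that double derivations are functions with a
  simple pole along the diagonal, with \<open>\<Delta>\<close> as the function \<open>1\<close>. Restriction to the diagonal gives an
  exact sequence \<open>0 \<rightarrow> A \<otimes> A \<rightarrow> \<D>er(A) \<rightarrow> Der(A) \<rightarrow> 0\<close>, in which \<open>s\<close> is sent to \<open>s \<Delta>\<close> and \<open>\<Theta>\<close> to the
  vector field \<open>\<xi>(a) = \<Theta>'(a) \<Theta>''(a)\<close>. In \<open>\<Pi>\<^sup>1\<close> the element \<open>s \<Delta>\<close> becomes the restriction of \<open>s\<close>
  to the diagonal, and \<open>[\<Theta>, a] = \<xi>(a)\<close>. Hence \<open>\<Pi>\<^sup>1\<close> is generated by functions and vector fields, and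
  what remains is to choose lifts of the vector fields. The flip of the two factors acts on double
  derivations and sends \<open>\<Delta>\<close> to \<open>- \<Delta>\<close>; the class of a flip-invariant lift depends on \<open>\<xi>\<close> only. The
  flip-invariant lift of \<open>f \<xi>\<close> is \<open>(f \<Theta> + \<Theta> f)/2 = f \<Theta> + \<xi>(f)/2\<close>, which is the rule of half-forms.
  The bracket relation holds because its defect is bilinear over \<open>A\<close> and alternating, and vector
  fields on a curve have rank one (\<open>curv_zero\<close>). In the other direction, \<open>\<Theta>\<close> is sent to
  \<open>\<ell>\<^sub>\<xi> + \<alpha>(\<Theta>)\<close>, where \<open>\<Theta> - \<Theta>\<^sup>\<sigma> = 2 s \<Delta>\<close> and \<open>\<alpha>(\<Theta>)\<close> is the restriction of \<open>s\<close> to the diagonal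
  (\<open>alpha_mult\<close>, \<open>psi_bimodule\<close>).

  The geometric input is that the diagonal is a Cartier divisor. It is used in the form of
  \<open>unit_decomposition\<close>: there are double derivations and functions with \<open>\<Sum>\<^sub>i \<Theta>\<^sub>i(a\<^sub>i) = 1 \<otimes> 1\<close>. This
  gives the exact sequence (\<open>DD_kernel\<close>, \<open>derivation_lift\<close>, \<open>delta_multiple_zero\<close>) and the rank of the
  vector fields (\<open>der_proportional\<close>) by short computations. Since the values of double derivations
  include \<open>I\<close>, it suffices to find at each point \<open>x\<close> a double derivation whose vector field does not
  vanish at \<open>x\<close> (\<open>nonvanishing_double_derivation\<close>). Zariski's lemma identifies the residue field with
  \<open>k\<close>. If \<open>t\<close> spans the cotangent space, then \<open>t \<otimes> 1 - 1 \<otimes> t\<close> generates \<open>I\<close> near \<open>(x, x)\<close> by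
  Nakayama's lemma, and it is not a zero divisor there, because \<open>A\<close> is Noetherian (Hilbert's basis
  theorem) and \<open>x\<close> has height one; the double derivation is
  \<open>a \<mapsto> (a \<otimes> 1 - 1 \<otimes> a) / (t \<otimes> 1 - 1 \<otimes> t)\<close> up to a factor that is invertible at \<open>(x, x)\<close>.\<close>

section \<open>Noetherian subrings and Hilbert's basis theorem\<close>

text \<open>Subrings, ideals and spans are sets of elements of an ambient commutative ring, so
  that inductions on the number of generators of an algebra stay inside one type.\<close>

definition subring_set :: "'a::comm_ring_1 set \<Rightarrow> bool" where
  "subring_set R \<longleftrightarrow> 1 \<in> R \<and> (\<forall>x\<in>R. \<forall>y\<in>R. x + y \<in> R \<and> x * y \<in> R \<and> - x \<in> R)"

lemma subring_setD:
  assumes "subring_set R"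
  shows "1 \<in> R" "0 \<in> R" "x \<in> R \<Longrightarrow> y \<in> R \<Longrightarrow> x + y \<in> R" "x \<in> R \<Longrightarrow> y \<in> R \<Longrightarrow> x * y \<in> R"
    "x \<in> R \<Longrightarrow> - x \<in> R" "x \<in> R \<Longrightarrow> y \<in> R \<Longrightarrow> x - y \<in> R" "x \<in> R \<Longrightarrow> x ^ n \<in> R"
proof -
  show 1: "1 \<in> R" and 2: "\<And>x y. x \<in> R \<Longrightarrow> y \<in> R \<Longrightarrow> x + y \<in> R"
    and 3: "\<And>x y. x \<in> R \<Longrightarrow> y \<in> R \<Longrightarrow> x * y \<in> R"
    and 4: "\<And>x. x \<in> R \<Longrightarrow> - x \<in> R"
    using assms by (auto simp: subring_set_def)
  show "0 \<in> R" using 2[OF 1 4[OF 1]] by simp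
  show "x \<in> R \<Longrightarrow> y \<in> R \<Longrightarrow> x - y \<in> R" using 2[of x "- y"] 4[of y] by simp
  show "x \<in> R \<Longrightarrow> x ^ n \<in> R" by (induction n) (auto intro: 1 3)
qed

lemma subring_set_sum:
  assumes "subring_set R" "\<And>i. i \<in> I \<Longrightarrow> f i \<in> R"
  shows "sum f I \<in> R"
  using assms(2) by (induction I rule: infinite_finite_induct) (auto intro: subring_setD[OF assms(1)])

text \<open>The linear combinations of elements of \<open>T\<close> with coefficients in
  \<open>R\<close>. The ambient ring need not have a unit.\<close>

inductive_set span_over :: "'a::comm_ring set \<Rightarrow> 'a set \<Rightarrow> 'a set" for R T where
  zero: "0 \<in> span_over R T"
| step: "r \<in> R \<Longrightarrow> x \<in> T \<Longrightarrow> y \<in> span_over R T \<Longrightarrow> r * x + y \<in> span_over R T"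

lemma span_over_add: "x \<in> span_over R T \<Longrightarrow> y \<in> span_over R T \<Longrightarrow> x + y \<in> span_over R T"
  by (induction rule: span_over.induct) (auto simp: add.assoc intro: span_over.intros)

lemma span_over_mult_mem:
  assumes "\<And>s. s \<in> R \<Longrightarrow> r * s \<in> R'" "x \<in> span_over R T"
  shows "r * x \<in> span_over R' T"
  using assms(2)
proof induction
  case (step s x y)
  have "(r * s) * x + r * y \<in> span_over R' T"
    using step assms by (intro span_over.step) auto
  then show ?case by (simp add: algebra_simps)
qed (simp add: span_over.zero)

lemma span_over_mult:
  assumes "subring_set R" "r \<in> R" "x \<in> span_over R T"
  shows "r * x \<in> span_over R T"
  using assms(3) by (rule span_over_mult_mem[rotated]) (use assms in \<open>auto intro: subring_setD\<close>)

text \<open>\<open>L\<close> is an ideal of the subring \<open>R\<close>.\<close>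

definition ideal_of :: "'a::comm_ring_1 set \<Rightarrow> 'a set \<Rightarrow> bool" where
  "ideal_of R L \<longleftrightarrow> L \<subseteq> R \<and> 0 \<in> L \<and> (\<forall>x\<in>L. \<forall>y\<in>L. x + y \<in> L) \<and> (\<forall>r\<in>R. \<forall>x\<in>L. r * x \<in> L)"

lemma ideal_ofD:
  assumes "ideal_of R L"
  shows "x \<in> L \<Longrightarrow> x \<in> R" "0 \<in> L" "x \<in> L \<Longrightarrow> y \<in> L \<Longrightarrow> x + y \<in> L" "r \<in> R \<Longrightarrow> x \<in> L \<Longrightarrow> r * x \<in> L"
  using assms by (auto simp: ideal_of_def)

lemma ideal_of_minus:
  assumes "subring_set R" "ideal_of R L" "x \<in> L" "y \<in> L"
  shows "- x \<in> L" "x - y \<in> L"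
proof -
  have *: "- z \<in> L" if "z \<in> L" for z
    using ideal_ofD(4)[OF assms(2) subring_setD(5)[OF assms(1) subring_setD(1)[OF assms(1)]] that] by simp
  show "- x \<in> L" by (rule *) fact
  show "x - y \<in> L" using ideal_ofD(3)[OF assms(2,3) *[OF assms(4)]] by simp
qed

lemma span_over_subset_ideal:
  assumes "ideal_of R L" "T \<subseteq> L" "x \<in> span_over R T"
  shows "x \<in> L"
  using assms(3) by induction (use assms(1,2) in \<open>auto intro!: ideal_ofD[OF assms(1)]\<close>)

text \<open>All ideals of \<open>R\<close> are finitely generated.\<close>

definition noetherian_set :: "'a::comm_ring_1 set \<Rightarrow> bool" where
  "noetherian_set R \<longleftrightarrow> (\<forall>L. ideal_of R L \<longrightarrow> (\<exists>F. finite F \<and> F \<subseteq> L \<and> L \<subseteq> span_over R F))"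

lemma noetherian_setE:
  assumes "noetherian_set R" "ideal_of R L"
  obtains F where "finite F" "F \<subseteq> L" "L \<subseteq> span_over R F"
  using assms unfolding noetherian_set_def by blast

text \<open>The polynomials with coefficients in \<open>R\<close>.\<close>

definition polys_over :: "'a::comm_ring_1 set \<Rightarrow> 'a poly set" where
  "polys_over R = {p. \<forall>i. coeff p i \<in> R}"

lemma polys_over_closed:
  assumes R: "subring_set R"
  shows "0 \<in> polys_over R" "p \<in> polys_over R \<Longrightarrow> q \<in> polys_over R \<Longrightarrow> p + q \<in> polys_over R"
    "p \<in> polys_over R \<Longrightarrow> q \<in> polys_over R \<Longrightarrow> p - q \<in> polys_over R"
    "p \<in> polys_over R \<Longrightarrow> - p \<in> polys_over R"
    "r \<in> R \<Longrightarrow> p \<in> polys_over R \<Longrightarrow> smult r p \<in> polys_over R"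
    "r \<in> R \<Longrightarrow> monom r n \<in> polys_over R"
    "p \<in> polys_over R \<Longrightarrow> q \<in> polys_over R \<Longrightarrow> p * q \<in> polys_over R"
  using subring_setD[OF R]
  by (auto simp: polys_over_def coeff_mult intro!: subring_set_sum[OF R])

text \<open>The subring \<open>R[x]\<close>.\<close>

definition adjoin :: "'a::comm_ring_1 set \<Rightarrow> 'a \<Rightarrow> 'a set" where
  "adjoin R x = (\<lambda>p. poly p x) ` polys_over R"

lemma subring_adjoin:
  assumes R: "subring_set R"
  shows "subring_set (adjoin R x)" "R \<subseteq> adjoin R x" "x \<in> adjoin R x"
proof -
  note c = polys_over_closed[OF R]
  have const: "r \<in> adjoin R x" if "r \<in> R" for r
    unfolding adjoin_def using c(6)[OF that, of 0] by (intro image_eqI[of _ _ "monom r 0"]) (auto simp: poly_monom)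
  then show "R \<subseteq> adjoin R x" by blast
  show "x \<in> adjoin R x"
    unfolding adjoin_def using c(6)[OF subring_setD(1)[OF R], of 1]
    by (intro image_eqI[of _ _ "monom 1 1"]) (auto simp: poly_monom)
  show "subring_set (adjoin R x)"
    unfolding subring_set_def
  proof (intro conjI ballI)
    show "1 \<in> adjoin R x" by (rule const) (rule subring_setD[OF R])
    fix a b assume "a \<in> adjoin R x" "b \<in> adjoin R x"
    then obtain p q where pq: "p \<in> polys_over R" "q \<in> polys_over R" "a = poly p x" "b = poly q x"
      by (auto simp: adjoin_def)
    show "a + b \<in> adjoin R x" unfolding adjoin_def by (rule image_eqI[of _ _ "p + q"]) (auto simp: pq c)
    show "a * b \<in> adjoin R x" unfolding adjoin_def by (rule image_eqI[of _ _ "p * q"]) (auto simp: pq c)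
    show "- a \<in> adjoin R x" unfolding adjoin_def by (rule image_eqI[of _ _ "- p"]) (auto simp: pq c)
  qed
qed

lemma degree_less_of_coeff_0: "degree p \<le> n \<Longrightarrow> coeff p n = 0 \<Longrightarrow> p = 0 \<or> degree p < n"
  by (metis le_neq_implies_less leading_coeff_0_iff)

text \<open>Hilbert's basis theorem: the ideals of coefficients in degree \<open>n\<close> of an ideal of
  \<open>R[x]\<close> increase with \<open>n\<close> and become stationary.\<close>

theorem noetherian_adjoin:
  assumes R: "subring_set R" and N: "noetherian_set R"
  shows "noetherian_set (adjoin R x)"
  unfolding noetherian_set_def
proof (intro allI impI)
  fix L assume L: "ideal_of (adjoin R x) L"
  note S = subring_adjoin[OF R, of x]
  note c = polys_over_closed[OF R]
  define Q where "Q n = {p \<in> polys_over R. degree p \<le> n \<and> poly p x \<in> L}" for n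
  define C where "C n = (\<lambda>p. coeff p n) ` Q n" for n
  have Q0: "0 \<in> Q n" for n by (auto simp: Q_def c ideal_ofD[OF L])
  have Qadd: "p + q \<in> Q n" if "p \<in> Q n" "q \<in> Q n" for p q n
    using that by (auto simp: Q_def c degree_add_le intro: ideal_ofD[OF L])
  have Qsm: "smult r p \<in> Q n" if "r \<in> R" "p \<in> Q n" for p r n
    using that S by (auto simp: Q_def c intro: ideal_ofD[OF L] order_trans[OF degree_smult_le])
  have Qmon: "monom 1 k * p \<in> Q (k + n)" if "p \<in> Q n" for p n k
  proof -
    have "x ^ k * poly p x \<in> L"
      using that S by (intro ideal_ofD(4)[OF L] subring_setD(7)[OF S(1)]) (auto simp: Q_def)
    moreover have "degree (monom 1 k * p) \<le> k + n"
      using that degree_mult_le[of "monom 1 k" p] degree_monom_le[of "1::'a" k] by (auto simp: Q_def)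
    ultimately show ?thesis
      using that by (auto simp: Q_def c subring_setD[OF R] poly_monom)
  qed
  have Cmono: "C n \<subseteq> C (k + n)" for n k
  proof
    fix a assume "a \<in> C n"
    then obtain p where "p \<in> Q n" "a = coeff p n" by (auto simp: C_def)
    then show "a \<in> C (k + n)"
      using Qmon[of p n k] unfolding C_def by (intro image_eqI[of _ _ "monom 1 k * p"]) (auto simp: coeff_monom_mult)
  qed
  have Cmono: "C n \<subseteq> C n'" if "n \<le> n'" for n n'
    using Cmono[of n "n' - n"] that by simp
  have Cid: "ideal_of R (C n)" for n
    unfolding ideal_of_def
  proof (intro conjI ballI)
    show "C n \<subseteq> R" by (auto simp: C_def Q_def polys_over_def)
    show "0 \<in> C n" unfolding C_def using Q0 by (intro image_eqI[of _ _ 0]) auto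
    fix a b assume "a \<in> C n" "b \<in> C n"
    then obtain p q where "p \<in> Q n" "a = coeff p n" "q \<in> Q n" "b = coeff q n" by (auto simp: C_def)
    then show "a + b \<in> C n" unfolding C_def by (intro image_eqI[of _ _ "p + q"]) (auto simp: Qadd)
  next
    fix r a assume "r \<in> R" "a \<in> C n"
    then obtain p where "p \<in> Q n" "a = coeff p n" by (auto simp: C_def)
    with \<open>r \<in> R\<close> show "r * a \<in> C n" unfolding C_def by (intro image_eqI[of _ _ "smult r p"]) (auto simp: Qsm)
  qed
  have Uid: "ideal_of R (\<Union>n. C n)"
    unfolding ideal_of_def
  proof (intro conjI ballI)
    fix a b assume "a \<in> (\<Union>n. C n)" "b \<in> (\<Union>n. C n)"
    then obtain i j where "a \<in> C i" "b \<in> C j" by auto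
    then have "a \<in> C (max i j)" "b \<in> C (max i j)"
      using Cmono[of i "max i j"] Cmono[of j "max i j"] by auto
    from ideal_ofD(3)[OF Cid this] show "a + b \<in> (\<Union>n. C n)" by blast
  next
    show "0 \<in> (\<Union>n. C n)" using ideal_ofD(2)[OF Cid] by blast
    show "(\<Union>n. C n) \<subseteq> R" using ideal_ofD(1)[OF Cid] by blast
    fix r a assume "r \<in> R" "a \<in> (\<Union>n. C n)"
    then show "r * a \<in> (\<Union>n. C n)" using ideal_ofD(4)[OF Cid] by blast
  qed
  obtain F where F: "finite F" "F \<subseteq> (\<Union>n. C n)" "(\<Union>n. C n) \<subseteq> span_over R F"
    by (rule noetherian_setE[OF N Uid])
  have "\<exists>n. F \<subseteq> C n"
    using F(1,2)
  proof (induction F)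
    case (insert a F)
    then obtain i j where "a \<in> C i" "F \<subseteq> C j" by auto
    then have "insert a F \<subseteq> C (max i j)"
      using Cmono[of i "max i j"] Cmono[of j "max i j"] by auto
    then show ?case by blast
  qed simp
  then obtain N where "F \<subseteq> C N" by blast
  then have CN: "C n \<subseteq> C N" for n
    using F(3) span_over_subset_ideal[OF Cid[of N], of F] by auto
  have "\<exists>G. finite G \<and> G \<subseteq> Q n \<and> C n \<subseteq> span_over R ((\<lambda>p. coeff p n) ` G)" for n
  proof -
    obtain F where F: "finite F" "F \<subseteq> C n" "C n \<subseteq> span_over R F"
      by (rule noetherian_setE[OF N Cid])
    obtain G where "G \<subseteq> Q n" "finite G" "F = (\<lambda>p. coeff p n) ` G"
      using finite_subset_image[OF F(1) F(2)[unfolded C_def]] by blast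
    then show ?thesis using F by blast
  qed
  then obtain G where G: "\<And>n. finite (G n)" "\<And>n. G n \<subseteq> Q n"
    "\<And>n. C n \<subseteq> span_over R ((\<lambda>p. coeff p n) ` G n)"
    by metis
  define H where "H = (\<lambda>p. poly p x) ` (\<Union>n\<le>N. G n)"
  have HL: "H \<subseteq> L" using G(2) by (auto simp: H_def Q_def)
  have low: "\<exists>q\<in>Q n. coeff q n = a \<and> poly q x \<in> span_over (adjoin R x) H" if "n \<le> N" "a \<in> C n" for n a
  proof -
    have "a \<in> span_over R ((\<lambda>p. coeff p n) ` G n)" using G(3) that by blast
    then show ?thesis
    proof induction
      case zero
      show ?case using Q0 by (intro bexI[of _ 0]) (auto intro: span_over.zero)
    next
      case (step r y z)
      then obtain q g where q: "q \<in> Q n" "coeff q n = z" "poly q x \<in> span_over (adjoin R x) H"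
        and g: "g \<in> G n" "y = coeff g n" by auto
      have "poly g x \<in> H" using g \<open>n \<le> N\<close> by (auto simp: H_def)
      then have "r * poly g x + poly q x \<in> span_over (adjoin R x) H"
        using step q S by (intro span_over.step) auto
      moreover have "smult r g + q \<in> Q n" using Qadd[OF Qsm[OF step(1)] q(1)] g G(2) by blast
      ultimately show ?case using g q by (intro bexI[of _ "smult r g + q"]) auto
    qed
  qed
  have all: "\<exists>q\<in>Q n. coeff q n = a \<and> poly q x \<in> span_over (adjoin R x) H" if "a \<in> C n" for n a
  proof (cases "n \<le> N")
    case True then show ?thesis using low that by blast
  next
    case False
    then obtain k where k: "n = k + N" by (metis add.commute le_Suc_ex nat_le_linear)
    obtain q where q: "q \<in> Q N" "coeff q N = a" "poly q x \<in> span_over (adjoin R x) H"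
      using low[of N a] CN[of n] \<open>a \<in> C n\<close> by auto
    have "x ^ k * poly q x \<in> span_over (adjoin R x) H"
      using q S by (intro span_over_mult) (auto intro: subring_setD)
    then show ?thesis using q Qmon[OF q(1), of k] k
      by (intro bexI[of _ "monom 1 k * q"]) (auto simp: poly_monom coeff_monom_mult)
  qed
  have main: "poly p x \<in> span_over (adjoin R x) H" if "p \<in> Q n" for p n
    using that
  proof (induction n arbitrary: p rule: less_induct)
    case (less n)
    then obtain q where q: "q \<in> Q n" "coeff q n = coeff p n" "poly q x \<in> span_over (adjoin R x) H"
      using all[of "coeff p n" n] by (auto simp: C_def)
    have pq: "p - q \<in> Q n" using Qadd[OF less.prems Qsm[of "-1" q n]] q(1) subring_setD[OF R] by simp
    then have "p - q = 0 \<or> degree (p - q) < n"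
      using q by (intro degree_less_of_coeff_0) (auto simp: Q_def)
    then have "poly (p - q) x \<in> span_over (adjoin R x) H"
    proof
      assume "p - q = 0" then show ?thesis by (simp add: span_over.zero)
    next
      assume "degree (p - q) < n"
      then show ?thesis using pq by (intro less.IH[of "degree (p - q)"]) (auto simp: Q_def)
    qed
    from span_over_add[OF this q(3)] show ?case by simp
  qed
  show "\<exists>F. finite F \<and> F \<subseteq> L \<and> L \<subseteq> span_over (adjoin R x) F"
  proof (intro exI[of _ H] conjI)
    show "finite H" using G(1) by (auto simp: H_def)
    show "L \<subseteq> span_over (adjoin R x) H"
    proof
      fix y assume y: "y \<in> L"
      then obtain p where p: "p \<in> polys_over R" "y = poly p x"
        using ideal_ofD(1)[OF L] by (auto simp: adjoin_def)
      then show "y \<in> span_over (adjoin R x) H"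
        using main[of p "degree p"] y by (auto simp: Q_def)
    qed
  qed (fact HL)
qed

section \<open>Finitely generated algebras: Noetherianity and Zariski's lemma\<close>

lemma k_algebra_scale:
  assumes "k_algebra scale"
  shows "scale (c + d) 1 = scale c 1 + scale d 1" "scale (c * d) 1 = scale c 1 * scale d 1"
    "scale 1 x = x" "scale c x = scale c 1 * x" "scale 0 x = 0" "scale (- c) 1 = - scale c 1"
    "scale c (x + y) = scale c x + scale c y" "scale c (x * y) = scale c x * y"
    "scale c (x * y) = x * scale c y" "scale c 0 = 0" "scale c (scale d x) = scale (c * d) x"
proof -
  interpret k_algebra scale by fact
  show "scale (c + d) 1 = scale c 1 + scale d 1" by (rule scale_left_distrib)
  show "scale (c * d) 1 = scale c 1 * scale d 1" by (simp add: scale_mult_left)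
  show "scale c x = scale c 1 * x" by (simp add: scale_mult_left)
  show "scale 1 x = x" "scale 0 x = 0" "scale (- c) 1 = - scale c 1" "scale c 0 = 0"
    "scale c (scale d x) = scale (c * d) x" by simp_all
  show "scale c (x + y) = scale c x + scale c y" by (rule scale_right_distrib)
  show "scale c (x * y) = scale c x * y" by (rule scale_mult_left[symmetric])
  show "scale c (x * y) = x * scale c y" by (rule scale_mult_right[symmetric])
qed

lemma subring_constants:
  assumes "k_algebra scale"
  shows "subring_set (range (\<lambda>c. scale c 1))" "noetherian_set (range (\<lambda>c. scale c 1))"
proof -
  note k = k_algebra_scale[OF assms]
  show R: "subring_set (range (\<lambda>c. scale c 1))"
    unfolding subring_set_def
  proof (intro conjI ballI)
    show "1 \<in> range (\<lambda>c. scale c 1)" using k(3)[of 1] by (intro image_eqI[of _ _ 1]) auto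
    fix x y assume "x \<in> range (\<lambda>c. scale c 1)" "y \<in> range (\<lambda>c. scale c 1)"
    then obtain c d where *: "x = scale c 1" "y = scale d 1" by auto
    show "x + y \<in> range (\<lambda>c. scale c 1)" unfolding * k(1)[symmetric] by (rule rangeI)
    show "x * y \<in> range (\<lambda>c. scale c 1)" unfolding * k(2)[symmetric] by (rule rangeI)
    show "- x \<in> range (\<lambda>c. scale c 1)" unfolding * k(6)[symmetric] by (rule rangeI)
  qed
  show "noetherian_set (range (\<lambda>c. scale c 1))"
    unfolding noetherian_set_def
  proof (intro allI impI)
    fix L assume L: "ideal_of (range (\<lambda>c. scale c 1)) L"
    show "\<exists>F. finite F \<and> F \<subseteq> L \<and> L \<subseteq> span_over (range (\<lambda>c. scale c 1)) F"
    proof (cases "L \<subseteq> {0}")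
      case True
      then show ?thesis by (intro exI[of _ "{}"]) (auto intro: span_over.zero)
    next
      case False
      then obtain x where x: "x \<in> L" "x \<noteq> 0" by auto
      then obtain c where c: "x = scale c 1" using ideal_ofD(1)[OF L] by blast
      with x have c0: "c \<noteq> 0" by (auto simp: k(5))
      show ?thesis
      proof (intro exI[of _ "{x}"] conjI subsetI)
        fix y assume "y \<in> L"
        then obtain d where d: "y = scale d 1" using ideal_ofD(1)[OF L] by blast
        have "y = scale (d / c) 1 * x + 0" using c0 by (simp add: c d flip: k(2))
        then show "y \<in> span_over (range (\<lambda>c. scale c 1)) {x}"
          by (auto intro!: span_over.intros simp del: add_0_right)
      qed (use x in auto)
    qed
  qed
qed

text \<open>Properties of subrings that pass from \<open>R\<close> to \<open>R[x]\<close> hold for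
  finitely generated algebras, if they hold for the constants.\<close>

lemma finitely_generated_induct:
  fixes scale :: "'k::field \<Rightarrow> 'a::comm_ring_1 \<Rightarrow> 'a"
  assumes k: "k_algebra scale" and fin: "finite S" "generated_subalgebra scale S = UNIV"
    and base: "P (range (\<lambda>c. scale c 1))"
    and step: "\<And>R x. subring_set R \<Longrightarrow> range (\<lambda>c. scale c 1) \<subseteq> R \<Longrightarrow> P R \<Longrightarrow> P (adjoin R x)"
  shows "P UNIV"
proof -
  have "\<exists>R. subring_set R \<and> range (\<lambda>c. scale c 1) \<subseteq> R \<and> S \<subseteq> R \<and> P R"
    using fin(1)
  proof (induction S)
    case empty
    show ?case using subring_constants[OF k] base by blast
  next
    case (insert x S)
    then obtain R where R: "subring_set R" "range (\<lambda>c. scale c 1) \<subseteq> R" "S \<subseteq> R" "P R" by blast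
    show ?case using subring_adjoin[OF R(1), of x] step[OF R(1,2,4), of x] R(2,3)
      by (intro exI[of _ "adjoin R x"]) blast
  qed
  then obtain R where R: "subring_set R" "range (\<lambda>c. scale c 1) \<subseteq> R" "S \<subseteq> R" "P R" by blast
  have "x \<in> generated_subalgebra scale S \<Longrightarrow> x \<in> R" for x
    by (induction rule: generated_subalgebra.induct) (use R(2,3) in \<open>auto intro: subring_setD[OF R(1)]\<close>)
  with fin(2) have "R = UNIV" by auto
  with R show ?thesis by simp
qed

lemma finitely_generated_noetherian:
  fixes scale :: "'k::field \<Rightarrow> 'a::comm_ring_1 \<Rightarrow> 'a"
  assumes "k_algebra scale" "finite S" "generated_subalgebra scale S = UNIV"
  shows "noetherian_set (UNIV :: 'a set)"
  by (rule finitely_generated_induct[OF assms]) (auto intro: noetherian_adjoin subring_constants assms)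

text \<open>Prime ideals of the ambient ring.\<close>

definition prime_set :: "'a::comm_ring_1 set \<Rightarrow> bool" where
  "prime_set P \<longleftrightarrow> ideal_of UNIV P \<and> 1 \<notin> P \<and> (\<forall>x y. x * y \<in> P \<longrightarrow> x \<in> P \<or> y \<in> P)"

lemma subring_UNIV: "subring_set UNIV" by (simp add: subring_set_def)

lemma prime_setD:
  assumes "prime_set P"
  shows "0 \<in> P" "1 \<notin> P" "x \<in> P \<Longrightarrow> y \<in> P \<Longrightarrow> x + y \<in> P" "x \<in> P \<Longrightarrow> y \<in> P \<Longrightarrow> x - y \<in> P"
    "x \<in> P \<Longrightarrow> r * x \<in> P" "x \<in> P \<Longrightarrow> x * r \<in> P" "x * y \<in> P \<Longrightarrow> x \<in> P \<or> y \<in> P" "x ^ n \<in> P \<Longrightarrow> x \<in> P"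
    "x \<in> P \<Longrightarrow> - x \<in> P"
proof -
  have I: "ideal_of UNIV P" using assms by (simp add: prime_set_def)
  note d = ideal_ofD[OF I] ideal_of_minus[OF subring_UNIV I]
  show "0 \<in> P" "1 \<notin> P" "x \<in> P \<Longrightarrow> y \<in> P \<Longrightarrow> x + y \<in> P" "x \<in> P \<Longrightarrow> y \<in> P \<Longrightarrow> x - y \<in> P"
    and 5: "x \<in> P \<Longrightarrow> r * x \<in> P" and "x * y \<in> P \<Longrightarrow> x \<in> P \<or> y \<in> P" for x y r
    using assms d by (auto simp: prime_set_def)
  show "x \<in> P \<Longrightarrow> x * r \<in> P" using 5[of x r] by (simp add: mult.commute)
  show "x \<in> P \<Longrightarrow> - x \<in> P" using d by blast
  show "x ^ n \<in> P \<Longrightarrow> x \<in> P" using assms by (induction n) (auto simp: prime_set_def)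
qed

lemma ideal_sum: "ideal_of R P \<Longrightarrow> (\<And>i. i \<in> I \<Longrightarrow> f i \<in> P) \<Longrightarrow> sum f I \<in> P"
  by (induction I rule: infinite_finite_induct) (auto intro: ideal_ofD)

text \<open>A \<open>k\<close>-algebra homomorphism \<open>R \<rightarrow> k\<close> that vanishes
  on \<open>R \<inter> P\<close>, that is, a point of \<open>R/(R \<inter> P)\<close>. The values
  outside \<open>R\<close> are arbitrary.\<close>

definition point_on :: "('k::field \<Rightarrow> 'a::comm_ring_1 \<Rightarrow> 'a) \<Rightarrow> 'a set \<Rightarrow> 'a set \<Rightarrow> ('a \<Rightarrow> 'k) \<Rightarrow> bool" where
  "point_on scale P R \<phi> \<longleftrightarrow> (\<forall>x\<in>R. \<forall>y\<in>R. \<phi> (x + y) = \<phi> x + \<phi> y \<and> \<phi> (x * y) = \<phi> x * \<phi> y) \<and>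
     (\<forall>c. \<phi> (scale c 1) = c) \<and> (\<forall>x\<in>R \<inter> P. \<phi> x = 0)"

lemma point_onD:
  assumes "point_on scale P R \<phi>" "k_algebra scale" "subring_set R" "range (\<lambda>c. scale c 1) \<subseteq> R"
  shows "x \<in> R \<Longrightarrow> y \<in> R \<Longrightarrow> \<phi> (x + y) = \<phi> x + \<phi> y" "x \<in> R \<Longrightarrow> y \<in> R \<Longrightarrow> \<phi> (x * y) = \<phi> x * \<phi> y"
    "\<phi> (scale c 1) = c" "x \<in> R \<Longrightarrow> x \<in> P \<Longrightarrow> \<phi> x = 0" "\<phi> 0 = 0" "\<phi> 1 = 1"
    "x \<in> R \<Longrightarrow> \<phi> (- x) = - \<phi> x" "x \<in> R \<Longrightarrow> y \<in> R \<Longrightarrow> \<phi> (x - y) = \<phi> x - \<phi> y"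
    "(\<And>i. i \<in> I \<Longrightarrow> f i \<in> R) \<Longrightarrow> \<phi> (sum f I) = (\<Sum>i\<in>I. \<phi> (f i))" "x \<in> R \<Longrightarrow> \<phi> (x ^ n) = \<phi> x ^ n"
proof -
  note k = k_algebra_scale[OF assms(2)] and r = subring_setD[OF assms(3)]
  show 1: "\<And>x y. x \<in> R \<Longrightarrow> y \<in> R \<Longrightarrow> \<phi> (x + y) = \<phi> x + \<phi> y"
    and 2: "\<And>x y. x \<in> R \<Longrightarrow> y \<in> R \<Longrightarrow> \<phi> (x * y) = \<phi> x * \<phi> y"
    and 3: "\<And>c. \<phi> (scale c 1) = c" and "x \<in> R \<Longrightarrow> x \<in> P \<Longrightarrow> \<phi> x = 0"
    using assms(1) by (auto simp: point_on_def)
  show 5: "\<phi> 0 = 0" using 3[of 0] by (simp add: k(5))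
  show 6: "\<phi> 1 = 1" using 3[of 1] by (simp add: k(3))
  show 7: "\<phi> (- x) = - \<phi> x" if "x \<in> R" for x
    using 1[of x "- x"] 5 that r(5) by (simp add: eq_neg_iff_add_eq_0 add.commute)
  show "x \<in> R \<Longrightarrow> y \<in> R \<Longrightarrow> \<phi> (x - y) = \<phi> x - \<phi> y" using 1[of x "- y"] by (simp add: 7 r)
  show "(\<And>i. i \<in> I \<Longrightarrow> f i \<in> R) \<Longrightarrow> \<phi> (sum f I) = (\<Sum>i\<in>I. \<phi> (f i))"
    by (induction I rule: infinite_finite_induct) (auto simp: 5 1 subring_set_sum[OF assms(3)])
  show "x \<in> R \<Longrightarrow> \<phi> (x ^ n) = \<phi> x ^ n" by (induction n) (auto simp: 6 2 r)
qed

lemma poly_in_ideal: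
  assumes "ideal_of UNIV P" "\<And>i. coeff p i \<in> P"
  shows "poly p x \<in> P"
  unfolding poly_altdef using assms
  using ideal_ofD(4)[OF assms(1), of "x ^ _"]
  by (intro ideal_sum[OF assms(1)]) (auto simp: mult.commute)

text \<open>A point of \<open>R\<close> extends to \<open>R[x]\<close> by \<open>x \<mapsto> c\<close> as soon as \<open>c\<close> is a root of all
  relations satisfied by \<open>x\<close>.\<close>

lemma point_on_adjoin:
  assumes k: "k_algebra scale" and R: "subring_set R" "range (\<lambda>c. scale c 1) \<subseteq> R"
    and P: "prime_set P" and \<phi>: "point_on scale P R \<phi>"
    and rel: "\<And>q. q \<in> polys_over R \<Longrightarrow> poly q x \<in> P \<Longrightarrow> poly (map_poly \<phi> q) c = 0"
  shows "\<exists>\<psi>. point_on scale P (adjoin R x) \<psi> \<and> (\<forall>q\<in>polys_over R. \<psi> (poly q x) = poly (map_poly \<phi> q) c) \<and> (\<forall>a\<in>R. \<psi> a = \<phi> a)"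
proof -
  note p = point_onD[OF \<phi> k R] and r = polys_over_closed[OF R(1)]
  have inR: "q \<in> polys_over R \<Longrightarrow> coeff q i \<in> R" for q i by (auto simp: polys_over_def)
  have madd: "map_poly \<phi> (q + q') = map_poly \<phi> q + map_poly \<phi> q'"
    and mmult: "map_poly \<phi> (q * q') = map_poly \<phi> q * map_poly \<phi> q'"
    and mdiff: "map_poly \<phi> (q - q') = map_poly \<phi> q - map_poly \<phi> q'"
    if "q \<in> polys_over R" "q' \<in> polys_over R" for q q'
    using that inR by (auto intro!: poly_eqI simp: coeff_map_poly p coeff_mult subring_setD[OF R(1)])
  define \<psi> where "\<psi> y = poly (map_poly \<phi> (SOME q. q \<in> polys_over R \<and> poly q x = y)) c" for y
  have \<psi>: "\<psi> (poly q x) = poly (map_poly \<phi> q) c" if "q \<in> polys_over R" for q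
  proof -
    define q' where "q' = (SOME q'. q' \<in> polys_over R \<and> poly q' x = poly q x)"
    have q': "q' \<in> polys_over R \<and> poly q' x = poly q x" unfolding q'_def by (rule someI[of _ q]) (use that in auto)
    then have "poly (map_poly \<phi> (q' - q)) c = 0" using that by (intro rel r) (auto simp: prime_setD[OF P])
    then show ?thesis using q' that by (simp add: mdiff \<psi>_def flip: q'_def)
  qed
  have const: "\<psi> a = \<phi> a" if "a \<in> R" for a
    using \<psi>[OF r(6)[OF that, of 0]] by (simp add: poly_monom map_poly_monom p)
  show ?thesis
  proof (intro exI[of _ \<psi>] conjI ballI)
    show "point_on scale P (adjoin R x) \<psi>"
      unfolding point_on_def
    proof (intro conjI ballI allI)
      fix a b assume "a \<in> adjoin R x" "b \<in> adjoin R x"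
      then obtain q q' where q: "q \<in> polys_over R" "q' \<in> polys_over R" "a = poly q x" "b = poly q' x"
        by (auto simp: adjoin_def)
      show "\<psi> (a + b) = \<psi> a + \<psi> b" using \<psi>[OF r(2)[OF q(1,2)]] q by (simp add: \<psi> madd)
      show "\<psi> (a * b) = \<psi> a * \<psi> b" using \<psi>[OF r(7)[OF q(1,2)]] q by (simp add: \<psi> mmult)
    next
      fix c show "\<psi> (scale c 1) = c" using R(2) by (subst const) (auto simp: p)
    next
      fix a assume "a \<in> adjoin R x \<inter> P"
      then obtain q where q: "q \<in> polys_over R" "a = poly q x" "a \<in> P" by (auto simp: adjoin_def)
      then show "\<psi> a = 0" using rel by (simp add: \<psi>)
    qed
  qed (use \<psi> const in auto)
qed

text \<open>Dropping leading terms with coefficients in \<open>P\<close>: modulo \<open>P\<close>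
  a polynomial is zero or has a nonzero leading coefficient.\<close>

lemma truncate_mod:
  assumes R: "subring_set R" and P: "prime_set P" and "q \<in> polys_over R"
  shows "(\<forall>i. coeff q i \<in> P) \<or>
    (\<exists>q'\<in>polys_over R. degree q' \<le> degree q \<and> lead_coeff q' \<notin> P \<and> poly q x - poly q' x \<in> P)"
  using assms(3)
proof (induction "degree q" arbitrary: q rule: less_induct)
  case less
  note c = polys_over_closed[OF R] and pd = prime_setD[OF P]
  show ?case
  proof (cases "lead_coeff q \<in> P")
    case False
    then show ?thesis using less.prems by (intro disjI2 bexI[of _ q]) (auto simp: pd)
  next
    case lc: True
    show ?thesis
    proof (cases "degree q = 0")
      case True
      then have "coeff q i \<in> P" for i using lc by (cases i) (auto simp: pd coeff_eq_0)
      then show ?thesis by blast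
    next
      case False
      define m where "m = monom (lead_coeff q) (degree q)"
      define q1 where "q1 = q - m"
      have q1: "q1 \<in> polys_over R"
        unfolding q1_def m_def using less.prems by (intro c) (auto simp: polys_over_def)
      have "degree q1 \<le> degree q" by (auto simp: q1_def m_def intro!: degree_diff_le degree_monom_le)
      moreover have "coeff q1 (degree q) = 0" by (simp add: q1_def m_def)
      ultimately have deg: "degree q1 < degree q" using degree_less_of_coeff_0[of q1 "degree q"] False by auto
      have mP: "poly m x \<in> P" using lc by (simp add: m_def poly_monom pd)
      have *: "poly q x - y \<in> P" if "poly q1 x - y \<in> P" for y
        using pd(3)[OF that mP] by (simp add: q1_def algebra_simps)
      have "coeff q i \<in> P" if "\<forall>i. coeff q1 i \<in> P" for i
        using that[THEN spec, of i] lc by (auto simp: q1_def m_def split: if_splits)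
      then show ?thesis using less.hyps[OF deg q1] * deg
        by (elim disjE bexE conjE) (blast intro: less_imp_le order_trans)+
    qed
  qed
qed

text \<open>Pseudo-division with a quotient and a remainder that have coefficients in
  \<open>R\<close>.\<close>

lemma pseudo_division_over:
  assumes R: "subring_set R" and w: "w \<in> polys_over R" "degree w > 0" and p: "p \<in> polys_over R"
  shows "\<exists>n u v. u \<in> polys_over R \<and> v \<in> polys_over R \<and> degree v < degree w \<and>
    smult (lead_coeff w ^ n) p = w * u + v"
  using p
proof (induction "degree p" arbitrary: p rule: less_induct)
  case less
  note c = polys_over_closed[OF R]
  show ?case
  proof (cases "degree p < degree w")
    case True
    then show ?thesis using less.prems c(1) by (intro exI[of _ 0] exI[of _ p]) auto
  next
    case False
    define m where "m = monom (lead_coeff p) (degree p - degree w)"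
    define p1 where "p1 = smult (lead_coeff w) p - m * w"
    have lc: "lead_coeff p \<in> R" "lead_coeff w \<in> R" using less.prems w by (auto simp: polys_over_def)
    have m: "m \<in> polys_over R" unfolding m_def by (intro c lc)
    have p1: "p1 \<in> polys_over R" unfolding p1_def by (intro c lc m w less.prems)
    have "degree (m * w) \<le> degree p"
      using degree_mult_le[of m w] degree_monom_le[of "lead_coeff p" "degree p - degree w"] False by (simp add: m_def)
    then have "degree p1 \<le> degree p" unfolding p1_def by (intro degree_diff_le degree_smult_le)
    moreover have "coeff p1 (degree p) = 0" using False by (simp add: p1_def m_def coeff_monom_mult)
    ultimately have "degree p1 < degree p" using degree_less_of_coeff_0[of p1 "degree p"] False w(2) by auto
    from less.hyps[OF this p1] obtain n u v where *: "u \<in> polys_over R" "v \<in> polys_over R" "degree v < degree w"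
      "smult (lead_coeff w ^ n) p1 = w * u + v" by blast
    have "smult (lead_coeff w ^ Suc n) p = w * (smult (lead_coeff w ^ n) m + u) + v"
    proof -
      have "smult (lead_coeff w ^ Suc n) p = smult (lead_coeff w ^ n) p1 + smult (lead_coeff w ^ n) (m * w)"
        by (simp add: p1_def smult_diff_right mult.commute)
      then show ?thesis using * by (simp add: algebra_simps)
    qed
    moreover have "smult (lead_coeff w ^ n) m + u \<in> polys_over R" 
      by (rule c(2)[OF c(5)[OF subring_setD(7)[OF R lc(2)] m] *(1)])
    ultimately show ?thesis using *(2,3) by (intro exI conjI)
  qed
qed

text \<open>If \<open>p\<close> is a relation of minimal degree of \<open>x\<close> over \<open>R/P\<close> and \<open>s = q(x)\<close> is nonzero, then some
  nonzero multiple of \<open>s\<close> lies in \<open>R/P\<close>: a polynomial of minimal degree with value in the ideal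
  generated by \<open>s\<close> divides \<open>p\<close> and \<open>q\<close> up to constants.\<close>

lemma multiple_in_base:
  assumes R: "subring_set R" and P: "prime_set P"
    and p: "p \<in> polys_over R" "poly p x \<in> P" "lead_coeff p \<notin> P"
    and min: "\<And>q. q \<in> polys_over R \<Longrightarrow> poly q x \<in> P \<Longrightarrow> degree q < degree p \<Longrightarrow> (\<forall>i. coeff q i \<in> P)"
    and s: "s \<in> adjoin R x" "s \<notin> P"
  shows "\<exists>b\<in>R - P. \<exists>v\<in>adjoin R x. b - v * s \<in> P"
proof -
  note c = polys_over_closed[OF R] and pd = prime_setD[OF P] and r = subring_setD[OF R]
  note S = subring_adjoin[OF R, of x] and a = subring_setD[OF subring_adjoin(1)[OF R, of x]]
  have ev: "poly q x \<in> adjoin R x" if "q \<in> polys_over R" for q using that by (auto simp: adjoin_def)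
  obtain q where q: "q \<in> polys_over R" "s = poly q x" using s by (auto simp: adjoin_def)
  have IP: "ideal_of UNIV P" using P by (simp add: prime_set_def)
  have allP: "poly f x \<in> P" if "\<forall>i. coeff f i \<in> P" for f
    using that P by (intro poly_in_ideal) (auto simp: prime_set_def)
  define W where "W = {w \<in> polys_over R. lead_coeff w \<notin> P \<and> (\<exists>v\<in>adjoin R x. poly w x - v * s \<in> P)}"
  have "\<exists>w. w \<in> W"
  proof -
    obtain q' where "q' \<in> polys_over R" "lead_coeff q' \<notin> P" "poly q x - poly q' x \<in> P"
      using truncate_mod[OF R P q(1), of x] allP s q by auto
    then show ?thesis using pd(9)[of "poly q x - poly q' x"] a(1) q
      by (intro exI[of _ q']) (auto simp: W_def intro!: bexI[of _ 1])
  qed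
  then obtain w where w: "w \<in> W" and wmin: "\<And>w'. w' \<in> W \<Longrightarrow> degree w \<le> degree w'"
    using ex_has_least_nat[of "\<lambda>w. w \<in> W" _ degree] by blast
  then obtain v where v: "v \<in> adjoin R x" "poly w x - v * s \<in> P" "w \<in> polys_over R" "lead_coeff w \<notin> P"
    by (auto simp: W_def)
  have low: "\<forall>i. coeff f i \<in> P" if f: "f \<in> polys_over R" "degree f < degree w" and u: "u \<in> adjoin R x" "poly f x - u * s \<in> P" for f u
  proof (rule ccontr)
    assume "\<not> ?thesis"
    then obtain f' where f': "f' \<in> polys_over R" "degree f' \<le> degree f" "lead_coeff f' \<notin> P" "poly f x - poly f' x \<in> P"
      using truncate_mod[OF R P f(1), of x] by blast
    have "poly f' x - u * s \<in> P" using pd(4)[OF u(2) f'(4)] by simp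
    then have "f' \<in> W" using f' u by (auto simp: W_def)
    then show False using wmin f' f(2) by fastforce
  qed
  have lw: "lead_coeff w ^ n \<notin> P" for n using v(4) pd(8) by blast
  show ?thesis
  proof (cases "degree w = 0")
    case True
    then have "poly w x = lead_coeff w" by (elim degree_eq_zeroE) simp
    then show ?thesis using v by (intro bexI[of _ "lead_coeff w"] bexI[of _ v]) (auto simp: polys_over_def)
  next
    case False
    then have dw: "degree w > 0" by simp
    \<comment> \<open>a pseudo-remainder modulo \<open>w\<close> of a relation of \<open>x\<close> or of \<open>q\<close> vanishes modulo \<open>P\<close>\<close>
    have div: "\<exists>n u f. u \<in> polys_over R \<and> degree f < degree w \<and> (\<forall>i. coeff f i \<in> P) \<and> smult (lead_coeff w ^ n) g = w * u + f"
      if g: "g \<in> polys_over R" "t \<in> adjoin R x" "poly g x - t * s \<in> P" for g t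
    proof -
      obtain n u f where *: "u \<in> polys_over R" "f \<in> polys_over R" "degree f < degree w" "smult (lead_coeff w ^ n) g = w * u + f"
        using pseudo_division_over[OF R v(3) dw g(1)] by blast
      define t' where "t' = lead_coeff w ^ n * t - poly u x * v"
      have "lead_coeff w \<in> R" using v(3) by (auto simp: polys_over_def)
      then have t': "t' \<in> adjoin R x" unfolding t'_def using S(2) by (intro a ev * v g) auto
      have "poly f x = lead_coeff w ^ n * poly g x - poly w x * poly u x"
        using arg_cong[OF *(4), of "\<lambda>h. poly h x"] by simp
      then have "poly f x - t' * s = lead_coeff w ^ n * (poly g x - t * s) - poly u x * (poly w x - v * s)"
        by (simp add: t'_def algebra_simps)
      also have "\<dots> \<in> P" using pd g(3) v(2) by blast
      finally have "\<forall>i. coeff f i \<in> P" using low[OF *(2,3) t'] by blast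
      with * show ?thesis by blast
    qed
    have dwp: "degree w \<le> degree p"
      using p wmin[of p] a(2) by (force simp: W_def)
    obtain n u f where u: "u \<in> polys_over R" "degree f < degree w" "\<forall>i. coeff f i \<in> P"
      "smult (lead_coeff w ^ n) p = w * u + f"
      using div[of p 0] p a(2) by auto
    have "lead_coeff w ^ n * lead_coeff p = coeff (w * u) (degree p)"
      using arg_cong[OF u(4), of "\<lambda>h. coeff h (degree p)"] u(2) dwp by (simp add: coeff_eq_0)
    then have nz: "coeff (w * u) (degree p) \<notin> P" using lw p(3) pd(7) by metis
    have "poly w x \<in> P"
    proof (rule ccontr)
      assume nw: "poly w x \<notin> P"
      have "poly w x * poly u x + poly f x \<in> P"
        using arg_cong[OF u(4), of "\<lambda>h. poly h x"] p(2) pd(5) by (metis poly_add poly_mult poly_smult)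
      then have "poly w x * poly u x \<in> P" using pd(4) allP[OF u(3)] by fastforce
      then have uP: "poly u x \<in> P" using nw pd(7) by blast
      obtain u' where u': "\<forall>i. coeff (u - u') i \<in> P" "degree u' < degree p \<or> u' = 0" "u' \<in> polys_over R"
      proof
        define u' where "u' = (\<Sum>i\<le>degree p - degree w. monom (coeff u i) i)"
        have cu': "coeff u' i = (if i \<le> degree p - degree w then coeff u i else 0)" for i
          by (simp add: u'_def coeff_sum)
        show "u' \<in> polys_over R" using u(1) r(2) by (auto simp: polys_over_def cu')
        have "degree u' \<le> degree p - degree w" by (intro degree_le) (auto simp: cu')
        then show "degree u' < degree p \<or> u' = 0" using dw dwp by auto
        \<comment> \<open>the coefficients of \<open>u\<close> in degrees above \<open>degree p - degree w\<close> vanish modulo \<open>P\<close>\<close>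
        have high: "coeff u i \<in> P" if "i > degree p - degree w" for i
        proof (rule ccontr)
          assume ni: "coeff u i \<notin> P"
          have "{j. coeff u j \<notin> P} \<subseteq> {..degree u}"
            using le_degree[of u] pd(1) by (metis (mono_tags, lifting) atMost_iff mem_Collect_eq subsetI)
          then have "finite {j. coeff u j \<notin> P}" by (rule finite_subset) simp
          define j where "j = Max {j. coeff u j \<notin> P}"
          have j: "coeff u j \<notin> P" "\<And>l. l > j \<Longrightarrow> coeff u l \<in> P" "j \<ge> i"
            using ni Max_in[OF \<open>finite _\<close>] Max_ge[OF \<open>finite _\<close>] by (auto simp: j_def not_le[symmetric])
          have eq: "coeff (w * u) (degree w + j) = lead_coeff w * coeff u j + (\<Sum>l\<in>{..degree w + j} - {degree w}. coeff w l * coeff u (degree w + j - l))"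
            by (simp add: coeff_mult sum.remove[of _ "degree w"])
          have S: "(\<Sum>l\<in>{..degree w + j} - {degree w}. coeff w l * coeff u (degree w + j - l)) \<in> P"
          proof (rule ideal_sum[of UNIV])
            show "ideal_of UNIV P" using P by (simp add: prime_set_def)
            fix l assume l: "l \<in> {..degree w + j} - {degree w}"
            show "coeff w l * coeff u (degree w + j - l) \<in> P"
            proof (cases "l < degree w")
              case True then show ?thesis using l by (intro pd(5) j(2)) auto
            next
              case False then show ?thesis using l by (simp add: coeff_eq_0 pd)
            qed
          qed
          have "coeff (w * u) (degree w + j) \<in> P"
          proof -
            have "degree w + j > degree p" using j(3) that dwp by linarith
            then have "coeff (w * u + f) (degree w + j) = 0" unfolding u(4)[symmetric]
              by (simp add: coeff_eq_0)
            then show ?thesis using u(3) pd(4)[OF pd(1), of "coeff f (degree w + j)"]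
              by (simp add: add_eq_0_iff2)
          qed
          from pd(4)[OF this S] have "lead_coeff w * coeff u j \<in> P" by (simp add: eq)
          then show False using pd(7) v(4) j(1) by blast
        qed
        then show "\<forall>i. coeff (u - u') i \<in> P" by (auto simp: cu' pd)
      qed
      have "poly u' x \<in> P" using pd(4)[OF uP allP[OF u'(1)]] by simp
      then have "coeff u' i \<in> P" for i using min[OF u'(3)] u'(2) pd(1) by (auto split: if_splits)
      then have uc: "coeff u i \<in> P" for i using pd(3)[of "coeff (u - u') i" "coeff u' i"] u'(1) by simp
      have "coeff (w * u) (degree p) \<in> P"
        unfolding coeff_mult by (rule ideal_sum[OF IP]) (rule pd(5)[OF uc])
      with nz show False by blast
    qed
    obtain n u f where u: "u \<in> polys_over R" "\<forall>i. coeff f i \<in> P" "smult (lead_coeff w ^ n) q = w * u + f"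
      using div[OF q(1) a(1)] q pd(1) by auto
    have "lead_coeff w ^ n * s = poly w x * poly u x + poly f x"
      using arg_cong[OF u(3), of "\<lambda>h. poly h x"] q by simp
    also have "\<dots> \<in> P" by (rule pd(3)[OF pd(6)[OF \<open>poly w x \<in> P\<close>] allP[OF u(2)]])
    finally show ?thesis using lw s pd(7) by blast
  qed
qed

text \<open>The points of a finitely generated domain are dense. This is the inductive step of the
  Nullstellensatz.\<close>

lemma extend_point:
  fixes scale :: "'k::{alg_closed_field, field_char_0} \<Rightarrow> 'a::comm_ring_1 \<Rightarrow> 'a"
  assumes k: "k_algebra scale" and R: "subring_set R" "range (\<lambda>c. scale c 1) \<subseteq> R"
    and P: "prime_set P"
    and IH: "\<And>r. r \<in> R - P \<Longrightarrow> \<exists>\<phi>. point_on scale P R \<phi> \<and> \<phi> r \<noteq> 0"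
    and s: "s \<in> adjoin R x - P"
  shows "\<exists>\<phi>. point_on scale P (adjoin R x) \<phi> \<and> \<phi> s \<noteq> 0"
proof -
  note c = polys_over_closed[OF R(1)] and pd = prime_setD[OF P] and r = subring_setD[OF R(1)]
  have allP: "poly f x \<in> P" if "\<forall>i. coeff f i \<in> P" for f
    using that P by (intro poly_in_ideal) (auto simp: prime_set_def)
  have cR: "coeff f i \<in> R" if "f \<in> polys_over R" for f i using that by (auto simp: polys_over_def)
  obtain q where q: "q \<in> polys_over R" "s = poly q x" using s by (auto simp: adjoin_def)
  show ?thesis
  proof (cases "\<forall>f\<in>polys_over R. poly f x \<in> P \<longrightarrow> (\<forall>i. coeff f i \<in> P)")
    case True
    obtain i where i: "coeff q i \<notin> P" using allP s q by blast
    then obtain \<phi> where \<phi>: "point_on scale P R \<phi>" "\<phi> (coeff q i) \<noteq> 0" using IH cR[OF q(1)] by blast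
    note p = point_onD[OF \<phi>(1) k R]
    have "coeff (map_poly \<phi> q) i \<noteq> 0" using \<phi> by (simp add: coeff_map_poly p)
    then have "map_poly \<phi> q \<noteq> 0" by auto
    then obtain z where z: "poly (map_poly \<phi> q) z \<noteq> 0"
      using poly_roots_finite[of "map_poly \<phi> q"] infinite_UNIV_char_0[where ?'a='k] by (metis (mono_tags, lifting) ex_new_if_finite mem_Collect_eq)
    have "map_poly \<phi> f = 0" if "f \<in> polys_over R" "poly f x \<in> P" for f
      using True that cR by (intro poly_eqI) (auto simp: coeff_map_poly p)
    then obtain \<psi> where "point_on scale P (adjoin R x) \<psi>" "\<psi> (poly q x) = poly (map_poly \<phi> q) z"
      using point_on_adjoin[OF k R P \<phi>(1), of x z] q(1) by auto
    then show ?thesis using z q by auto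
  next
    case False
    define W where "W = {p \<in> polys_over R. poly p x \<in> P \<and> lead_coeff p \<notin> P}"
    from False obtain f where "f \<in> polys_over R" "poly f x \<in> P" "\<not> (\<forall>i. coeff f i \<in> P)" by blast
    then obtain f' where "f' \<in> polys_over R" "lead_coeff f' \<notin> P" "poly f x - poly f' x \<in> P"
      using truncate_mod[OF R(1) P, of f x] by blast
    then have "f' \<in> W" using pd(4)[OF \<open>poly f x \<in> P\<close>, of "poly f x - poly f' x"] by (auto simp: W_def)
    then obtain p where p: "p \<in> W" and pmin: "\<And>p'. p' \<in> W \<Longrightarrow> degree p \<le> degree p'"
      using ex_has_least_nat[of "\<lambda>w. w \<in> W" _ degree] by blast
    then have p: "p \<in> polys_over R" "poly p x \<in> P" "lead_coeff p \<notin> P" by (auto simp: W_def)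
    have min: "\<forall>i. coeff g i \<in> P" if g: "g \<in> polys_over R" "poly g x \<in> P" "degree g < degree p" for g
    proof (rule ccontr)
      assume "\<not> ?thesis"
      then obtain g' where g': "g' \<in> polys_over R" "degree g' \<le> degree g" "lead_coeff g' \<notin> P" "poly g x - poly g' x \<in> P"
        using truncate_mod[OF R(1) P g(1), of x] by blast
      then have "g' \<in> W" using pd(4)[OF g(2) g'(4)] by (auto simp: W_def)
      then show False using pmin g' g(3) by fastforce
    qed
    have dp: "degree p > 0"
    proof (rule ccontr)
      assume "\<not> ?thesis"
      then have "degree p = 0" by simp
      then have "poly p x = lead_coeff p" by (elim degree_eq_zeroE) simp
      then show False using p by simp
    qed
    obtain b v where b: "b \<in> R - P" "v \<in> adjoin R x" "b - v * s \<in> P"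
      using multiple_in_base[OF R(1) P p min] s by blast
    have "lead_coeff p * b \<in> R - P" using b cR[OF p(1)] p(3) pd(7) r(4) by blast
    then obtain \<phi> where \<phi>: "point_on scale P R \<phi>" "\<phi> (lead_coeff p * b) \<noteq> 0" using IH by blast
    note h = point_onD[OF \<phi>(1) k R]
    have nz: "\<phi> (lead_coeff p) \<noteq> 0" "\<phi> b \<noteq> 0" using \<phi>(2) b cR[OF p(1)] by (auto simp: h)
    have "coeff (map_poly \<phi> p) (degree p) \<noteq> 0" using nz by (simp add: coeff_map_poly h)
    then have "degree (map_poly \<phi> p) > 0" using dp le_degree order_less_le_trans by blast
    then obtain z where z: "poly (map_poly \<phi> p) z = 0" using alg_closed_imp_poly_has_root by blast
    have rel: "poly (map_poly \<phi> f) z = 0" if f: "f \<in> polys_over R" "poly f x \<in> P" for f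
    proof -
      obtain n u g where *: "u \<in> polys_over R" "g \<in> polys_over R" "degree g < degree p"
        "smult (lead_coeff p ^ n) f = p * u + g"
        using pseudo_division_over[OF R(1) p(1) dp f(1)] by blast
      have "poly g x = lead_coeff p ^ n * poly f x - poly p x * poly u x"
        using arg_cong[OF *(4), of "\<lambda>h. poly h x"] by simp
      also have "\<dots> \<in> P" using pd(4)[OF pd(5)[OF f(2)] pd(6)[OF p(2)]] .
      finally have g0: "map_poly \<phi> g = 0" using min[OF *(2) _ *(3)] cR[OF *(2)] by (intro poly_eqI) (auto simp: coeff_map_poly h)
      have "smult (\<phi> (lead_coeff p ^ n)) (map_poly \<phi> f) = map_poly \<phi> (smult (lead_coeff p ^ n) f)"
        using cR[OF f(1)] cR[OF p(1)] r(7) by (intro poly_eqI) (auto simp: coeff_map_poly h)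
      also have "\<dots> = map_poly \<phi> p * map_poly \<phi> u + map_poly \<phi> g"
        unfolding *(4) using cR[OF p(1)] cR[OF *(1)] cR[OF *(2)] r
        by (intro poly_eqI) (auto simp: coeff_map_poly h coeff_mult subring_set_sum[OF R(1)])
      finally have "\<phi> (lead_coeff p ^ n) * poly (map_poly \<phi> f) z = 0"
        using z g0 by (metis add.right_neutral mult_zero_left poly_mult poly_smult)
      then show ?thesis using nz cR[OF p(1)] by (simp add: h)
    qed
    obtain \<psi> where \<psi>: "point_on scale P (adjoin R x) \<psi>" "\<forall>a\<in>R. \<psi> a = \<phi> a"
      using point_on_adjoin[OF k R P \<phi>(1) rel] by blast
    note S = subring_adjoin[OF R(1), of x] and a = subring_setD[OF subring_adjoin(1)[OF R(1), of x]]
    have "range (\<lambda>c. scale c 1) \<subseteq> adjoin R x" using S R by blast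
    note y = point_onD[OF \<psi>(1) k S(1) this]
    have bS: "b \<in> adjoin R x" "v * s \<in> adjoin R x" using b S s a by auto
    have "\<psi> (b - v * s) = 0" using b bS a by (intro y) auto
    then have "\<phi> b = \<psi> v * \<psi> s" using bS b s \<psi> by (simp add: y)
    then show ?thesis using nz \<psi> by auto
  qed
qed

text \<open>The residue field of a finitely generated algebra at a maximal ideal \<open>m\<close>
  is \<open>k\<close>.\<close>

theorem Zariski_lemma:
  fixes scale :: "'k::{alg_closed_field, field_char_0} \<Rightarrow> 'a::comm_ring_1 \<Rightarrow> 'a"
  assumes k: "k_algebra scale" and fg: "finite S" "generated_subalgebra scale S = UNIV"
    and P: "prime_set m"
    and max: "\<And>x. x \<notin> m \<Longrightarrow> \<exists>y. x * y - 1 \<in> m"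
  shows "\<exists>\<phi>. point_on scale m UNIV \<phi> \<and> (\<forall>x. \<phi> x = 0 \<longleftrightarrow> x \<in> m)"
proof -
  have "\<forall>s\<in>UNIV - m. \<exists>\<phi>. point_on scale m UNIV \<phi> \<and> \<phi> s \<noteq> 0"
  proof (rule finitely_generated_induct[OF k fg, where P="\<lambda>R. \<forall>s\<in>R - m. \<exists>\<phi>. point_on scale m R \<phi> \<and> \<phi> s \<noteq> 0"])
    note K = k_algebra_scale[OF k]
    have m0: "c = 0" if "scale c 1 \<in> m" for c
    proof (rule ccontr)
      assume "c \<noteq> 0"
      then have "scale (inverse c) 1 * scale c 1 = 1" using K(2)[of "inverse c" c] by (simp add: K(3))
      then show False using prime_setD(2,5)[OF P] that by metis
    qed
    have inj: "c = d" if "scale c 1 = scale d 1" for c d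
      using m0[of "c - d"] that K(1)[of "c - d" d] prime_setD(1)[OF P] by simp
    define f where "f x = (THE c. x = scale c 1)" for x
    have f: "f (scale c 1) = c" for c unfolding f_def using inj by blast
    have f': "f (scale c 1 + scale d 1) = c + d" "f (scale c 1 * scale d 1) = c * d" for c d
      by (simp_all only: K(1,2)[symmetric] f)
    show "\<forall>s\<in>range (\<lambda>c. scale c 1) - m. \<exists>\<phi>. point_on scale m (range (\<lambda>c. scale c 1)) \<phi> \<and> \<phi> s \<noteq> 0"
    proof
      fix s assume "s \<in> range (\<lambda>c. scale c 1) - m"
      then have "f s \<noteq> 0" using prime_setD(1)[OF P] by (auto simp: f K(5))
      moreover have "point_on scale m (range (\<lambda>c. scale c 1)) f"
        unfolding point_on_def
      proof (intro conjI ballI allI)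
        fix x assume "x \<in> range (\<lambda>c. scale c 1) \<inter> m"
        then obtain c where "x = scale c 1" "scale c 1 \<in> m" by auto
        then show "f x = 0" using m0 f by simp
      qed (auto simp: f f')
      ultimately show "\<exists>\<phi>. point_on scale m (range (\<lambda>c. scale c 1)) \<phi> \<and> \<phi> s \<noteq> 0" by blast
    qed
  next
    fix R x assume R: "subring_set R" "range (\<lambda>c. scale c 1) \<subseteq> R" and IH: "\<forall>s\<in>R - m. \<exists>\<phi>. point_on scale m R \<phi> \<and> \<phi> s \<noteq> 0"
    show "\<forall>s\<in>adjoin R x - m. \<exists>\<phi>. point_on scale m (adjoin R x) \<phi> \<and> \<phi> s \<noteq> 0"
      by (intro ballI extend_point[OF k R P]) (use IH in auto)
  qed
  then obtain \<phi> where \<phi>: "point_on scale m UNIV \<phi>" using prime_setD(2)[OF P] by blast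
  note p = point_onD[OF \<phi> k subring_UNIV, simplified]
  have "x \<in> m" if "\<phi> x = 0" for x
  proof (rule ccontr)
    assume "x \<notin> m"
    then obtain y where "x * y - 1 \<in> m" using max by blast
    then have "\<phi> (x * y - 1) = 0" by (rule p)
    then show False using that by (simp add: p)
  qed
  then show ?thesis using \<phi> p by blast
qed

section \<open>Points of a smooth affine curve\<close>

text \<open>Krull's theorem, by Zorn's lemma.\<close>

lemma maximal_ideal_exists:
  assumes "ideal_of UNIV J" "1 \<notin> J"
  shows "\<exists>m. J \<subseteq> m \<and> ideal_of UNIV m \<and> 1 \<notin> m \<and> (\<forall>L. ideal_of UNIV L \<longrightarrow> m \<subseteq> L \<longrightarrow> 1 \<notin> L \<longrightarrow> L = m)"
proof -
  define \<A> where "\<A> = {L. ideal_of UNIV L \<and> 1 \<notin> L \<and> J \<subseteq> L}"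
  have "\<exists>m\<in>\<A>. \<forall>L\<in>\<A>. m \<subseteq> L \<longrightarrow> L = m"
  proof (rule subset_Zorn_nonempty)
    show "\<A> \<noteq> {}" using assms by (auto simp: \<A>_def)
    fix \<C> assume C: "\<C> \<noteq> {}" "subset.chain \<A> \<C>"
    then have sub: "\<And>L. L \<in> \<C> \<Longrightarrow> ideal_of UNIV L \<and> 1 \<notin> L \<and> J \<subseteq> L" and lin: "\<And>L L'. L \<in> \<C> \<Longrightarrow> L' \<in> \<C> \<Longrightarrow> L \<subseteq> L' \<or> L' \<subseteq> L"
      by (auto simp: \<A>_def subset_chain_def)
    have "x + y \<in> \<Union>\<C>" if xy: "x \<in> \<Union>\<C>" "y \<in> \<Union>\<C>" for x y
    proof -
      obtain L L' where L: "x \<in> L" "L \<in> \<C>" "y \<in> L'" "L' \<in> \<C>" using xy by auto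
      then have "(x \<in> L' \<and> y \<in> L') \<or> (x \<in> L \<and> y \<in> L)" using lin[of L L'] by auto
      then show ?thesis using L sub ideal_ofD(3) by (metis UnionI)
    qed
    moreover have "r * x \<in> \<Union>\<C>" if "x \<in> \<Union>\<C>" for r x
      using that sub ideal_ofD(4)[of UNIV] by (metis UNIV_I Union_iff)
    moreover have "0 \<in> \<Union>\<C>" using C(1) sub ideal_ofD(2)[of UNIV] by blast
    ultimately have "ideal_of UNIV (\<Union>\<C>)" by (simp add: ideal_of_def)
    then show "\<Union>\<C> \<in> \<A>" using sub C(1) by (auto simp: \<A>_def)
  qed
  then obtain m where "ideal_of UNIV m" "1 \<notin> m" "J \<subseteq> m" "\<forall>L\<in>\<A>. m \<subseteq> L \<longrightarrow> L = m"
    unfolding \<A>_def by blast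
  moreover from this have "\<forall>L. ideal_of UNIV L \<longrightarrow> m \<subseteq> L \<longrightarrow> 1 \<notin> L \<longrightarrow> L = m" by (auto simp: \<A>_def)
  ultimately show ?thesis by blast
qed

abbreviation (input) type_ring :: "'a::comm_ring_1 ring" where
  "type_ring \<equiv> ring_of_type_algebra"

lemma type_ring_simps [simp]:
  "carrier (type_ring :: 'a::comm_ring_1 ring) = UNIV"
  "monoid.mult type_ring = ((*) :: 'a::comm_ring_1 \<Rightarrow> 'a \<Rightarrow> 'a)"
  "ring.add type_ring = ((+) :: 'a::comm_ring_1 \<Rightarrow> 'a \<Rightarrow> 'a)"
  "\<one>\<^bsub>type_ring\<^esub> = (1::'a::comm_ring_1)" "\<zero>\<^bsub>type_ring\<^esub> = (0::'a::comm_ring_1)"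
  by (auto simp: ring_of_type_algebra_def fun_eq_iff)

lemma type_ring_a_inv [simp]: "\<ominus>\<^bsub>type_ring\<^esub> x = - (x::'a::comm_ring_1)"
proof -
  interpret ring "type_ring :: 'a ring" by (rule ring_from_type_algebra)
  show ?thesis using minus_equality[of "- x" x] by simp
qed

lemma type_ring_a_minus [simp]: "x \<ominus>\<^bsub>type_ring\<^esub> y = x - (y::'a::comm_ring_1)"
  by (simp add: a_minus_def)

lemma ideal_type_ring: "ideal L (type_ring :: 'a::comm_ring_1 ring) \<longleftrightarrow> ideal_of UNIV L"
proof
  assume "ideal L (type_ring :: 'a ring)"
  then interpret ideal L "type_ring :: 'a ring" .
  show "ideal_of UNIV L"
    unfolding ideal_of_def using additive_subgroup.zero_closed[OF additive_subgroup_axioms]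
      additive_subgroup.a_closed[OF additive_subgroup_axioms] I_l_closed by auto
next
  assume L: "ideal_of UNIV L"
  show "ideal L (type_ring :: 'a ring)"
  proof (rule idealI)
    show "ring (type_ring :: 'a ring)" by (rule ring_from_type_algebra)
    then interpret ring "type_ring :: 'a ring" .
    show "subgroup L (add_monoid (type_ring :: 'a ring))"
    proof
      fix x assume x: "x \<in> L"
      have "inv\<^bsub>add_monoid type_ring\<^esub> x = - x"
        using type_ring_a_inv[of x] by (simp add: a_inv_def)
      then show "inv\<^bsub>add_monoid type_ring\<^esub> x \<in> L"
        using ideal_of_minus(1)[OF subring_UNIV L x x] by simp
    qed (use ideal_ofD[OF L] in auto)
    fix a x :: 'a assume "a \<in> L"
    then show "x \<otimes>\<^bsub>type_ring\<^esub> a \<in> L" "a \<otimes>\<^bsub>type_ring\<^esub> x \<in> L"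
      using ideal_ofD(4)[OF L, of x a] by (simp_all add: mult.commute)
  qed
qed

lemma primeideal_type_ring:
  assumes "primeideal L (type_ring :: 'a::comm_ring_1 ring)"
  shows "prime_set L"
proof -
  interpret primeideal L "type_ring :: 'a ring" by fact
  have I: "ideal_of UNIV L" using is_ideal ideal_type_ring by blast
  have "1 \<notin> L"
    using I_notcarr ideal_ofD(4)[OF I, of _ 1] by auto
  then show ?thesis using I I_prime by (auto simp: prime_set_def)
qed

text \<open>A point of \<open>A\<close> is a \<open>k\<close>-algebra homomorphism \<open>ev : A \<rightarrow> k\<close>. The maximal ideals of a smooth
  affine curve are the kernels of points, by Zariski's lemma.\<close>

theorem smooth_affine_curve_point:
  fixes scale :: "'k::{alg_closed_field, field_char_0} \<Rightarrow> 'a::comm_ring_1 \<Rightarrow> 'a"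
  assumes A: "smooth_affine_curve scale" and J: "ideal_of UNIV J" "1 \<notin> J"
  obtains ev t P z where "point_on scale {} UNIV ev" "\<forall>x\<in>J. ev x = 0" "ev t = 0"
    "\<forall>x. ev x = 0 \<longrightarrow> (\<exists>a. x - a * t \<in> ideal_prod type_ring {x. ev x = 0} {x. ev x = 0})"
    "prime_set P" "\<forall>x\<in>P. ev x = 0" "ev z = 0" "z \<notin> P"
proof -
  have k: "k_algebra scale" using A by (simp add: smooth_affine_curve_def)
  obtain S where S: "finite S" "generated_subalgebra scale S = UNIV"
    using A by (auto simp: smooth_affine_curve_def)
  obtain m where m: "J \<subseteq> m" "ideal_of UNIV m" "1 \<notin> m" "\<And>L. ideal_of UNIV L \<Longrightarrow> m \<subseteq> L \<Longrightarrow> 1 \<notin> L \<Longrightarrow> L = m"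
    using maximal_ideal_exists[OF J] by auto
  have max: "maximalideal m (type_ring :: 'a ring)"
  proof (rule maximalidealI)
    show "ideal m (type_ring :: 'a ring)" using m(2) by (simp add: ideal_type_ring)
    show "carrier type_ring \<noteq> m" using m(3) by auto
    fix L :: "'a set" assume L: "ideal L (type_ring :: 'a ring)" "m \<subseteq> L"
    then have L': "ideal_of UNIV L" by (simp add: ideal_type_ring)
    show "L = m \<or> L = carrier type_ring"
    proof (cases "1 \<in> L")
      case True
      then have "x \<in> L" for x using ideal_ofD(4)[OF L', of x 1] by simp
      then show ?thesis by auto
    next
      case False then show ?thesis using m(4) L' L(2) by blast
    qed
  qed
  have "primeideal m (type_ring :: 'a ring)"
    using cring.maximalideal_prime[OF cring_from_type_algebra max] .
  then have pm: "prime_set m" by (rule primeideal_type_ring)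
  have inv: "\<exists>y. x * y - 1 \<in> m" if "x \<notin> m" for x
  proof -
    define L where "L = {a + x * b | a b. a \<in> m}"
    have "ideal_of UNIV L"
      unfolding ideal_of_def
    proof (intro conjI ballI)
      show "0 \<in> L" unfolding L_def using ideal_ofD(2)[OF m(2)] by (intro CollectI exI[of _ 0]) auto
      fix p q assume "p \<in> L" "q \<in> L"
      then obtain a b a' b' where *: "p = a + x * b" "q = a' + x * b'" "a \<in> m" "a' \<in> m" by (auto simp: L_def)
      then show "p + q \<in> L" unfolding L_def
        by (intro CollectI exI[of _ "a + a'"] exI[of _ "b + b'"]) (auto simp: algebra_simps intro: ideal_ofD[OF m(2)])
    next
      fix r p assume "p \<in> L"
      then obtain a b where *: "p = a + x * b" "a \<in> m" by (auto simp: L_def)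
      then show "r * p \<in> L" unfolding L_def
        using ideal_ofD(4)[OF m(2), of r a]
        by (intro CollectI exI[of _ "r * a"] exI[of _ "r * b"]) (auto simp: algebra_simps)
    qed simp
    moreover have "m \<subseteq> L"
    proof
      fix a assume "a \<in> m"
      then show "a \<in> L" unfolding L_def by (intro CollectI exI[of _ a] exI[of _ 0]) simp
    qed
    moreover have "x \<in> L" unfolding L_def using ideal_ofD(2)[OF m(2)] by (intro CollectI exI[of _ 0] exI[of _ 1]) simp
    ultimately have "1 \<in> L" using m(4) that by blast
    then obtain a b where "1 = a + x * b" "a \<in> m" by (auto simp: L_def)
    then have "x * b - 1 = - a" by (simp add: algebra_simps)
    then show ?thesis using prime_setD(9)[OF pm \<open>a \<in> m\<close>] by metis
  qed
  obtain ev where ev: "point_on scale m UNIV ev" "\<And>x. ev x = 0 \<longleftrightarrow> x \<in> m"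
    using Zariski_lemma[OF k S pm inv] by blast
  have m_eq: "{x. ev x = 0} = m" using ev(2) by auto
  have ht: "ideal_height (type_ring :: 'a ring) m = 1" and cot: "cotangent_line (type_ring :: 'a ring) m"
    using A max by (auto simp: smooth_affine_curve_def)
  obtain t where t: "t \<in> m" "\<And>x. x \<in> m \<Longrightarrow> \<exists>a. x - a * t \<in> ideal_prod type_ring m m"
    using cot by (auto simp: cotangent_line_def)
  define H where "H = {enat n | n. \<exists>p. (\<forall>i\<le>n. primeideal (p i) (type_ring :: 'a ring)) \<and> (\<forall>i<n. p i \<subset> p (Suc i)) \<and> p n = m}"
  have "\<not> (\<forall>h\<in>H. h \<le> 0)"
  proof
    assume "\<forall>h\<in>H. h \<le> 0"
    then have "Sup H \<le> 0" by (intro Sup_least) auto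
    then show False using ht by (simp add: ideal_height_def H_def)
  qed
  then obtain n p where p: "n > 0" "\<forall>i\<le>n. primeideal (p i) (type_ring :: 'a ring)" "\<forall>i<n. p i \<subset> p (Suc i)" "p n = m"
    by (auto simp: H_def zero_enat_def)
  define P where "P = p (n - 1)"
  have "prime_set P" "P \<subset> m"
    using p(1,2,4) primeideal_type_ring[of P] p(3)[rule_format, of "n - 1"] by (auto simp: P_def)
  then obtain z where "prime_set P" "\<And>x. x \<in> P \<Longrightarrow> x \<in> m" "z \<in> m" "z \<notin> P" by blast
  then show ?thesis
    using that[of ev t P z] ev t m m_eq by (auto simp: point_on_def)
qed

section \<open>The tensor square and its double derivations\<close>

text \<open>Homomorphisms of abelian groups.\<close>

definition additive_map :: "('a::ab_group_add \<Rightarrow> 'b::ab_group_add) \<Rightarrow> bool" where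
  "additive_map F \<longleftrightarrow> (\<forall>p q. F (p + q) = F p + F q)"

lemma additive_mapD:
  assumes "additive_map F"
  shows "F (p + q) = F p + F q" "F 0 = 0" "F (- p) = - F p" "F (p - q) = F p - F q"
    "F (sum f I) = (\<Sum>i\<in>I. F (f i))"
proof -
  show 1: "F (p + q) = F p + F q" for p q using assms by (simp add: additive_map_def)
  show 2: "F 0 = 0" using 1[of 0 0] by simp
  show 3: "F (- p) = - F p" for p using 1[of p "- p"] 2 by (simp add: eq_neg_iff_add_eq_0 add.commute)
  show "F (p - q) = F p - F q" using 1[of p "- q"] 3 by simp
  show "F (sum f I) = (\<Sum>i\<in>I. F (f i))" by (induction I rule: infinite_finite_induct) (auto simp: 1 2)
qed

text \<open>The biadditive maps that factor through \<open>A \<otimes>\<^sub>k A\<close>. Since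
  \<open>k\<close> acts through \<open>A\<close>, no scalars are needed on the target.\<close>

definition balanced :: "('k \<Rightarrow> 'a \<Rightarrow> 'a) \<Rightarrow> ('a::ab_group_add \<Rightarrow> 'a \<Rightarrow> 'c::ab_group_add) \<Rightarrow> bool" where
  "balanced scale f \<longleftrightarrow> (\<forall>x x' y. f (x + x') y = f x y + f x' y) \<and>
     (\<forall>x y y'. f x (y + y') = f x y + f x y') \<and> (\<forall>c x y. f (scale c x) y = f x (scale c y))"

text \<open>The tensor square \<open>A \<otimes>\<^sub>k A\<close> inside a commutative ring, with
  its universal property for maps to \<open>A\<close> and to the ring itself. The class
  \<^class>\<open>comm_ring\<close> does not ask for a unit: the unit of the tensor square is
  \<open>tens 1 1\<close>.\<close>

locale tensor_square_model =
  fixes scale :: "'k::field \<Rightarrow> 'a::comm_ring_1 \<Rightarrow> 'a" and tens :: "'a \<Rightarrow> 'a \<Rightarrow> 'b::comm_ring"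
  assumes k: "k_algebra scale"
    and tens_balanced: "balanced scale tens"
    and tens_mult: "tens a b * tens c d = tens (a * c) (b * d)"
    and lift_alg: "balanced scale f \<Longrightarrow> \<exists>F::'b \<Rightarrow> 'a. additive_map F \<and> (\<forall>x y. F (tens x y) = f x y)"
    and lift_tens: "balanced scale h \<Longrightarrow> \<exists>F::'b \<Rightarrow> 'b. additive_map F \<and> (\<forall>x y. F (tens x y) = h x y)"
begin

lemmas K = k_algebra_scale[OF k]

lemma tens_add: "tens (x + x') y = tens x y + tens x' y" "tens x (y + y') = tens x y + tens x y'"
  and tens_scale: "tens (scale c x) y = tens x (scale c y)"
  using tens_balanced by (auto simp: balanced_def)

lemma tens_diff: "tens (x - x') y = tens x y - tens x' y" "tens x (y - y') = tens x y - tens x y'"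
  and tens_zero [simp]: "tens 0 y = 0" "tens x 0 = 0"
  and tens_minus: "tens (- x) y = - tens x y" "tens x (- y) = - tens x y"
proof -
  have *: "additive_map (\<lambda>x. tens x y)" "additive_map (tens x)" for x y
    by (auto simp: additive_map_def tens_add)
  show "tens (x - x') y = tens x y - tens x' y" "tens x (y - y') = tens x y - tens x y'"
    "tens 0 y = 0" "tens x 0 = 0" "tens (- x) y = - tens x y" "tens x (- y) = - tens x y"
    using additive_mapD[OF *(1)] additive_mapD[OF *(2)] by auto
qed

text \<open>The type of the values of \<open>tens\<close> may be larger than the tensor square, which is the span
  of the pure tensors.\<close>

inductive_set B :: "'b set" where
  zero: "0 \<in> B"
| step: "p \<in> B \<Longrightarrow> tens x y + p \<in> B"

lemma B_add: "p \<in> B \<Longrightarrow> q \<in> B \<Longrightarrow> p + q \<in> B"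
  by (induction rule: B.induct) (auto simp: add.assoc intro: B.intros)

lemma B_tens [simp]: "tens x y \<in> B"
  using B.step[OF B.zero, of x y] by simp

lemma B_minus: "p \<in> B \<Longrightarrow> - p \<in> B"
proof (induction rule: B.induct)
  case (step p x y)
  have "tens (- x) y + - p \<in> B" using step by (intro B.step)
  then show ?case by (simp add: tens_minus)
qed (simp add: B.zero)

lemma B_diff: "p \<in> B \<Longrightarrow> q \<in> B \<Longrightarrow> p - q \<in> B"
  using B_add[of p "- q"] B_minus[of q] by simp

lemma B_mult: "p \<in> B \<Longrightarrow> q \<in> B \<Longrightarrow> p * q \<in> B"
proof (induction rule: B.induct)
  case (step p x y)
  have "tens x y * q \<in> B" using step(3)
    by (induction rule: B.induct) (auto simp: algebra_simps tens_mult intro: B.zero B_add)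
  then show ?case using step by (auto simp: algebra_simps intro: B_add)
qed (simp add: B.zero)

lemma B_sum: "(\<And>i. i \<in> I \<Longrightarrow> f i \<in> B) \<Longrightarrow> sum f I \<in> B"
  by (induction I rule: infinite_finite_induct) (auto intro: B.zero B_add)

lemmas B_closed = B.zero B_tens B_add B_minus B_diff B_mult

lemma tens_unit: "p \<in> B \<Longrightarrow> tens 1 1 * p = p"
  by (induction rule: B.induct) (auto simp: algebra_simps tens_mult)

text \<open>The multiplication \<open>A \<otimes> A \<rightarrow> A\<close>, that is, the
  restriction to the diagonal.\<close>

definition tmult :: "'b \<Rightarrow> 'a" where
  "tmult = (SOME F. additive_map F \<and> (\<forall>x y. F (tens x y) = x * y))"

lemma tmult: "additive_map tmult" "tmult (tens x y) = x * y"
proof -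
  have "balanced scale (\<lambda>x y. x * y)"
    by (auto simp: balanced_def algebra_simps K(8,9)[symmetric])
  from someI_ex[OF lift_alg[OF this]] show "additive_map tmult" "tmult (tens x y) = x * y"
    by (auto simp: tmult_def)
qed

lemmas tmult_simps = additive_mapD[OF tmult(1)] tmult(2)

lemma tmult_mult: "p \<in> B \<Longrightarrow> q \<in> B \<Longrightarrow> tmult (p * q) = tmult p * tmult q"
proof (induction rule: B.induct)
  case (step p x y)
  have "tmult (tens x y * q) = x * y * tmult q" using step(3)
    by (induction rule: B.induct) (auto simp: algebra_simps tmult_simps tens_mult)
  then show ?case using step by (auto simp: algebra_simps tmult_simps)
qed (simp add: tmult_simps)

text \<open>The flip of the two factors.\<close>

definition tflip :: "'b \<Rightarrow> 'b" where
  "tflip = (SOME F. additive_map F \<and> (\<forall>x y. F (tens x y) = tens y x))"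

lemma tflip: "additive_map tflip" "tflip (tens x y) = tens y x"
proof -
  have "balanced scale (\<lambda>x y. tens y x)"
    by (auto simp: balanced_def tens_add tens_scale)
  from someI_ex[OF lift_tens[OF this]] show "additive_map tflip" "tflip (tens x y) = tens y x"
    by (auto simp: tflip_def)
qed

lemmas tflip_simps = additive_mapD[OF tflip(1)] tflip(2)

lemma tflip_B: "p \<in> B \<Longrightarrow> tflip p \<in> B"
  by (induction rule: B.induct) (auto simp: tflip_simps intro: B.intros)

lemma tflip_mult: "p \<in> B \<Longrightarrow> q \<in> B \<Longrightarrow> tflip (p * q) = tflip p * tflip q"
proof (induction rule: B.induct)
  case (step p x y)
  have "tflip (tens x y * q) = tens y x * tflip q" using step(3)
    by (induction rule: B.induct) (auto simp: algebra_simps tflip_simps tens_mult)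
  then show ?case using step by (auto simp: algebra_simps tflip_simps)
qed (simp add: tflip_simps)

lemma tflip_tflip: "p \<in> B \<Longrightarrow> tflip (tflip p) = p"
  by (induction rule: B.induct) (auto simp: tflip_simps)

lemma tmult_tflip: "p \<in> B \<Longrightarrow> tmult (tflip p) = tmult p"
  by (induction rule: B.induct) (auto simp: tflip_simps tmult_simps mult.commute)

text \<open>The values of the double derivation \<open>\<Delta>\<close>.\<close>

definition delta :: "'a \<Rightarrow> 'b" where
  "delta x = tens x 1 - tens 1 x"

lemma delta_B [simp]: "delta x \<in> B" by (simp add: delta_def B_diff)

lemma delta_add: "delta (x + y) = delta x + delta y"
  by (simp add: delta_def tens_add)

lemma delta_mult: "delta (x * y) = tens x 1 * delta y + tens 1 y * delta x"
  by (simp add: delta_def algebra_simps tens_mult)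

lemma delta_const: "delta (scale c 1) = 0"
  by (simp add: delta_def tens_scale)

lemma tmult_delta: "tmult (delta x) = 0"
  by (simp add: delta_def tmult_simps)

text \<open>The kernel of the multiplication is generated by the elements \<open>a \<otimes> 1 - 1 \<otimes> a\<close>.\<close>

lemma kernel_tmult:
  assumes "p \<in> B"
  shows "p - tens 1 (tmult p) \<in> span_over B (range delta)"
  using assms
proof induction
  case (step p x y)
  have "tens 1 y * delta x + (p - tens 1 (tmult p)) \<in> span_over B (range delta)"
    using step by (intro span_over.step) auto
  then show ?case by (simp add: delta_def algebra_simps tens_mult tens_add tmult_simps)
qed (simp add: span_over.zero tmult_simps)

lemma kernel_tmult_0: "p \<in> B \<Longrightarrow> tmult p = 0 \<Longrightarrow> p \<in> span_over B (range delta)"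
  using kernel_tmult[of p] by simp

text \<open>Double derivations. Since \<open>A\<close> is commutative, the outer action is
  multiplication by \<open>x \<otimes> y\<close> in the ring \<open>A \<otimes> A\<close>.\<close>

definition DD :: "('a \<Rightarrow> 'b) set" where
  "DD = {\<Theta>. (\<forall>x. \<Theta> x \<in> B) \<and> (\<forall>x y. \<Theta> (x + y) = \<Theta> x + \<Theta> y) \<and>
     (\<forall>c x. \<Theta> (scale c x) = tens (scale c 1) 1 * \<Theta> x) \<and>
     (\<forall>x y. \<Theta> (x * y) = tens x 1 * \<Theta> y + tens 1 y * \<Theta> x)}"

lemma DD_props:
  assumes "\<Theta> \<in> DD"
  shows "\<Theta> x \<in> B" "\<Theta> (x + y) = \<Theta> x + \<Theta> y" "\<Theta> (scale c x) = tens (scale c 1) 1 * \<Theta> x"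
    "\<Theta> (x * y) = tens x 1 * \<Theta> y + tens 1 y * \<Theta> x"
  using assms by (auto simp: DD_def)

lemma delta_DD: "delta \<in> DD"
proof -
  have "delta (scale c x) = tens (scale c 1) 1 * delta x" for c x
    by (simp add: delta_def right_diff_distrib tens_mult tens_scale K(4)[of c x, symmetric])
  then show ?thesis by (simp add: DD_def delta_add delta_mult)
qed

lemma DD_mult: "s \<in> B \<Longrightarrow> \<Theta> \<in> DD \<Longrightarrow> (\<lambda>x. s * \<Theta> x) \<in> DD"
  unfolding DD_def mem_Collect_eq
  using DD_props[of \<Theta>] by (auto simp: B_mult distrib_left mult.left_commute)

lemma DD_add: "\<Theta> \<in> DD \<Longrightarrow> \<Psi> \<in> DD \<Longrightarrow> (\<lambda>x. \<Theta> x + \<Psi> x) \<in> DD"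
  by (auto simp: DD_def algebra_simps intro: B_add)

text \<open>This is where commutativity of \<open>A\<close> enters.\<close>

lemma DD_proportional:
  assumes "\<Theta> \<in> DD"
  shows "\<Theta> x * delta y = \<Theta> y * delta x"
proof -
  have "tens x 1 * \<Theta> y + tens 1 y * \<Theta> x = tens y 1 * \<Theta> x + tens 1 x * \<Theta> y"
    using DD_props(4)[OF assms, of x y] DD_props(4)[OF assms, of y x] by (simp add: mult.commute)
  then show ?thesis by (simp add: delta_def algebra_simps)
qed

end

text \<open>Nakayama's lemma, in the form of an elimination of generators: \<open>U\<close> is multiplicative and
  \<open>U - M \<subseteq> U\<close>.\<close>

lemma Nakayama_elimination:
  fixes B :: "'b::comm_ring set"
  assumes W: "0 \<in> W" "\<And>x y. x \<in> W \<Longrightarrow> y \<in> W \<Longrightarrow> x + y \<in> W" "\<And>b x. b \<in> B \<Longrightarrow> x \<in> W \<Longrightarrow> b * x \<in> W"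
    and M: "M \<subseteq> B" "0 \<in> M" "\<And>b x. b \<in> B \<Longrightarrow> x \<in> M \<Longrightarrow> b * x \<in> M" "\<And>x y. x \<in> M \<Longrightarrow> y \<in> M \<Longrightarrow> x + y \<in> M"
    and U: "U \<subseteq> B" "U \<noteq> {}" "\<And>x y. x \<in> U \<Longrightarrow> y \<in> U \<Longrightarrow> x * y \<in> U" "\<And>u x. u \<in> U \<Longrightarrow> x \<in> M \<Longrightarrow> u - x \<in> U"
    and F: "finite F" "\<And>x. x \<in> F \<Longrightarrow> \<exists>u\<in>U. \<exists>w\<in>W. u * x - w \<in> span_over M F"
  shows "\<exists>u\<in>U. \<forall>x\<in>F. u * x \<in> W"
  using F
proof (induction F)
  case empty then show ?case using U(2) by auto
next
  case (insert z F)
  have split: "\<exists>c\<in>M. p - c * z \<in> span_over M F" if "p \<in> span_over M (insert z F)" for p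
    using that
  proof induction
    case zero show ?case using M(2) by (intro bexI[of _ 0]) (auto intro: span_over.zero)
  next
    case (step r x y)
    then obtain c where c: "c \<in> M" "y - c * z \<in> span_over M F" by blast
    show ?case
    proof (cases "x = z")
      case True
      have eq: "r * z + y - (r + c) * z = y - c * z" by (simp add: algebra_simps)
      show ?thesis unfolding True
        using step(1) c by (intro bexI[of _ "r + c"]) (simp_all only: eq M(4))
    next
      case False
      then have "r * x + (y - c * z) \<in> span_over M F" using step c by (intro span_over.step) auto
      then show ?thesis using c(1) by (intro bexI[of _ c]) (auto simp: algebra_simps)
    qed
  qed
  obtain uz wz where z: "uz \<in> U" "wz \<in> W" "uz * z - wz \<in> span_over M (insert z F)" using insert.prems by blast
  obtain c where c: "c \<in> M" "uz * z - wz - c * z \<in> span_over M F" using split[OF z(3)] by blast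
  define u' where "u' = uz - c"
  have u': "u' \<in> U" "u' * z - wz \<in> span_over M F" using z c U by (auto simp: u'_def algebra_simps)
  have "\<exists>u\<in>U. \<exists>w\<in>W. u * x - w \<in> span_over M F" if "x \<in> F" for x
  proof -
    obtain u w where x: "u \<in> U" "w \<in> W" "u * x - w \<in> span_over M (insert z F)" using insert.prems \<open>x \<in> F\<close> by blast
    obtain d where d: "d \<in> M" "u * x - w - d * z \<in> span_over M F" using split[OF x(3)] by blast
    have "u' * (u * x - w - d * z) + d * (u' * z - wz) \<in> span_over M F"
      using u' d M U(1) by (intro span_over_add span_over_mult_mem[of M _ M]) (auto dest: subsetD)
    then have "(u' * u) * x - (u' * w + d * wz) \<in> span_over M F" by (simp add: algebra_simps)
    moreover have "u' * w + d * wz \<in> W" using W u' x z d U(1) M(1) by blast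
    ultimately show ?thesis using U(3) u'(1) x(1) by blast
  qed
  then obtain u where u: "u \<in> U" "\<forall>x\<in>F. u * x \<in> W" using insert.IH by blast
  have spanW: "u * p \<in> W" if "p \<in> span_over M F" for p
    using that
  proof induction
    case (step r x y)
    have "r * (u * x) + u * y \<in> W" using step u W M(1) by blast
    then show ?case by (simp add: algebra_simps)
  qed (use W in simp)
  have "u * (u' * z - wz) + u * wz \<in> W" using spanW[OF u'(2)] W u(1) U(1) z(2) by blast
  then have "(u * u') * z \<in> W" by (simp add: algebra_simps)
  moreover have "(u * u') * x \<in> W" if "x \<in> F" for x
  proof -
    have "u' * (u * x) \<in> W" using W(3) u u'(1) U(1) \<open>x \<in> F\<close> by blast
    then show ?thesis by (simp add: algebra_simps)
  qed
  ultimately show ?case using U(3)[OF u(1) u'(1)] by blast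
qed

section \<open>Double derivations near a point of the diagonal\<close>

context tensor_square_model begin

sublocale vector_space scale
  using k by (simp add: k_algebra_def)

text \<open>Linear forms on \<open>A\<close>.\<close>

definition linear_form :: "('a \<Rightarrow> 'k) \<Rightarrow> bool" where
  "linear_form l \<longleftrightarrow> (\<forall>x y. l (x + y) = l x + l y) \<and> (\<forall>c x. l (scale c x) = c * l x)"

text \<open>\<open>l \<otimes> id : A \<otimes> A \<rightarrow> A\<close>.\<close>

definition contract :: "('a \<Rightarrow> 'k) \<Rightarrow> 'b \<Rightarrow> 'a" where
  "contract l = (SOME F. additive_map F \<and> (\<forall>x y. F (tens x y) = scale (l x) y))"

lemma contract:
  assumes "linear_form l"
  shows "additive_map (contract l)" "contract l (tens x y) = scale (l x) y"
proof -
  have "balanced scale (\<lambda>x y. scale (l x) y)"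
    using assms by (auto simp: balanced_def linear_form_def scale_left_distrib scale_right_distrib mult.commute)
  from someI_ex[OF lift_alg[OF this]]
  show "additive_map (contract l)" "contract l (tens x y) = scale (l x) y"
    by (auto simp: contract_def)
qed

text \<open>The contractions with the coordinate forms of a basis separate the elements of \<open>A \<otimes> A\<close>.\<close>

lemma contract_separates:
  assumes "p \<in> B" "\<And>l. linear_form l \<Longrightarrow> contract l p = 0"
  shows "p = 0"
proof -
  define E where "E = extend_basis {}"
  have E: "independent E" "span E = UNIV"
    unfolding E_def using independent_extend_basis[of "{}"] span_extend_basis[of "{}"] by (auto simp: independent_empty)
  define l where "l b x = representation E x b" for b x
  have form: "linear_form (l b)" for b
    using E by (auto simp: linear_form_def l_def representation_add representation_scale)
  have rep: "finite {b. l b x \<noteq> 0}" "{b. l b x \<noteq> 0} \<subseteq> E" "(\<Sum>b | l b x \<noteq> 0. scale (l b x) b) = x" for x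
    using E finite_representation[of E x] representation_ne_zero[of E x] sum_nonzero_representation_eq[of E x]
    by (auto simp: l_def)
  have "\<exists>F y. finite F \<and> F \<subseteq> E \<and> p = (\<Sum>b\<in>F. tens b (y b))"
    using assms(1)
  proof induction
    case zero show ?case by (intro exI[of _ "{}"]) auto
  next
    case (step p x z)
    then obtain F y where F: "finite F" "F \<subseteq> E" "p = (\<Sum>b\<in>F. tens b (y b))" by blast
    define G where "G = {b. l b x \<noteq> 0}"
    define y' where "y' b = scale (l b x) z + (if b \<in> F then y b else 0)" for b
    note [simp] = tens_add
    have G: "finite G" "G \<subseteq> E" using rep[of x] by (auto simp: G_def)
    have "tens x z = (\<Sum>b\<in>G. tens b (scale (l b x) z))"
    proof -
      have "tens x z = tens (\<Sum>b\<in>G. scale (l b x) b) z" using rep[of x] by (simp add: G_def)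
      also have "\<dots> = (\<Sum>b\<in>G. tens (scale (l b x) b) z)"
        by (rule additive_mapD(5)[of "\<lambda>x. tens x z"]) (simp add: additive_map_def)
      finally show ?thesis by (simp add: tens_scale)
    qed
    also have "\<dots> = (\<Sum>b\<in>F \<union> G. tens b (scale (l b x) z))"
      using F G by (intro sum.mono_neutral_left) (auto simp: G_def)
    finally have 1: "tens x z = (\<Sum>b\<in>F \<union> G. tens b (scale (l b x) z))" .
    have "p = (\<Sum>b\<in>F. tens b (if b \<in> F then y b else 0))" using F by simp
    also have "\<dots> = (\<Sum>b\<in>F \<union> G. tens b (if b \<in> F then y b else 0))"
      using F G by (intro sum.mono_neutral_left) auto
    finally have "tens x z + p = (\<Sum>b\<in>F \<union> G. tens b (y' b))"
      using 1 by (simp add: y'_def sum.distrib)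
    then show ?case using F G by blast
  qed
  then obtain F y where F: "finite F" "F \<subseteq> E" "p = (\<Sum>b\<in>F. tens b (y b))" by blast
  have "y b = 0" if "b \<in> F" for b
  proof -
    note c = contract[OF form[of b]]
    have lb: "l b b' = (if b = b' then 1 else 0)" if "b' \<in> F" for b'
      using representation_basis[OF E(1), of b'] that F(2) by (auto simp: l_def)
    have "contract (l b) p = (\<Sum>b'\<in>F. if b = b' then y b' else 0)"
      unfolding F(3) additive_mapD(5)[OF c(1)] by (intro sum.cong) (auto simp: c lb)
    then show ?thesis using assms(2)[OF form] F(1) that by simp
  qed
  then show ?thesis using F by simp
qed

text \<open>The contractions of a fixed tensor lie in a space of finite dimension.\<close>

lemma contract_finite_dim:
  assumes "p \<in> B"
  shows "\<exists>W. finite W \<and> (\<forall>l. linear_form l \<longrightarrow> contract l p \<in> span W)"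
  using assms
proof induction
  case zero
  show ?case by (intro exI[of _ "{}"]) (auto simp: additive_mapD contract)
next
  case (step p x y)
  then obtain W where W: "finite W" "\<And>l. linear_form l \<Longrightarrow> contract l p \<in> span W" by blast
  show ?case
  proof (intro exI[of _ "insert y W"] conjI allI impI)
    fix l assume l: "linear_form l"
    have "contract l p \<in> span (insert y W)" using W(2)[OF l] span_mono[of W "insert y W"] by blast
    then show "contract l (tens x y + p) \<in> span (insert y W)"
      unfolding additive_mapD(1)[OF contract(1)[OF l]] contract(2)[OF l]
      by (intro span_add span_scale) (auto intro: span_base)
  qed (use W in simp)
qed

lemma linear_dependence_of_sequence:
  fixes f :: "nat \<Rightarrow> 'a"
  assumes "finite W" "\<And>i. f i \<in> span W"
  shows "\<exists>n c. (\<exists>i\<le>n. c i \<noteq> 0) \<and> (\<Sum>i\<le>n. scale (c i) (f i)) = 0"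
proof (cases "inj_on f {..card W}")
  case False
  then obtain i j where ij: "i \<noteq> j" "i \<le> card W" "j \<le> card W" "f i = f j" by (auto simp: inj_on_def)
  define c where "c l = (if l = i then 1 else if l = j then - 1 else 0 :: 'k)" for l
  have "(\<Sum>l\<le>card W. scale (c l) (f l)) = (\<Sum>l\<in>{i, j}. scale (c l) (f l))"
    using ij by (intro sum.mono_neutral_right) (auto simp: c_def)
  also have "\<dots> = 0" using ij by (simp add: c_def)
  finally show ?thesis using ij by (intro exI[of _ "card W"] exI[of _ c]) (auto simp: c_def)
next
  case True
  then have card: "card (f ` {..card W}) = Suc (card W)" by (simp add: card_image)
  have "dependent (f ` {..card W})"
  proof (rule ccontr)
    assume "independent (f ` {..card W})"
    then have "card (f ` {..card W}) \<le> card W"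
      using independent_span_bound[OF assms(1)] assms(2) by blast
    then show False using card by simp
  qed
  then obtain u where u: "\<exists>v\<in>f ` {..card W}. u v \<noteq> 0" "(\<Sum>v\<in>f ` {..card W}. scale (u v) v) = 0"
    by (auto simp: dependent_finite)
  then show ?thesis using True
    by (intro exI[of _ "card W"] exI[of _ "u \<circ> f"]) (auto simp: sum.reindex)
qed

end

text \<open>A point \<open>x\<close>, given by the evaluation \<open>ev\<close>, at which the
  cotangent space is spanned by \<open>t\<close> and whose maximal ideal strictly contains a prime
  ideal \<open>P\<close>; the strictness is witnessed by \<open>z\<close>.\<close>

locale tensor_square_at_point = tensor_square_model scale tens
  for scale :: "'k::field \<Rightarrow> 'a::comm_ring_1 \<Rightarrow> 'a" and tens :: "'a \<Rightarrow> 'a \<Rightarrow> 'b::comm_ring" +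
  fixes S P :: "'a set" and ev :: "'a \<Rightarrow> 'k" and t z :: 'a
  assumes S: "finite S" "generated_subalgebra scale S = UNIV"
    and noetherian: "noetherian_set (UNIV :: 'a set)"
    and point: "point_on scale {} UNIV ev"
    and t: "ev t = 0" "\<And>x. ev x = 0 \<Longrightarrow> \<exists>a. x - a * t \<in> ideal_prod type_ring {x. ev x = 0} {x. ev x = 0}"
    and P: "prime_set P" "\<And>x. x \<in> P \<Longrightarrow> ev x = 0"
    and z: "ev z = 0" "z \<notin> P"
begin

lemma ev: "ev (x + y) = ev x + ev y" "ev (x * y) = ev x * ev y" "ev (scale c 1) = c" "ev 0 = 0" "ev 1 = 1"
  "ev (- x) = - ev x" "ev (x - y) = ev x - ev y" "ev (sum f I) = (\<Sum>i\<in>I. ev (f i))" "ev (x ^ n) = ev x ^ n"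
  "ev (scale c x) = c * ev x"
proof -
  note p = point_onD[OF point k subring_UNIV, simplified]
  show "ev (x + y) = ev x + ev y" "ev (x * y) = ev x * ev y" "ev (scale c 1) = c" "ev 0 = 0" "ev 1 = 1"
    "ev (- x) = - ev x" "ev (x - y) = ev x - ev y" "ev (sum f I) = (\<Sum>i\<in>I. ev (f i))" "ev (x ^ n) = ev x ^ n"
    by (simp_all add: p)
  show "ev (scale c x) = c * ev x" by (subst K(4)) (simp add: p)
qed

text \<open>The elements of \<open>A \<otimes> A\<close> that vanish at \<open>(x, x)\<close>,
  respectively do not.\<close>

definition M :: "'b set" where "M = {p \<in> B. ev (tmult p) = 0}"
definition U :: "'b set" where "U = {p \<in> B. ev (tmult p) \<noteq> 0}"

text \<open>Near the point \<open>(x, x)\<close> the ideal of the diagonal is generated by \<open>t \<otimes> 1 - 1 \<otimes> t\<close>.\<close>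

lemma diagonal_principal: "\<exists>g\<in>U. \<forall>a. \<exists>h\<in>B. g * delta a = h * delta t"
proof -
  define W where "W = {h * delta t | h. h \<in> B}"
  have W: "0 \<in> W" "\<And>x y. x \<in> W \<Longrightarrow> y \<in> W \<Longrightarrow> x + y \<in> W" "\<And>b x. b \<in> B \<Longrightarrow> x \<in> W \<Longrightarrow> b * x \<in> W"
  proof -
    show "0 \<in> W" unfolding W_def using B.zero by (intro CollectI exI[of _ 0]) auto
    show "x + y \<in> W" if "x \<in> W" "y \<in> W" for x y
      using that unfolding W_def by (auto simp: distrib_right[symmetric] intro: B_add)
    show "b * x \<in> W" if "b \<in> B" "x \<in> W" for b x
      using that unfolding W_def by (auto simp: mult.assoc[symmetric] intro: B_mult)
  qed
  have gen: "delta a \<in> span_over B (delta ` S)" for a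
  proof -
    have "a \<in> generated_subalgebra scale S" using S by simp
    then show ?thesis
    proof induction
      case (gen x)
      have "tens 1 1 * delta x + 0 \<in> span_over B (delta ` S)"
        using gen by (intro span_over.intros) auto
      then show ?case by (simp add: tens_unit)
    next
      case (const c) then show ?case by (simp add: delta_const span_over.zero)
    next
      case (add x y) then show ?case by (simp add: delta_add span_over_add)
    next
      case (mult x y) then show ?case unfolding delta_mult
        by (intro span_over_add span_over_mult_mem[of B _ B]) (auto intro: B_mult)
    qed
  qed
  have M: "M \<subseteq> B" "0 \<in> M" "\<And>b x. b \<in> B \<Longrightarrow> x \<in> M \<Longrightarrow> b * x \<in> M" "\<And>x y. x \<in> M \<Longrightarrow> y \<in> M \<Longrightarrow> x + y \<in> M"
    by (auto simp: M_def B.zero tmult_simps ev tmult_mult B_mult B_add)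
  have sq: "delta x \<in> span_over M (delta ` S)" if "x \<in> ideal_prod type_ring {x. ev x = 0} {x. ev x = 0}" for x
    using that
  proof induction
    case (prod i j)
    have "tens i 1 \<in> M" "tens 1 j \<in> M" using prod by (auto simp: M_def tmult_simps)
    then show ?case unfolding type_ring_simps delta_mult
      by (intro span_over_add span_over_mult_mem[OF _ gen]) (use M(3) in \<open>auto simp: mult.commute\<close>)
  next
    case (sum x y) then show ?case by (simp add: delta_add span_over_add)
  qed
  have "\<exists>u\<in>U. \<forall>x\<in>delta ` S. u * x \<in> W"
  proof (rule Nakayama_elimination[OF W M])
    show "U \<subseteq> B" by (auto simp: U_def)
    have u: "tens 1 1 \<in> U" by (simp add: U_def tmult_simps ev)
    then show "U \<noteq> {}" by blast
    show "x * y \<in> U" if "x \<in> U" "y \<in> U" for x y using that by (auto simp: U_def B_mult tmult_mult ev)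
    show "u - x \<in> U" if "u \<in> U" "x \<in> M" for u x using that by (auto simp: U_def M_def B_diff tmult_simps ev)
    show "finite (delta ` S)" using S by simp
    fix d assume "d \<in> delta ` S"
    then obtain x where x: "d = delta x" by blast
    define y where "y = x - scale (ev x) 1"
    have "ev y = 0" by (simp add: y_def ev)
    then obtain a where a: "y - a * t \<in> ideal_prod type_ring {x. ev x = 0} {x. ev x = 0}" using t(2) by blast
    have "delta y = delta x" using delta_add[of y "scale (ev x) 1"] by (simp add: y_def delta_const)
    then have "delta x = delta (a * t) + delta (y - a * t)" using delta_add[of "a * t" "y - a * t"] by simp
    moreover have "tens 1 1 * d = d" by (simp add: x tens_unit)
    ultimately have eq: "tens 1 1 * d - tens a 1 * delta t = tens 1 t * delta a + delta (y - a * t)"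
      by (simp add: x delta_mult)
    have "tens 1 t \<in> M" using t by (simp add: M_def tmult_simps)
    then have "tens 1 t * delta a + delta (y - a * t) \<in> span_over M (delta ` S)"
      by (intro span_over_add span_over_mult_mem[OF _ gen] sq a) (use M(3) in \<open>auto simp: mult.commute\<close>)
    moreover have "tens a 1 * delta t \<in> W" by (auto simp: W_def)
    ultimately show "\<exists>u\<in>U. \<exists>w\<in>W. u * d - w \<in> span_over M (delta ` S)" using eq u by metis
  qed
  then obtain g where g: "g \<in> U" "\<forall>x\<in>delta ` S. g * x \<in> W" by blast
  have "g * p \<in> W" if "p \<in> span_over B (delta ` S)" for p
    using that
  proof induction
    case (step r x y)
    have "r * (g * x) + g * y \<in> W" using step g W by blast
    then show ?case by (simp add: algebra_simps)
  qed (use W in simp)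
  then have "\<forall>a. g * delta a \<in> W" using gen by blast
  then show ?thesis using g(1) unfolding W_def by blast
qed

text \<open>Restriction to \<open>A \<otimes> k(x) = A\<close>.\<close>

definition restr :: "'b \<Rightarrow> 'a" where
  "restr = (SOME F. additive_map F \<and> (\<forall>x y. F (tens x y) = scale (ev y) x))"

lemma restr: "additive_map restr" "restr (tens x y) = scale (ev y) x"
proof -
  have "balanced scale (\<lambda>x y. scale (ev y) x)"
    by (auto simp: balanced_def scale_left_distrib scale_right_distrib ev mult.commute)
  from someI_ex[OF lift_alg[OF this]] show "additive_map restr" "restr (tens x y) = scale (ev y) x"
    by (auto simp: restr_def)
qed

lemmas restr_simps = additive_mapD[OF restr(1)] restr(2)

lemma restr_mult: "p \<in> B \<Longrightarrow> q \<in> B \<Longrightarrow> restr (p * q) = restr p * restr q"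
proof (induction rule: B.induct)
  case (step p x y)
  have "restr (tens x y * q) = restr (tens x y) * restr q" using step(3)
  proof (induction rule: B.induct)
    case (step q x' y')
    then show ?case
      by (simp add: distrib_left restr_simps tens_mult ev K(8)[symmetric] K(9)[symmetric])
  qed (simp add: restr_simps)
  then show ?case using step by (simp add: distrib_right restr_simps)
qed (simp add: restr_simps)

lemma ev_restr: "p \<in> B \<Longrightarrow> ev (restr p) = ev (tmult p)"
  by (induction rule: B.induct) (auto simp: restr_simps tmult_simps ev mult.commute)

lemma restr_delta: "ev a = 0 \<Longrightarrow> restr (delta a) = a"
  by (simp add: delta_def restr_simps ev)

text \<open>Near \<open>x\<close> the maximal ideal is generated by \<open>t\<close>.\<close>

lemma point_principal: "\<exists>g. ev g \<noteq> 0 \<and> (\<forall>a. ev a = 0 \<longrightarrow> (\<exists>h. g * a = h * t))"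
proof -
  obtain g where g: "g \<in> U" "\<forall>a. \<exists>h\<in>B. g * delta a = h * delta t" using diagonal_principal by blast
  have "\<exists>h. restr g * a = h * t" if "ev a = 0" for a
  proof -
    obtain h where h: "h \<in> B" "g * delta a = h * delta t" using g by blast
    have "g \<in> B" using g by (simp add: U_def)
    from arg_cong[OF h(2), of restr] show ?thesis
      using restr_delta[OF that] restr_delta[OF t(1)] h(1) \<open>g \<in> B\<close> by (auto simp: restr_mult)
  qed
  then show ?thesis using g ev_restr by (intro exI[of _ "restr g"]) (auto simp: U_def)
qed

lemma t_notin_P: "t \<notin> P"
proof
  assume tP: "t \<in> P"
  obtain g where g: "ev g \<noteq> 0" "\<forall>a. ev a = 0 \<longrightarrow> (\<exists>h. g * a = h * t)" using point_principal by blast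
  then obtain h where "g * z = h * t" using z by blast
  then have "g * z \<in> P" using prime_setD(5)[OF P(1) tP, of h] by simp
  then show False using prime_setD(7)[OF P(1)] P(2) z g by blast
qed

text \<open>The elements that vanish near the point.\<close>

definition Loc :: "'a set" where "Loc = {y. \<exists>u. ev u \<noteq> 0 \<and> u * y = 0}"

lemma Loc_mult: "ev u \<noteq> 0 \<Longrightarrow> u * y \<in> Loc \<Longrightarrow> y \<in> Loc"
proof -
  assume "ev u \<noteq> 0" "u * y \<in> Loc"
  then obtain v where "ev v \<noteq> 0" "v * (u * y) = 0" by (auto simp: Loc_def)
  then show ?thesis using \<open>ev u \<noteq> 0\<close> unfolding Loc_def
    by (intro CollectI exI[of _ "v * u"]) (auto simp: ev mult.assoc)
qed

lemma Loc_ideal: "ideal_of UNIV Loc"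
  unfolding ideal_of_def
proof (intro conjI ballI)
  show "0 \<in> Loc" unfolding Loc_def by (intro CollectI exI[of _ 1]) (auto simp: ev)
  fix x y assume "x \<in> Loc" "y \<in> Loc"
  then obtain u v where "ev u \<noteq> 0" "u * x = 0" "ev v \<noteq> 0" "v * y = 0" by (auto simp: Loc_def)
  moreover have "(u * v) * (x + y) = v * (u * x) + u * (v * y)" by (simp add: algebra_simps)
  ultimately have "ev (u * v) \<noteq> 0" "(u * v) * (x + y) = v * (u * x) + u * (v * y)"
    by (simp_all add: ev)
  then show "x + y \<in> Loc" unfolding Loc_def using \<open>u * x = 0\<close> \<open>v * y = 0\<close> by (intro CollectI exI[of _ "u * v"]) auto
next
  fix r x assume "x \<in> Loc"
  then obtain u where "ev u \<noteq> 0" "u * x = 0" by (auto simp: Loc_def)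
  then show "r * x \<in> Loc" unfolding Loc_def
    by (intro CollectI exI[of _ u]) (simp add: mult.left_commute[of u r x])
qed simp

text \<open>The function \<open>t\<close> is not a zero divisor near \<open>x\<close>: if \<open>t
  y = 0\<close>, then \<open>y\<close> is divisible by all powers of \<open>t\<close>, since
  \<open>t\<close> is not nilpotent, while the annihilators of the powers of \<open>t\<close>
  become stationary.\<close>

lemma t_regular_0:
  assumes "t * x = 0"
  shows "x \<in> Loc"
proof -
  define N where "N = {y. \<exists>n. t ^ n * y = 0}"
  have up: "t ^ m * y = 0" if "t ^ n * y = 0" "n \<le> m" for n m y
    using that by (metis le_add_diff_inverse2 mult.assoc mult_zero_right power_add)
  have "ideal_of UNIV N"
    unfolding ideal_of_def
  proof (intro conjI ballI)
    fix y y' assume "y \<in> N" "y' \<in> N"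
    then obtain n n' where "t ^ n * y = 0" "t ^ n' * y' = 0" by (auto simp: N_def)
    then have "t ^ (max n n') * y = 0" "t ^ (max n n') * y' = 0" by (auto intro: up)
    then have "t ^ max n n' * (y + y') = 0" by (simp add: distrib_left)
    then show "y + y' \<in> N" unfolding N_def by blast
  next
    fix r y assume "y \<in> N"
    then obtain n where "t ^ n * y = 0" by (auto simp: N_def)
    then have "t ^ n * (r * y) = 0" by (simp add: mult.left_commute)
    then show "r * y \<in> N" by (auto simp: N_def)
  qed (auto simp: N_def)
  then obtain F where F: "finite F" "F \<subseteq> N" "N \<subseteq> span_over UNIV F" by (rule noetherian_setE[OF noetherian])
  have "\<exists>n. \<forall>y\<in>F. t ^ n * y = 0"
    using F(1,2)
  proof (induction F)
    case (insert y F)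
    then obtain n m where "\<forall>y\<in>F. t ^ n * y = 0" "t ^ m * y = 0" by (auto simp: N_def)
    then show ?case by (intro exI[of _ "max n m"]) (auto intro: up)
  qed simp
  then obtain n where n: "\<forall>y\<in>F. t ^ n * y = 0" by blast
  have n: "t ^ n * y = 0" if "y \<in> N" for y
  proof -
    have "y \<in> span_over UNIV F" using F that by blast
    then show ?thesis by induction (use n in \<open>auto simp: distrib_left mult.left_commute\<close>)
  qed
  obtain g where g: "ev g \<noteq> 0" "\<forall>a. ev a = 0 \<longrightarrow> (\<exists>h. g * a = h * t)" using point_principal by blast
  \<comment> \<open>\<open>x\<close> is divisible by all powers of \<open>t\<close> near the point\<close>
  have "\<exists>u y. ev u \<noteq> 0 \<and> u * x = t ^ j * y" for j
  proof (induction j)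
    case 0 show ?case by (intro exI[of _ 1] exI[of _ x]) (simp add: ev)
  next
    case (Suc j)
    then obtain u y where u: "ev u \<noteq> 0" "u * x = t ^ j * y" by blast
    show ?case
    proof (cases "ev y = 0")
      case True
      then obtain h where "g * y = h * t" using g by blast
      then have "(g * u) * x = t ^ Suc j * h" using u(2) by (metis mult.assoc mult.left_commute power_Suc mult.commute)
      then show ?thesis using u g by (intro exI[of _ "g * u"] exI[of _ h]) (auto simp: ev)
    next
      case False
      have "t ^ Suc j * y = u * (t * x)" using u(2) by (metis mult.assoc mult.left_commute power_Suc)
      then have "t ^ Suc j * y \<in> P" using assms prime_setD(1)[OF P(1)] by simp
      then show ?thesis using prime_setD(7,8)[OF P(1)] t_notin_P P(2) False by blast
    qed
  qed
  then obtain u y where u: "ev u \<noteq> 0" "u * x = t ^ n * y" by blast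
  have "t ^ Suc n * y = u * (t * x)" using u(2) by (metis mult.assoc mult.left_commute power_Suc)
  then have "y \<in> N" using assms unfolding N_def by (auto intro!: exI[of _ "Suc n"])
  then have "u * x = 0" using n u by simp
  then show ?thesis using u by (auto simp: Loc_def)
qed

lemma t_regular: "t * x \<in> Loc \<Longrightarrow> x \<in> Loc"
proof -
  assume "t * x \<in> Loc"
  then obtain u where u: "ev u \<noteq> 0" "u * (t * x) = 0" by (auto simp: Loc_def)
  then have "t * (u * x) = 0" by (simp add: mult.left_commute)
  then show ?thesis using t_regular_0 Loc_mult u by blast
qed

text \<open>The functions that satisfy a nontrivial linear relation between the \<open>t\<^sup>i
  y\<close> vanish near \<open>x\<close>: a polynomial in \<open>t\<close> is a power of
  \<open>t\<close> times a unit near \<open>x\<close>.\<close>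

lemma algebraic_torsion:
  assumes "\<exists>i\<le>n. c i \<noteq> 0" "(\<Sum>i\<le>n. scale (c i) (t ^ i * y)) \<in> Loc"
  shows "y \<in> Loc"
  using assms
proof (induction n arbitrary: c)
  case 0
  then have "ev (scale (c 0) 1) \<noteq> 0" "scale (c 0) 1 * y \<in> Loc" by (simp_all add: ev K(4)[of _ y, symmetric])
  then show ?case by (rule Loc_mult)
next
  case (Suc n)
  show ?case
  proof (cases "c 0 = 0")
    case False
    define v where "v = (\<Sum>i\<le>Suc n. scale (c i) (t ^ i))"
    have "v * y = (\<Sum>i\<le>Suc n. scale (c i) (t ^ i * y))" by (simp only: v_def sum_distrib_right K(8))
    moreover have "ev v = c 0"
      unfolding v_def ev by (subst sum.remove[of _ 0]) (auto simp: ev t power_0_left)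
    ultimately show ?thesis using Loc_mult[of v y] Suc.prems False by simp
  next
    case True
    have "(\<Sum>i\<le>Suc n. scale (c i) (t ^ i * y)) = t * (\<Sum>i\<le>n. scale (c (Suc i)) (t ^ i * y))"
      by (simp add: sum.atMost_Suc_shift True sum_distrib_left K(9)[symmetric] mult.assoc del: sum.atMost_Suc)
    then have "(\<Sum>i\<le>n. scale (c (Suc i)) (t ^ i * y)) \<in> Loc" using Suc.prems t_regular by simp
    moreover obtain i where "i \<le> Suc n" "c i \<noteq> 0" using Suc.prems by blast
    then have "\<exists>i\<le>n. c (Suc i) \<noteq> 0" using True by (cases i) auto
    ultimately show ?thesis by (intro Suc.IH[of "\<lambda>i. c (Suc i)"])
  qed
qed

lemma Loc_killed: "\<exists>G. ev G \<noteq> 0 \<and> (\<forall>y\<in>Loc. G * y = 0)"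
proof -
  obtain F where F: "finite F" "F \<subseteq> Loc" "Loc \<subseteq> span_over UNIV F" by (rule noetherian_setE[OF noetherian Loc_ideal])
  have "\<exists>G. ev G \<noteq> 0 \<and> (\<forall>y\<in>F. G * y = 0)"
    using F(1,2)
  proof (induction F)
    case (insert y F)
    then obtain G u where "ev G \<noteq> 0" "\<forall>y\<in>F. G * y = 0" "ev u \<noteq> 0" "u * y = 0" by (auto simp: Loc_def)
    moreover have "(G * u) * y' = u * (G * y')" "(G * u) * y' = G * (u * y')" for y' by (simp_all add: algebra_simps)
    ultimately have "\<forall>y'\<in>insert y F. (G * u) * y' = 0" "ev (G * u) \<noteq> 0"
      by (metis insert_iff mult_zero_right) (simp add: ev \<open>ev G \<noteq> 0\<close> \<open>ev u \<noteq> 0\<close>)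
    then show ?case by blast
  qed (auto intro: exI[of _ 1] simp: ev)
  then obtain G where G: "ev G \<noteq> 0" "\<forall>y\<in>F. G * y = 0" by blast
  have "G * y = 0" if "y \<in> Loc" for y
  proof -
    have "y \<in> span_over UNIV F" using F that by blast
    then show ?thesis by induction (use G in \<open>auto simp: distrib_left mult.left_commute\<close>)
  qed
  then show ?thesis using G by blast
qed

text \<open>After multiplication with \<open>1 \<otimes> G\<close> the element \<open>t \<otimes>
  1 - 1 \<otimes> t\<close> is not a zero divisor. If it kills \<open>p\<close>, then
  \<open>t\<^sup>n (l \<otimes> id)(p)\<close> is the contraction of \<open>p\<close> with the
  form \<open>l(t\<^sup>n -)\<close>. These elements lie in a space of finite dimension.\<close>

lemma delta_t_regular:
  assumes "p \<in> B" "delta t * p = 0" "\<forall>y\<in>Loc. G * y = 0"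
  shows "tens 1 G * p = 0"
proof (rule contract_separates)
  show "tens 1 G * p \<in> B" using assms by (intro B_mult) auto
  have shift: "linear_form (\<lambda>x. l (t ^ n * x))" if "linear_form l" for l n
    using that by (auto simp: linear_form_def distrib_left K(9)[symmetric])
  have pow: "t ^ n * contract l p = contract (\<lambda>x. l (t ^ n * x)) p" if l: "linear_form l" for n l
    using l
  proof (induction n arbitrary: l)
    case (Suc n)
    define l' where "l' x = l (t ^ n * x)" for x
    have l': "linear_form l'" using shift[OF Suc.prems] by (simp add: l'_def[abs_def])
    have l'': "linear_form (\<lambda>x. l' (t * x))" using shift[OF l', of 1] by simp
    have "contract l' (delta t * q) = contract (\<lambda>x. l' (t * x)) q - t * contract l' q" if "q \<in> B" for q
      using that
    proof induction
      case (step q x y)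
      have "contract l' (delta t * tens x y) = contract (\<lambda>x. l' (t * x)) (tens x y) - t * contract l' (tens x y)"
        by (simp add: delta_def left_diff_distrib tens_mult additive_mapD[OF contract(1)[OF l']] contract(2)[OF l'] contract(2)[OF l''] K(9)[symmetric])
      then show ?case using step
        by (simp add: distrib_left additive_mapD[OF contract(1)[OF l']] additive_mapD[OF contract(1)[OF l'']])
    qed (simp add: additive_mapD[OF contract(1)[OF l']] additive_mapD[OF contract(1)[OF l'']])
    from this[OF assms(1)] have "t * contract l' p = contract (\<lambda>x. l' (t * x)) p"
      using assms(2) by (simp add: additive_mapD[OF contract(1)[OF l']])
    then show ?case using Suc.IH[OF Suc.prems] by (simp add: l'_def[abs_def] mult.assoc mult.left_commute[of t])
  qed simp
  fix l assume l: "linear_form l"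
  obtain W where W: "finite W" "\<And>l. linear_form l \<Longrightarrow> contract l p \<in> span W"
    using contract_finite_dim[OF assms(1)] by blast
  obtain n c where c: "\<exists>i\<le>n. c i \<noteq> 0" "(\<Sum>i\<le>n. scale (c i) (t ^ i * contract l p)) = 0"
    using linear_dependence_of_sequence[OF W(1), of "\<lambda>i. t ^ i * contract l p"] W(2)[OF shift[OF l]] pow[OF l] by auto
  have "contract l p \<in> Loc"
    by (rule algebraic_torsion[OF c(1)]) (simp only: c(2) ideal_ofD(2)[OF Loc_ideal])
  then have "G * contract l p = 0" using assms(3) by blast
  moreover have "contract l (tens 1 G * q) = G * contract l q" if "q \<in> B" for q
    using that by induction (auto simp: distrib_left tens_mult additive_mapD[OF contract(1)[OF l]] contract(2)[OF l] K(9)[symmetric])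
  ultimately show "contract l (tens 1 G * p) = 0" using assms(1) by simp
qed

text \<open>The double derivation \<open>a \<mapsto> G g \<Delta>(a) / \<Delta>(t)\<close>.\<close>

lemma nonvanishing_double_derivation: "\<exists>\<Theta>\<in>DD. ev (tmult (\<Theta> t)) \<noteq> 0"
proof -
  obtain g where g: "g \<in> U" "\<forall>a. \<exists>h\<in>B. g * delta a = h * delta t" using diagonal_principal by blast
  then obtain h where h: "\<And>a. h a \<in> B" "\<And>a. g * delta a = h a * delta t" by metis
  obtain G where G: "ev G \<noteq> 0" "\<forall>y\<in>Loc. G * y = 0" using Loc_killed by blast
  have gB: "g \<in> B" using g by (simp add: U_def)
  have uniq: "tens 1 G * p = tens 1 G * q" if "p \<in> B" "q \<in> B" "p * delta t = q * delta t" for p q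
  proof -
    have "delta t * (p - q) = 0" using that by (simp add: algebra_simps)
    then have "tens 1 G * (p - q) = 0" using that G by (intro delta_t_regular B_diff) auto
    then show ?thesis by (simp add: algebra_simps)
  qed
  \<comment> \<open>the quotients \<open>h a\<close> are unique after multiplication with \<open>1 \<otimes> G\<close>\<close>
  define \<Theta> where "\<Theta> a = tens 1 G * h a" for a
  have 1: "\<Theta> (x + y) = tens 1 G * (h x + h y)" for x y
    unfolding \<Theta>_def by (rule uniq) (auto simp: h(1) B_add distrib_right h(2)[symmetric] delta_add distrib_left)
  have 2: "\<Theta> (scale c x) = tens 1 G * (tens (scale c 1) 1 * h x)" for c x
    unfolding \<Theta>_def
  proof (rule uniq)
    have "h (scale c x) * delta t = g * (tens (scale c 1) 1 * delta x)"
      using DD_props(3)[OF delta_DD] by (simp add: h(2)[symmetric])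
    also have "\<dots> = tens (scale c 1) 1 * (g * delta x)" by (rule mult.left_commute)
    finally show "h (scale c x) * delta t = tens (scale c 1) 1 * h x * delta t"
      by (simp only: h(2) mult.assoc)
  qed (auto simp: h B_mult)
  have 3: "\<Theta> (x * y) = tens 1 G * (tens x 1 * h y + tens 1 y * h x)" for x y
    unfolding \<Theta>_def
  proof (rule uniq)
    have "h (x * y) * delta t = g * (tens x 1 * delta y + tens 1 y * delta x)"
      by (simp add: h(2)[symmetric] delta_mult)
    also have "\<dots> = tens x 1 * (g * delta y) + tens 1 y * (g * delta x)"
      by (simp only: distrib_left mult.left_commute)
    finally show "h (x * y) * delta t = (tens x 1 * h y + tens 1 y * h x) * delta t"
      by (simp only: h(2) distrib_right mult.assoc)
  qed (auto simp: h B_mult B_add)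
  have "\<Theta> \<in> DD"
    unfolding DD_def mem_Collect_eq
  proof (intro conjI allI)
    show "\<Theta> x \<in> B" for x by (simp add: \<Theta>_def B_mult h)
    show "\<Theta> (x + y) = \<Theta> x + \<Theta> y" for x y using 1[of x y] by (simp add: \<Theta>_def distrib_left)
    show "\<Theta> (scale c x) = tens (scale c 1) 1 * \<Theta> x" for c x using 2[of c x] by (simp add: \<Theta>_def mult.left_commute)
    show "\<Theta> (x * y) = tens x 1 * \<Theta> y + tens 1 y * \<Theta> x" for x y
      using 3[of x y] by (simp add: \<Theta>_def distrib_left mult.left_commute)
  qed
  moreover have "\<Theta> t = tens 1 G * g"
    unfolding \<Theta>_def by (rule uniq) (auto simp: h(1) gB h(2)[symmetric])
  then have "ev (tmult (\<Theta> t)) \<noteq> 0"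
    using g G gB by (simp add: tmult_mult tmult_simps ev U_def)
  ultimately show ?thesis by blast
qed

end

section \<open>Double derivations of a smooth affine curve\<close>

lemma der_iff:
  "\<xi> \<in> der scale \<longleftrightarrow> vector_space scale \<and> (\<forall>x y. \<xi> (x + y) = \<xi> x + \<xi> y) \<and> (\<forall>c x. \<xi> (scale c x) = scale c (\<xi> x)) \<and>
     (\<forall>x y. \<xi> (x * y) = x * \<xi> y + \<xi> x * y)"
  by (auto simp: der_def module_hom_iff_linear[symmetric] module_hom_iff module_iff_vector_space)

context tensor_square_model begin

lemma derD:
  assumes "\<xi> \<in> der scale"
  shows "\<xi> (x + y) = \<xi> x + \<xi> y" "\<xi> (scale c x) = scale c (\<xi> x)" "\<xi> (x * y) = x * \<xi> y + \<xi> x * y"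
    "\<xi> 1 = 0" "\<xi> (- x) = - \<xi> x" "\<xi> (x - y) = \<xi> x - \<xi> y" "\<xi> (scale c 1) = 0"
proof -
  have 1: "\<And>x y. \<xi> (x + y) = \<xi> x + \<xi> y" and 2: "\<And>c x. \<xi> (scale c x) = scale c (\<xi> x)"
    and 3: "\<And>x y. \<xi> (x * y) = x * \<xi> y + \<xi> x * y"
    using assms by (auto simp: der_iff)
  then have a: "additive_map \<xi>" by (simp add: additive_map_def)
  have 4: "\<xi> 1 = 0" using 3[of 1 1] by simp
  show "\<xi> (x + y) = \<xi> x + \<xi> y" "\<xi> (scale c x) = scale c (\<xi> x)" "\<xi> (x * y) = x * \<xi> y + \<xi> x * y"
    "\<xi> 1 = 0" "\<xi> (- x) = - \<xi> x" "\<xi> (x - y) = \<xi> x - \<xi> y" "\<xi> (scale c 1) = 0"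
    using additive_mapD[OF a] by (simp_all add: 2 3 4)
qed

lemma der_mult: "\<xi> \<in> der scale \<Longrightarrow> (\<lambda>x. f * \<xi> x) \<in> der scale"
  by (auto simp: der_iff distrib_left K(9)[symmetric] algebra_simps)

lemma der_add: "\<xi> \<in> der scale \<Longrightarrow> \<eta> \<in> der scale \<Longrightarrow> (\<lambda>x. \<xi> x + \<eta> x) \<in> der scale"
  by (auto simp: der_iff algebra_simps)

lemma der_scale: "\<xi> \<in> der scale \<Longrightarrow> (\<lambda>x. scale c (\<xi> x)) \<in> der scale"
  using der_mult[of \<xi> "scale c 1"] by (simp add: K(4)[symmetric])

lemma der_bracket: "\<xi> \<in> der scale \<Longrightarrow> \<eta> \<in> der scale \<Longrightarrow> (\<lambda>x. \<xi> (\<eta> x) - \<eta> (\<xi> x)) \<in> der scale"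
  by (auto simp: der_iff algebra_simps scale_right_diff_distrib)

lemma tmult_DD: "\<Theta> \<in> DD \<Longrightarrow> (\<lambda>x. tmult (\<Theta> x)) \<in> der scale"
  using DD_props[of \<Theta>] vector_space_axioms
  by (auto simp: der_iff tmult_simps tmult_mult K(4)[symmetric] mult.commute)

text \<open>The map \<open>x \<otimes> y \<mapsto> x \<xi>(y)\<close>.\<close>

definition ext_der :: "('a \<Rightarrow> 'a) \<Rightarrow> 'b \<Rightarrow> 'a" where
  "ext_der \<xi> = (SOME F. additive_map F \<and> (\<forall>x y. F (tens x y) = x * \<xi> y))"

lemma ext_der:
  assumes "\<xi> \<in> der scale"
  shows "additive_map (ext_der \<xi>)" "ext_der \<xi> (tens x y) = x * \<xi> y"
proof -
  have "balanced scale (\<lambda>x y. x * \<xi> y)"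
    by (auto simp: balanced_def derD[OF assms] algebra_simps K(8,9)[symmetric])
  from someI_ex[OF lift_alg[OF this]] show "additive_map (ext_der \<xi>)" "ext_der \<xi> (tens x y) = x * \<xi> y"
    by (auto simp: ext_der_def)
qed

lemma ext_der_mult:
  assumes \<xi>: "\<xi> \<in> der scale"
  shows "p \<in> B \<Longrightarrow> q \<in> B \<Longrightarrow> ext_der \<xi> (p * q) = ext_der \<xi> p * tmult q + tmult p * ext_der \<xi> q"
proof (induction rule: B.induct)
  case (step p x y)
  note [simp] = additive_mapD[OF ext_der(1)[OF \<xi>]] ext_der(2)[OF \<xi>] tmult_simps
  have "ext_der \<xi> (tens x y * q) = x * \<xi> y * tmult q + x * y * ext_der \<xi> q" using step(3)
  proof (induction rule: B.induct)
    case (step q x' y')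
    have "ext_der \<xi> (tens x y * tens x' y') = x * \<xi> y * tmult (tens x' y') + x * y * ext_der \<xi> (tens x' y')"
      by (simp add: tens_mult derD(3)[OF \<xi>] algebra_simps)
    then show ?case using step by (simp add: distrib_left)
  qed simp
  then show ?case using step by (simp add: distrib_right algebra_simps)
qed (simp add: additive_mapD[OF ext_der(1)[OF \<xi>]] tmult_simps)

lemma ext_der_delta: "\<xi> \<in> der scale \<Longrightarrow> ext_der \<xi> (delta x) = - \<xi> x"
  by (simp add: delta_def additive_mapD[OF ext_der(1)] ext_der(2) derD)

text \<open>The map \<open>x \<otimes> y \<mapsto> x \<Theta>(y)\<close>. Up to sign it extends
  \<open>\<Theta>\<close> from the elements \<open>a \<otimes> 1 - 1 \<otimes> a\<close> to the
  ideal of the diagonal.\<close>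

definition ext_dd :: "('a \<Rightarrow> 'b) \<Rightarrow> 'b \<Rightarrow> 'b" where
  "ext_dd \<Theta> = (SOME F. additive_map F \<and> (\<forall>x y. F (tens x y) = tens x 1 * \<Theta> y))"

lemma ext_dd:
  assumes "\<Theta> \<in> DD"
  shows "additive_map (ext_dd \<Theta>)" "ext_dd \<Theta> (tens x y) = tens x 1 * \<Theta> y"
proof -
  have "tens (scale c x) 1 * \<Theta> y = tens x 1 * \<Theta> (scale c y)" for c x y
    unfolding DD_props(3)[OF assms]
    by (simp add: mult.assoc[symmetric] tens_mult K(9)[of c x 1, symmetric, simplified])
  then have "balanced scale (\<lambda>x y. tens x 1 * \<Theta> y)"
    by (simp add: balanced_def DD_props(2)[OF assms] tens_add distrib_left distrib_right)
  from someI_ex[OF lift_tens[OF this]] show "additive_map (ext_dd \<Theta>)" "ext_dd \<Theta> (tens x y) = tens x 1 * \<Theta> y"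
    by (auto simp: ext_dd_def)
qed

lemma ext_dd_delta:
  assumes \<Theta>: "\<Theta> \<in> DD"
  shows "p \<in> B \<Longrightarrow> ext_dd \<Theta> (p * delta d) = - (p * \<Theta> d)"
proof (induction rule: B.induct)
  case (step p x y)
  note [simp] = additive_mapD[OF ext_dd(1)[OF \<Theta>]] ext_dd(2)[OF \<Theta>]
  have "tens x y * delta d = tens (x * d) y - tens x (d * y)"
    by (simp add: delta_def right_diff_distrib tens_mult mult.commute)
  then have "ext_dd \<Theta> (tens x y * delta d) = tens (x * d) 1 * \<Theta> y - tens x 1 * (tens d 1 * \<Theta> y + tens 1 y * \<Theta> d)"
    by (simp add: DD_props(4)[OF \<Theta>])
  also have "\<dots> = - (tens x y * \<Theta> d)"
    by (simp add: distrib_left mult.assoc[symmetric] tens_mult)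
  finally show ?case using step by (simp add: distrib_right)
qed (simp add: additive_mapD[OF ext_dd(1)[OF \<Theta>]])

text \<open>\<open>ext_dd \<Theta>\<close> is linear over the tensor square on the ideal of the diagonal.\<close>

lemma ext_dd_linear:
  assumes \<Theta>: "\<Theta> \<in> DD" and "q \<in> B" "p \<in> span_over B (range delta)"
  shows "ext_dd \<Theta> (q * p) = q * ext_dd \<Theta> p"
  using assms(3)
proof induction
  case (step r x y)
  note a = additive_mapD[OF ext_dd(1)[OF \<Theta>]]
  obtain d where d: "x = delta d" using step by blast
  have "ext_dd \<Theta> (q * (r * x)) = q * ext_dd \<Theta> (r * x)"
    using ext_dd_delta[OF \<Theta> B_mult[OF assms(2) step(1)], of d] ext_dd_delta[OF \<Theta> step(1), of d]
    by (simp add: d mult.assoc)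
  then show ?case using step by (simp add: a distrib_left)
qed (simp add: additive_mapD[OF ext_dd(1)[OF \<Theta>]])

lemma DD_flip:
  assumes "\<Theta> \<in> DD"
  shows "(\<lambda>x. tflip (\<Theta> x)) \<in> DD"
  unfolding DD_def mem_Collect_eq
proof (intro conjI allI)
  note d = DD_props[OF assms]
  fix x y c
  show "tflip (\<Theta> x) \<in> B" by (intro tflip_B d)
  show "tflip (\<Theta> (x + y)) = tflip (\<Theta> x) + tflip (\<Theta> y)" by (simp only: d(2) tflip_simps)
  show "tflip (\<Theta> (scale c x)) = tens (scale c 1) 1 * tflip (\<Theta> x)"
    by (simp only: d(3) tflip_mult[OF B_tens d(1)] tflip_simps tens_scale)
  have "\<Theta> (x * y) = tens y 1 * \<Theta> x + tens 1 x * \<Theta> y" using d(4)[of y x] by (simp add: mult.commute)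
  then show "tflip (\<Theta> (x * y)) = tens x 1 * tflip (\<Theta> y) + tens 1 y * tflip (\<Theta> x)"
    by (simp add: tflip_simps tflip_mult d(1))
qed

text \<open>The double derivation \<open>c (\<Theta> + \<Theta>\<^sup>\<sigma>)\<close>.\<close>

lemma DD_symmetrize:
  assumes "\<Theta> \<in> DD"
  shows "(\<lambda>x. tens (scale c 1) 1 * (\<Theta> x + tflip (\<Theta> x))) \<in> DD"
    "tflip (tens (scale c 1) 1 * (\<Theta> x + tflip (\<Theta> x))) = tens (scale c 1) 1 * (\<Theta> x + tflip (\<Theta> x))"
    "tmult (tens (scale c 1) 1 * (\<Theta> x + tflip (\<Theta> x))) = scale (c + c) (tmult (\<Theta> x))"
proof -
  note d = DD_props(1)[OF assms]
  show "(\<lambda>x. tens (scale c 1) 1 * (\<Theta> x + tflip (\<Theta> x))) \<in> DD"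
    by (intro DD_mult DD_add DD_flip assms) simp
  show "tflip (tens (scale c 1) 1 * (\<Theta> x + tflip (\<Theta> x))) = tens (scale c 1) 1 * (\<Theta> x + tflip (\<Theta> x))"
    by (simp add: tflip_mult d tflip_B B_add tflip_simps tflip_tflip tens_scale[of c 1 1] add.commute)
  show "tmult (tens (scale c 1) 1 * (\<Theta> x + tflip (\<Theta> x))) = scale (c + c) (tmult (\<Theta> x))"
    by (simp only: tmult_mult[OF B_tens d] tmult_mult[OF B_tens tflip_B[OF d]] tmult_simps tmult_tflip[OF d]
      K(4)[of "c + c" "tmult (\<Theta> x)"] K(1) mult_1_right distrib_left distrib_right)
qed

end

locale tensor_square_curve = tensor_square_model scale tens
  for scale :: "'k::{alg_closed_field, field_char_0} \<Rightarrow> 'a::comm_ring_1 \<Rightarrow> 'a"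
    and tens :: "'a \<Rightarrow> 'a \<Rightarrow> 'b::comm_ring" +
  assumes curve: "smooth_affine_curve scale"
begin

text \<open>The ideal generated by the values of double derivations.\<close>

inductive_set dd_values :: "'b set" where
  zero: "0 \<in> dd_values"
| step: "\<Theta> \<in> DD \<Longrightarrow> p \<in> dd_values \<Longrightarrow> \<Theta> a + p \<in> dd_values"

lemma values_add: "p \<in> dd_values \<Longrightarrow> q \<in> dd_values \<Longrightarrow> p + q \<in> dd_values"
  by (induction rule: dd_values.induct) (auto simp: add.assoc intro: dd_values.intros)

lemma values_mult: "p \<in> dd_values \<Longrightarrow> s \<in> B \<Longrightarrow> s * p \<in> dd_values"
proof (induction rule: dd_values.induct)
  case (step \<Theta> p a)
  have "s * \<Theta> a + s * p \<in> dd_values" using dd_values.step[OF DD_mult[OF step(4,1)]] step by simp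
  then show ?case by (simp add: distrib_left)
qed (simp add: dd_values.zero)

lemma values_B: "p \<in> dd_values \<Longrightarrow> p \<in> B"
  by (induction rule: dd_values.induct) (auto intro: B_closed DD_props(1))

lemma delta_values: "span_over B (range delta) \<subseteq> dd_values"
proof
  fix p assume "p \<in> span_over B (range delta)"
  then show "p \<in> dd_values"
  proof induction
    case (step r x y)
    then obtain d where "x = delta d" by blast
    then show ?case using dd_values.step[OF DD_mult[OF step(1) delta_DD] step(4)] by simp
  qed (rule dd_values.zero)
qed

text \<open>The values of double derivations generate the unit ideal: since they contain the ideal of the diagonal,
  this may be checked after restriction to the diagonal, at each point of the curve.\<close>

theorem unit_decomposition:
  "\<exists>n::nat. \<exists>\<Theta> a. (\<forall>i<n. \<Theta> i \<in> DD) \<and> (\<Sum>i<n. \<Theta> i (a i)) = tens 1 1"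
proof -
  define J where "J = tmult ` dd_values"
  have J: "ideal_of UNIV J"
    unfolding ideal_of_def
  proof (intro conjI ballI)
    show "0 \<in> J" unfolding J_def using dd_values.zero by (intro image_eqI[of _ _ 0]) (auto simp: tmult_simps)
    fix x y assume "x \<in> J" "y \<in> J"
    then obtain p q where "p \<in> dd_values" "x = tmult p" "q \<in> dd_values" "y = tmult q" by (auto simp: J_def)
    then show "x + y \<in> J" unfolding J_def
      by (intro image_eqI[of _ _ "p + q"]) (simp_all only: tmult_simps values_add)
  next
    fix r x assume "x \<in> J"
    then obtain p where p: "p \<in> dd_values" "x = tmult p" by (auto simp: J_def)
    then have "r * x = tmult (tens r 1 * p)" by (simp add: tmult_mult values_B tmult_simps)
    then show "r * x \<in> J" unfolding J_def using values_mult[OF p(1) B_tens] by blast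
  qed simp
  obtain S where S: "finite S" "generated_subalgebra scale S = UNIV"
    using curve by (auto simp: smooth_affine_curve_def)
  have noeth: "noetherian_set (UNIV :: 'a set)" by (rule finitely_generated_noetherian[OF k S])
  have "1 \<in> J"
  proof (rule ccontr)
    assume "1 \<notin> J"
    obtain ev t P z where e: "point_on scale {} UNIV ev" "\<forall>x\<in>J. ev x = 0" "ev t = 0"
      "\<forall>x. ev x = 0 \<longrightarrow> (\<exists>a. x - a * t \<in> ideal_prod type_ring {x. ev x = 0} {x. ev x = 0})"
      "prime_set P" "\<forall>x\<in>P. ev x = 0" "ev z = 0" "z \<notin> P"
      by (rule smooth_affine_curve_point[OF curve J \<open>1 \<notin> J\<close>])
    interpret tensor_square_at_point scale tens S P ev t z
      by unfold_locales (use S noeth e in auto)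
    obtain \<Theta> where "\<Theta> \<in> DD" "ev (tmult (\<Theta> t)) \<noteq> 0" using nonvanishing_double_derivation by blast
    moreover from this have "\<Theta> t \<in> dd_values" using dd_values.step[OF _ dd_values.zero, of \<Theta> t] by simp
    ultimately show False using e(2) by (auto simp: J_def)
  qed
  then obtain p where p: "p \<in> dd_values" "tmult p = 1" by (auto simp: J_def)
  from p have "tens 1 1 - p \<in> span_over B (range delta)"
    by (intro kernel_tmult_0 B_diff B_tens values_B) (auto simp: tmult_simps)
  then have "(tens 1 1 - p) + p \<in> dd_values" using delta_values p(1) values_add by blast
  then have "tens 1 1 \<in> dd_values" by simp
  moreover have "\<exists>n::nat. \<exists>\<Theta> a. (\<forall>i<n. \<Theta> i \<in> DD) \<and> (\<Sum>i<n. \<Theta> i (a i)) = q" if "q \<in> dd_values" for q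
    using that
  proof induction
    case zero show ?case by (intro exI[of _ 0]) auto
  next
    case (step \<Psi> p b)
    then obtain n :: nat and \<Theta> a where "\<forall>i<n. \<Theta> i \<in> DD" "(\<Sum>i<n. \<Theta> i (a i)) = p" by blast
    then show ?case using step(1)
      by (intro exI[of _ "Suc n"] exI[of _ "\<Theta>(n := \<Psi>)"] exI[of _ "a(n := b)"]) (auto simp: less_Suc_eq add.commute)
  qed
  ultimately show ?thesis by blast
qed

text \<open>The double derivations with values in the ideal of the diagonal are the multiples of \<open>\<Delta>\<close>.\<close>

lemma DD_kernel:
  assumes \<Theta>: "\<Theta> \<in> DD" and 0: "\<And>a. tmult (\<Theta> a) = 0"
  shows "\<exists>s\<in>B. \<forall>a. \<Theta> a = s * delta a"
proof -
  obtain n :: nat and \<Psi> a where u: "\<And>i. i < n \<Longrightarrow> \<Psi> i \<in> DD" "(\<Sum>i<n. \<Psi> i (a i)) = tens 1 1"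
    using unit_decomposition by blast
  have \<Theta>I: "\<Theta> b \<in> span_over B (range delta)" for b by (intro kernel_tmult_0 DD_props(1)[OF \<Theta>] 0)
  have EB: "ext_dd (\<Psi> i) p \<in> B" if "p \<in> B" "i < n" for p i
    using that(1)
    by induction (auto simp: additive_mapD[OF ext_dd(1)[OF u(1)[OF that(2)]]] ext_dd(2)[OF u(1)[OF that(2)]]
        intro!: B_closed DD_props(1)[OF u(1)[OF that(2)]])
  \<comment> \<open>linearity of \<open>ext_dd (\<Psi> i)\<close> on the ideal of the diagonal gives \<open>s \<Delta>(b) = \<Sum>\<^sub>i \<Theta>(b) \<Psi>\<^sub>i(a\<^sub>i)\<close>\<close>
  define s where "s = - (\<Sum>i<n. ext_dd (\<Psi> i) (\<Theta> (a i)))"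
  have "\<Theta> b = s * delta b" for b
  proof -
    have "ext_dd (\<Psi> i) (\<Theta> (a i)) * delta b = - (\<Theta> b * \<Psi> i (a i))" if "i < n" for i
    proof -
      have "ext_dd (\<Psi> i) (\<Theta> (a i)) * delta b = ext_dd (\<Psi> i) (delta b * \<Theta> (a i))"
        using ext_dd_linear[OF u(1)[OF that] delta_B \<Theta>I, of b "a i"] by (metis mult.commute)
      also have "delta b * \<Theta> (a i) = \<Theta> b * delta (a i)"
        using DD_proportional[OF \<Theta>, of "a i" b] by (simp add: mult.commute)
      also have "ext_dd (\<Psi> i) (\<Theta> b * delta (a i)) = - (\<Theta> b * \<Psi> i (a i))"
        by (rule ext_dd_delta[OF u(1)[OF that] DD_props(1)[OF \<Theta>]])
      finally show ?thesis .
    qed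
    then have "s * delta b = (\<Sum>i<n. \<Theta> b * \<Psi> i (a i))"
      by (simp add: s_def sum_distrib_right sum_negf)
    also have "\<dots> = tens 1 1 * \<Theta> b" by (simp add: sum_distrib_left[symmetric] u(2) mult.commute)
    finally show ?thesis using tens_unit[OF DD_props(1)[OF \<Theta>]] by simp
  qed
  moreover have "s \<in> B" unfolding s_def by (intro B_minus B_sum EB DD_props(1)[OF \<Theta>]) auto
  ultimately show ?thesis by blast
qed

text \<open>The restriction of the unit decomposition to the diagonal: the values of vector fields
  generate the unit ideal.\<close>

lemma derivations_generate:
  "\<exists>n::nat. \<exists>\<xi> a. (\<forall>i<n. \<xi> i \<in> der scale) \<and> (\<Sum>i<n. \<xi> i (a i)) = 1"
proof -
  obtain n :: nat and \<Psi> a where u: "\<And>i. i < n \<Longrightarrow> \<Psi> i \<in> DD" "(\<Sum>i<n. \<Psi> i (a i)) = tens 1 1"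
    using unit_decomposition by blast
  have "(\<Sum>i<n. tmult (\<Psi> i (a i))) = 1"
    using arg_cong[OF u(2), of tmult] by (simp add: tmult_simps)
  then show ?thesis using tmult_DD[OF u(1)]
    by (intro exI[of _ n] exI[of _ "\<lambda>i x. tmult (\<Psi> i x)"] exI[of _ a]) auto
qed

text \<open>On a curve the tangent sheaf has rank one.\<close>

lemma der_proportional:
  assumes \<xi>: "\<xi> \<in> der scale" and \<eta>: "\<eta> \<in> der scale"
  shows "\<xi> x * \<eta> y = \<xi> y * \<eta> x"
proof -
  obtain n :: nat and \<Psi> a where u: "\<And>i. i < n \<Longrightarrow> \<Psi> i \<in> DD" "(\<Sum>i<n. \<Psi> i (a i)) = tens 1 1"
    using unit_decomposition by blast
  have *: "tmult (\<Psi> i x) * \<zeta> y = tmult (\<Psi> i y) * \<zeta> x" if "i < n" "\<zeta> \<in> der scale" for i x y \<zeta>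
    using arg_cong[OF DD_proportional[OF u(1)[OF that(1)], of x y], of "ext_der \<zeta>"]
    by (simp add: ext_der_mult[OF that(2)] DD_props(1)[OF u(1)[OF that(1)]] ext_der_delta[OF that(2)] tmult_delta)
  have "tmult (\<Psi> i (a i)) * (\<xi> x * \<eta> y) = tmult (\<Psi> i (a i)) * (\<xi> y * \<eta> x)" if "i < n" for i
  proof -
    have "tmult (\<Psi> i (a i)) * (\<xi> x * \<eta> y) = \<xi> (a i) * (tmult (\<Psi> i x) * \<eta> y)"
      using arg_cong[OF *[OF that \<xi>, of "a i" x], of "\<lambda>u. u * \<eta> y"] by (simp add: algebra_simps)
    also have "\<dots> = \<xi> (a i) * (tmult (\<Psi> i y) * \<eta> x)" using *[OF that \<eta>, of x y] by simp
    also have "\<dots> = tmult (\<Psi> i (a i)) * (\<xi> y * \<eta> x)"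
      using arg_cong[OF *[OF that \<xi>, of "a i" y], of "\<lambda>u. u * \<eta> x"] by (simp add: algebra_simps)
    finally show ?thesis .
  qed
  then have "(\<Sum>i<n. tmult (\<Psi> i (a i))) * (\<xi> x * \<eta> y) = (\<Sum>i<n. tmult (\<Psi> i (a i))) * (\<xi> y * \<eta> x)"
    by (simp add: sum_distrib_right)
  moreover have "(\<Sum>i<n. tmult (\<Psi> i (a i))) = 1"
    using arg_cong[OF u(2), of tmult] by (simp add: tmult_simps)
  ultimately show ?thesis by simp
qed

text \<open>Every vector field lifts to a double derivation: the lift is \<open>\<Sum>\<^sub>i
  (\<xi>(a\<^sub>i) \<otimes> 1) \<Theta>\<^sub>i\<close> for a unit decomposition
  \<open>\<Sum>\<^sub>i \<Theta>\<^sub>i(a\<^sub>i) = 1\<close>.\<close>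

lemma derivation_lift:
  assumes \<xi>: "\<xi> \<in> der scale"
  shows "\<exists>\<Theta>\<in>DD. \<forall>a. tmult (\<Theta> a) = \<xi> a"
proof -
  obtain n :: nat and \<Psi> a where u: "\<And>i. i < n \<Longrightarrow> \<Psi> i \<in> DD" "(\<Sum>i<n. \<Psi> i (a i)) = tens 1 1"
    using unit_decomposition by blast
  define \<Theta> where "\<Theta> x = (\<Sum>i<n. tens (\<xi> (a i)) 1 * \<Psi> i x)" for x
  have "(\<lambda>x. \<Sum>i\<in>I. tens (\<xi> (a i)) 1 * \<Psi> i x) \<in> DD" if "I \<subseteq> {..<n}" for I
    using finite_subset[OF that finite_lessThan] that
  proof (induction I)
    case empty
    show ?case by (auto simp: DD_def B.zero)
  next
    case (insert i I)
    then show ?case using DD_add[OF DD_mult[OF B_tens u(1)[of i]], of "\<lambda>x. \<Sum>i\<in>I. tens (\<xi> (a i)) 1 * \<Psi> i x"] by simp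
  qed
  then have "\<Theta> \<in> DD" unfolding \<Theta>_def[abs_def] by blast
  moreover have "tmult (\<Theta> x) = \<xi> x" for x
  proof -
    have "tmult (\<Theta> x) = (\<Sum>i<n. \<xi> (a i) * tmult (\<Psi> i x))"
      unfolding \<Theta>_def tmult_simps by (intro sum.cong) (auto simp: tmult_mult DD_props(1) u tmult_simps)
    also have "\<dots> = (\<Sum>i<n. tmult (\<Psi> i (a i)) * \<xi> x)"
      using der_proportional[OF tmult_DD[OF u(1)] \<xi>] by (intro sum.cong) (auto simp: mult.commute)
    also have "\<dots> = \<xi> x"
      using arg_cong[OF u(2), of tmult] by (simp add: tmult_simps sum_distrib_right[symmetric])
    finally show ?thesis .
  qed
  ultimately show ?thesis by blast
qed

lemma delta_multiple_zero:
  assumes s: "s \<in> B" and 0: "\<And>a. s * delta a = 0"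
  shows "tmult s = 0"
proof -
  obtain n :: nat and \<xi> a where u: "\<And>i. i < n \<Longrightarrow> \<xi> i \<in> der scale" "(\<Sum>i<n. \<xi> i (a i)) = 1"
    using derivations_generate by blast
  have "tmult s * \<xi> i (a i) = 0" if "i < n" for i
    using arg_cong[OF 0[of "a i"], of "ext_der (\<xi> i)"] u(1)[OF that] s
    by (simp add: ext_der_mult ext_der_delta tmult_delta additive_mapD[OF ext_der(1)])
  then have "tmult s * (\<Sum>i<n. \<xi> i (a i)) = 0" by (simp add: sum_distrib_left)
  then show ?thesis using u(2) by simp
qed

text \<open>\<open>\<alpha>(\<Theta>)\<close> is the restriction to the diagonal of half the quotient of \<open>\<Theta> - \<Theta>\<^sup>\<sigma>\<close> by \<open>\<Delta>\<close>, where
  \<open>\<Theta>\<^sup>\<sigma>\<close> is the flipped double derivation.\<close>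

definition alpha :: "('a \<Rightarrow> 'b) \<Rightarrow> 'a" where
  "alpha \<Theta> = scale (1 / 2) (tmult (SOME s. s \<in> B \<and> (\<forall>a. \<Theta> a - tflip (\<Theta> a) = s * delta a)))"

lemma alpha_eq:
  assumes "s \<in> B" "\<And>a. \<Theta> a - tflip (\<Theta> a) = s * delta a"
  shows "alpha \<Theta> = scale (1 / 2) (tmult s)"
proof -
  define s' where "s' = (SOME s. s \<in> B \<and> (\<forall>a. \<Theta> a - tflip (\<Theta> a) = s * delta a))"
  have s': "s' \<in> B \<and> (\<forall>a. \<Theta> a - tflip (\<Theta> a) = s' * delta a)"
    unfolding s'_def by (rule someI[of _ s]) (use assms in auto)
  have "(s - s') * delta a = 0" for a using assms(2)[of a] s' by (simp add: left_diff_distrib)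
  then have "tmult (s - s') = 0" using s' assms by (intro delta_multiple_zero B_diff) auto
  then show ?thesis by (simp add: alpha_def tmult_simps flip: s'_def)
qed

lemma antisymmetric_part:
  assumes "\<Theta> \<in> DD"
  shows "\<exists>s\<in>B. \<forall>a. \<Theta> a - tflip (\<Theta> a) = s * delta a"
proof -
  have "(\<lambda>x. \<Theta> x + (- tens 1 1) * tflip (\<Theta> x)) \<in> DD"
    using assms by (intro DD_add DD_mult DD_flip B_minus) auto
  moreover have "(- tens 1 1) * tflip (\<Theta> x) = - tflip (\<Theta> x)" for x
    using tens_unit[OF tflip_B[OF DD_props(1)[OF assms]]] by simp
  ultimately have "(\<lambda>x. \<Theta> x - tflip (\<Theta> x)) \<in> DD" by simp
  then show ?thesis
    by (rule DD_kernel) (simp add: tmult_simps tmult_tflip DD_props(1)[OF assms])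
qed

lemma alpha_symmetric: "\<Theta> \<in> DD \<Longrightarrow> (\<And>a. tflip (\<Theta> a) = \<Theta> a) \<Longrightarrow> alpha \<Theta> = 0"
  using alpha_eq[of 0 \<Theta>] by (simp add: B.zero tmult_simps)

lemma alpha_delta: "alpha delta = 1"
proof -
  have "alpha delta = scale (1 / 2) (tmult (tens 1 1 + tens 1 1))"
    by (rule alpha_eq) (auto simp: B_add distrib_right tens_unit delta_def tflip_simps algebra_simps tens_mult)
  also have "\<dots> = scale (1 / 2 + 1 / 2) 1" by (simp only: tmult_simps mult_1 scale_right_distrib scale_left_distrib)
  finally show ?thesis by simp
qed

lemma alpha_add:
  assumes "\<Theta> \<in> DD" "\<Psi> \<in> DD"
  shows "alpha (\<lambda>x. \<Theta> x + \<Psi> x) = alpha \<Theta> + alpha \<Psi>"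
proof -
  obtain s s' where s: "s \<in> B" "\<And>a. \<Theta> a - tflip (\<Theta> a) = s * delta a" "s' \<in> B" "\<And>a. \<Psi> a - tflip (\<Psi> a) = s' * delta a"
    using antisymmetric_part assms by metis
  have "\<Theta> a + \<Psi> a - tflip (\<Theta> a + \<Psi> a) = (s + s') * delta a" for a
    unfolding distrib_right s(2,4)[symmetric] tflip_simps by simp
  then have "alpha (\<lambda>x. \<Theta> x + \<Psi> x) = scale (1 / 2) (tmult (s + s'))"
    using s by (intro alpha_eq B_add)
  then show ?thesis using alpha_eq[OF s(1,2)] alpha_eq[OF s(3,4)] by (simp add: tmult_simps scale_right_distrib)
qed

text \<open>The deviation of \<open>\<alpha>\<close> from a bimodule map is the one of
  \<open>\<xi> \<mapsto> - \<ell>\<^sub>\<xi>\<close>, so that \<open>\<Theta> \<mapsto>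
  \<ell>\<^sub>\<xi> + \<alpha>(\<Theta>)\<close> is a bimodule map.\<close>

lemma alpha_mult:
  assumes \<Theta>: "\<Theta> \<in> DD"
  shows "alpha (\<lambda>x. tens c b * \<Theta> x) = b * c * alpha \<Theta> + scale (1 / 2) (b * tmult (\<Theta> c) - c * tmult (\<Theta> b))"
proof -
  obtain s where s: "s \<in> B" "\<And>a. \<Theta> a - tflip (\<Theta> a) = s * delta a"
    using antisymmetric_part \<Theta> by metis
  define s' where "s' = tens c b * s + (tens 1 b * tflip (\<Theta> c) - tens 1 c * tflip (\<Theta> b))"
  note d = DD_props(1)[OF \<Theta>]
  have p: "tflip (\<Theta> x) * delta y = tflip (\<Theta> y) * delta x" for x y
    by (rule DD_proportional[OF DD_flip[OF \<Theta>]])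
  have "tens c b * \<Theta> a - tflip (tens c b * \<Theta> a) = s' * delta a" for a
  proof -
    have "tens c b * \<Theta> a - tflip (tens c b * \<Theta> a) = tens c b * (\<Theta> a - tflip (\<Theta> a)) + (tens c b - tens b c) * tflip (\<Theta> a)"
      by (simp add: tflip_mult d tflip_simps algebra_simps)
    also have "tens c b - tens b c = tens 1 b * delta c - tens 1 c * delta b"
      by (simp add: delta_def right_diff_distrib tens_mult mult.commute)
    also have "(tens 1 b * delta c - tens 1 c * delta b) * tflip (\<Theta> a)
        = tens 1 b * (tflip (\<Theta> a) * delta c) - tens 1 c * (tflip (\<Theta> a) * delta b)"
      by (simp add: algebra_simps)
    also have "\<dots> = tens 1 b * (tflip (\<Theta> c) * delta a) - tens 1 c * (tflip (\<Theta> b) * delta a)"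
      by (simp only: p[of a c] p[of a b])
    finally show ?thesis by (simp add: s(2) s'_def algebra_simps)
  qed
  moreover have "s' \<in> B" by (simp add: s'_def s B_add B_diff B_mult tflip_B d)
  ultimately have "alpha (\<lambda>x. tens c b * \<Theta> x) = scale (1 / 2) (tmult s')" by (intro alpha_eq)
  also have "tmult s' = b * c * tmult s + (b * tmult (\<Theta> c) - c * tmult (\<Theta> b))"
    by (simp add: s'_def tmult_simps tmult_mult s d tflip_B B_mult tmult_tflip mult.commute)
  finally show ?thesis using alpha_eq[OF s] by (simp add: scale_right_distrib K(9))
qed

lemma symmetric_decomposition:
  assumes \<Theta>: "\<Theta> \<in> DD"
  obtains \<Psi> s where "\<Psi> \<in> DD" "\<And>a. tflip (\<Psi> a) = \<Psi> a" "\<And>a. tmult (\<Psi> a) = tmult (\<Theta> a)"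
    "s \<in> B" "\<And>a. \<Theta> a = \<Psi> a + s * delta a" "alpha \<Theta> = tmult s"
proof -
  obtain s where s: "s \<in> B" "\<And>a. \<Theta> a - tflip (\<Theta> a) = s * delta a"
    using antisymmetric_part \<Theta> by metis
  define h where "h = tens (scale (1/2) 1) 1"
  define \<Psi> where "\<Psi> x = h * (\<Theta> x + tflip (\<Theta> x))" for x
  note y = DD_symmetrize[OF \<Theta>, of "1 / 2"]
  have "scale (1 / 2) 1 + scale (1 / 2) 1 = (1 :: 'a)" by (simp add: scale_left_distrib[symmetric])
  then have h: "h + h = tens 1 1" by (simp add: h_def tens_add(1)[symmetric])
  have "\<Psi> a + (h * s) * delta a = (h + h) * \<Theta> a" for a
    by (simp add: \<Psi>_def mult.assoc s(2)[symmetric] algebra_simps)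
  then have "\<Theta> a = \<Psi> a + (h * s) * delta a" for a
    using tens_unit[OF DD_props(1)[OF \<Theta>]] by (simp add: h)
  moreover have "alpha \<Theta> = tmult (h * s)"
    using alpha_eq[OF s] s by (simp add: h_def tmult_mult tmult_simps K(4)[symmetric])
  moreover have "h * s \<in> B" using s by (simp add: h_def B_mult)
  moreover have "tmult (\<Psi> a) = tmult (\<Theta> a)" for a
    using y(3)[of a] by (simp add: \<Psi>_def h_def)
  moreover have "\<Psi> \<in> DD" "tflip (\<Psi> a) = \<Psi> a" for a
    using y(1,2) by (simp_all only: \<Psi>_def[abs_def] h_def)
  ultimately show ?thesis by (intro that[of \<Psi> "h * s"])
qed

lemma symmetric_lift:
  assumes "\<xi> \<in> der scale"
  shows "\<exists>\<Theta>\<in>DD. (\<forall>a. tflip (\<Theta> a) = \<Theta> a) \<and> (\<forall>a. tmult (\<Theta> a) = \<xi> a)"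
  using derivation_lift[OF assms] symmetric_decomposition by metis

end

section \<open>Rings as rings of a type class\<close>

text \<open>The product of all rings with elements in a given type. Every such ring embeds into it,
  so that identities in a ring with an explicit carrier may be verified in a type class. The embedding does not
  preserve the unit.\<close>

typedef 'r ring_family = "{f :: 'r ring \<Rightarrow> 'r. \<forall>R. if ring R then f R \<in> carrier R else f R = undefined}"
  by (rule exI[of _ "\<lambda>R. if ring R then \<zero>\<^bsub>R\<^esub> else undefined"]) (auto intro: ring.ring_simprules)

lemma component_closed: "ring R \<Longrightarrow> Rep_ring_family f R \<in> carrier R"
  and component_other: "\<not> ring R \<Longrightarrow> Rep_ring_family f R = undefined"
  using Rep_ring_family[of f] by (auto split: if_splits dest: spec[of _ R])

lemma ring_family_eqI: "(\<And>R. ring R \<Longrightarrow> Rep_ring_family f R = Rep_ring_family g R) \<Longrightarrow> f = g"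
  by (metis Rep_ring_family_inject component_other ext)

text \<open>The family with given members; its value at a structure that is not a ring is fixed.\<close>

definition family_of :: "('r ring \<Rightarrow> 'r) \<Rightarrow> 'r ring_family" where
  "family_of f = Abs_ring_family (\<lambda>R. if ring R then f R else undefined)"

lemma component_family_of:
  assumes "ring R" "\<And>R. ring R \<Longrightarrow> f R \<in> carrier R"
  shows "Rep_ring_family (family_of f) R = f R"
  unfolding family_of_def using assms by (subst Abs_ring_family_inverse) auto

instantiation ring_family :: (type) ring
begin

definition zero_ring_family :: "'a ring_family" where "zero_ring_family = family_of (\<lambda>R. \<zero>\<^bsub>R\<^esub>)"
definition plus_ring_family :: "'a ring_family \<Rightarrow> 'a ring_family \<Rightarrow> 'a ring_family" where
  "plus_ring_family f g = family_of (\<lambda>R. Rep_ring_family f R \<oplus>\<^bsub>R\<^esub> Rep_ring_family g R)"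
definition times_ring_family :: "'a ring_family \<Rightarrow> 'a ring_family \<Rightarrow> 'a ring_family" where
  "times_ring_family f g = family_of (\<lambda>R. Rep_ring_family f R \<otimes>\<^bsub>R\<^esub> Rep_ring_family g R)"
definition uminus_ring_family :: "'a ring_family \<Rightarrow> 'a ring_family" where
  "uminus_ring_family f = family_of (\<lambda>R. \<ominus>\<^bsub>R\<^esub> Rep_ring_family f R)"
definition minus_ring_family :: "'a ring_family \<Rightarrow> 'a ring_family \<Rightarrow> 'a ring_family" where
  "minus_ring_family f g = f + (- g)"

lemma component_ops:
  assumes R: "ring R"
  shows "Rep_ring_family (0::'a ring_family) R = \<zero>\<^bsub>R\<^esub>"
    "Rep_ring_family (f + g) R = Rep_ring_family f R \<oplus>\<^bsub>R\<^esub> Rep_ring_family g R"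
    "Rep_ring_family (f * g) R = Rep_ring_family f R \<otimes>\<^bsub>R\<^esub> Rep_ring_family g R"
    "Rep_ring_family (- f) R = \<ominus>\<^bsub>R\<^esub> Rep_ring_family f R"
  unfolding zero_ring_family_def plus_ring_family_def times_ring_family_def uminus_ring_family_def
  by (auto intro!: component_family_of R ring.ring_simprules component_closed)

instance
proof
  fix a b c :: "'a ring_family"
  note s = ring.ring_simprules and c = component_closed
  show "a + b + c = a + (b + c)" by (rule ring_family_eqI) (simp add: component_ops s c)
  show "a + b = b + a" by (rule ring_family_eqI) (simp add: component_ops s c)
  show "0 + a = a" by (rule ring_family_eqI) (simp add: component_ops s c)
  show "- a + a = 0" by (rule ring_family_eqI) (simp add: component_ops s c)
  show "a - b = a + - b" by (rule minus_ring_family_def)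
  show "a * b * c = a * (b * c)" by (rule ring_family_eqI) (simp add: component_ops s c)
  show "(a + b) * c = a * c + b * c" by (rule ring_family_eqI) (simp add: component_ops s c)
  show "a * (b + c) = a * b + a * c" by (rule ring_family_eqI) (simp add: component_ops s c)
qed

end

text \<open>The embedding of the ring \<open>R\<close> as one factor of the product.\<close>

definition embed :: "'r ring \<Rightarrow> 'r \<Rightarrow> 'r ring_family" where
  "embed R x = family_of (\<lambda>R'. if R' = R then x else \<zero>\<^bsub>R'\<^esub>)"

lemma component_embed:
  assumes "x \<in> carrier R" "ring R'"
  shows "Rep_ring_family (embed R x) R' = (if R' = R then x else \<zero>\<^bsub>R'\<^esub>)"
  unfolding embed_def using assms by (intro component_family_of) (auto intro: ring.ring_simprules)

lemma embed_ops:
  assumes "ring R" "x \<in> carrier R" "y \<in> carrier R"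
  shows "embed R (x \<oplus>\<^bsub>R\<^esub> y) = embed R x + embed R y" "embed R (x \<otimes>\<^bsub>R\<^esub> y) = embed R x * embed R y"
    "embed R \<zero>\<^bsub>R\<^esub> = 0" "embed R (\<ominus>\<^bsub>R\<^esub> x) = - embed R x" "embed R (x \<ominus>\<^bsub>R\<^esub> y) = embed R x - embed R y"
proof -
  note s = ring.ring_simprules
  have 1: "embed R (x \<oplus>\<^bsub>R\<^esub> z) = embed R x + embed R z" if "z \<in> carrier R" for z
    using assms that by (intro ring_family_eqI) (auto simp: component_embed component_ops s)
  have 2: "embed R (\<ominus>\<^bsub>R\<^esub> z) = - embed R z" if "z \<in> carrier R" for z
    using assms that by (intro ring_family_eqI) (auto simp: component_embed component_ops s)
  show "embed R (x \<oplus>\<^bsub>R\<^esub> y) = embed R x + embed R y" "embed R (\<ominus>\<^bsub>R\<^esub> x) = - embed R x"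
    using 1 2 assms by auto
  show "embed R (x \<otimes>\<^bsub>R\<^esub> y) = embed R x * embed R y" "embed R \<zero>\<^bsub>R\<^esub> = 0"
    using assms by (auto intro!: ring_family_eqI simp: component_embed component_ops s)
  show "embed R (x \<ominus>\<^bsub>R\<^esub> y) = embed R x - embed R y"
    using assms by (simp add: a_minus_def 1 2 s)
qed

lemma component_embed_self: "ring R \<Longrightarrow> x \<in> carrier R \<Longrightarrow> Rep_ring_family (embed R x) R = x"
  by (simp add: component_embed)

lemma embed_inj: "ring R \<Longrightarrow> x \<in> carrier R \<Longrightarrow> y \<in> carrier R \<Longrightarrow> embed R x = embed R y \<Longrightarrow> x = y"
  by (metis component_embed_self)

text \<open>The commutative counterpart.\<close>

typedef 'r cring_family = "{f :: 'r ring_family. \<forall>R. ring R \<longrightarrow> \<not> cring R \<longrightarrow> Rep_ring_family f R = \<zero>\<^bsub>R\<^esub>}"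
  by (rule exI[of _ 0]) (auto simp: component_ops)

instantiation cring_family :: (type) comm_ring
begin

definition zero_cring_family :: "'a cring_family" where "zero_cring_family = Abs_cring_family 0"
definition plus_cring_family :: "'a cring_family \<Rightarrow> 'a cring_family \<Rightarrow> 'a cring_family" where
  "plus_cring_family f g = Abs_cring_family (Rep_cring_family f + Rep_cring_family g)"
definition times_cring_family :: "'a cring_family \<Rightarrow> 'a cring_family \<Rightarrow> 'a cring_family" where
  "times_cring_family f g = Abs_cring_family (Rep_cring_family f * Rep_cring_family g)"
definition uminus_cring_family :: "'a cring_family \<Rightarrow> 'a cring_family" where
  "uminus_cring_family f = Abs_cring_family (- Rep_cring_family f)"
definition minus_cring_family :: "'a cring_family \<Rightarrow> 'a cring_family \<Rightarrow> 'a cring_family" where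
  "minus_cring_family f g = f + (- g)"

lemma Rep_cring_family_ops:
  "Rep_cring_family 0 = 0" "Rep_cring_family (f + g) = Rep_cring_family f + Rep_cring_family g"
  "Rep_cring_family (f * g) = Rep_cring_family f * Rep_cring_family g" "Rep_cring_family (- f) = - Rep_cring_family f"
proof -
  have *: "Rep_ring_family (Rep_cring_family f) R = \<zero>\<^bsub>R\<^esub>" if "ring R" "\<not> cring R" for f :: "'a cring_family" and R
    using Rep_cring_family[of f] that by auto
  show "Rep_cring_family 0 = 0" "Rep_cring_family (f + g) = Rep_cring_family f + Rep_cring_family g"
    "Rep_cring_family (f * g) = Rep_cring_family f * Rep_cring_family g" "Rep_cring_family (- f) = - Rep_cring_family f"
    unfolding zero_cring_family_def plus_cring_family_def times_cring_family_def uminus_cring_family_def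
    by (auto intro!: Abs_cring_family_inverse
      simp: * component_ops ring.ring_simprules)
qed

instance
proof
  fix a b c :: "'a cring_family"
  note i = Rep_cring_family_inject[symmetric] and o = Rep_cring_family_ops
  show "a + b + c = a + (b + c)" "a + b = b + a" "0 + a = a" "- a + a = 0" "a * b * c = a * (b * c)"
    "(a + b) * c = a * c + b * c" by (simp_all add: i o algebra_simps)
  show "a - b = a + - b" by (rule minus_cring_family_def)
  show "a * b = b * a"
    unfolding i o
  proof (rule ring_family_eqI)
    fix R :: "'a ring" assume R: "ring R"
    show "Rep_ring_family (Rep_cring_family a * Rep_cring_family b) R = Rep_ring_family (Rep_cring_family b * Rep_cring_family a) R"
    proof (cases "cring R")
      case True
      then show ?thesis using R by (simp add: component_ops cring.cring_simprules(14) component_closed)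
    next
      case False
      then show ?thesis using Rep_cring_family[of a] Rep_cring_family[of b] R
        by (simp add: component_ops ring.ring_simprules)
    qed
  qed
qed

end

definition cembed :: "'r ring \<Rightarrow> 'r \<Rightarrow> 'r cring_family" where
  "cembed R x = Abs_cring_family (embed R x)"

definition ccomponent :: "'r ring \<Rightarrow> 'r cring_family \<Rightarrow> 'r" where
  "ccomponent R f = Rep_ring_family (Rep_cring_family f) R"

lemma Rep_cembed:
  assumes "cring R" "x \<in> carrier R"
  shows "Rep_cring_family (cembed R x) = embed R x"
  unfolding cembed_def using assms
  by (subst Abs_cring_family_inverse) (auto simp: component_embed)

lemma cembed_ops:
  assumes "cring R" "x \<in> carrier R" "y \<in> carrier R"
  shows "cembed R (x \<oplus>\<^bsub>R\<^esub> y) = cembed R x + cembed R y" "cembed R (x \<otimes>\<^bsub>R\<^esub> y) = cembed R x * cembed R y"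
    "cembed R \<zero>\<^bsub>R\<^esub> = 0" "cembed R (\<ominus>\<^bsub>R\<^esub> x) = - cembed R x" "cembed R (x \<ominus>\<^bsub>R\<^esub> y) = cembed R x - cembed R y"
proof -
  have R: "ring R" using assms(1) by (simp add: cring_def)
  note s = ring.ring_simprules[OF R]
  show "cembed R (x \<oplus>\<^bsub>R\<^esub> y) = cembed R x + cembed R y" "cembed R (x \<otimes>\<^bsub>R\<^esub> y) = cembed R x * cembed R y"
    "cembed R \<zero>\<^bsub>R\<^esub> = 0" "cembed R (\<ominus>\<^bsub>R\<^esub> x) = - cembed R x"
    using assms
    by (simp_all add: Rep_cring_family_inject[symmetric] Rep_cembed Rep_cring_family_ops embed_ops[OF R assms(2,3)] s(1-5))
  show "cembed R (x \<ominus>\<^bsub>R\<^esub> y) = cembed R x - cembed R y"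
    unfolding minus_cring_family_def Rep_cring_family_inject[symmetric] Rep_cring_family_ops
    using assms by (simp add: Rep_cembed embed_ops[OF R assms(2,3)] s(1-5))
qed

lemma ccomponent_ops:
  assumes "cring R"
  shows "ccomponent R f \<in> carrier R" "ccomponent R (f + g) = ccomponent R f \<oplus>\<^bsub>R\<^esub> ccomponent R g"
    "x \<in> carrier R \<Longrightarrow> ccomponent R (cembed R x) = x"
  using assms component_closed[of R]
  by (auto simp: ccomponent_def Rep_cring_family_ops component_ops cring_def Rep_cembed component_embed_self)

lemma cembed_inj: "cring R \<Longrightarrow> x \<in> carrier R \<Longrightarrow> y \<in> carrier R \<Longrightarrow> cembed R x = cembed R y \<Longrightarrow> x = y"
  by (metis ccomponent_ops(3))

section \<open>Monoid algebras\<close>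

text \<open>The additive extension of a map on monomials.\<close>

definition lin_ext :: "('w \<Rightarrow> 'k::zero \<Rightarrow> 'c::comm_monoid_add) \<Rightarrow> ('w \<Rightarrow>\<^sub>0 'k) \<Rightarrow> 'c" where
  "lin_ext g p = (\<Sum>u\<in>Poly_Mapping.keys p. g u (Poly_Mapping.lookup p u))"

lemma lin_ext_superset:
  assumes "finite U" "Poly_Mapping.keys p \<subseteq> U" "\<And>u. g u 0 = 0"
  shows "lin_ext g p = (\<Sum>u\<in>U. g u (Poly_Mapping.lookup p u))"
  unfolding lin_ext_def using assms by (intro sum.mono_neutral_left) (auto simp: in_keys_iff)

lemma lin_ext_additive:
  fixes g :: "'w \<Rightarrow> 'k::ab_group_add \<Rightarrow> 'c::ab_group_add"
  assumes g: "\<And>u. additive_map (g u)"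
  shows "additive_map (lin_ext g)"
  unfolding additive_map_def
proof (intro allI)
  fix p q :: "'w \<Rightarrow>\<^sub>0 'k"
  note a = additive_mapD[OF g]
  define U where "U = Poly_Mapping.keys p \<union> Poly_Mapping.keys q"
  have U: "finite U" "Poly_Mapping.keys p \<subseteq> U" "Poly_Mapping.keys q \<subseteq> U" "Poly_Mapping.keys (p + q) \<subseteq> U"
    using keys_add[of p q] by (auto simp: U_def)
  show "lin_ext g (p + q) = lin_ext g p + lin_ext g q"
    using U by (simp add: lin_ext_superset[of U] a lookup_add sum.distrib)
qed

lemma lin_ext_single:
  fixes g :: "'w \<Rightarrow> 'k::ab_group_add \<Rightarrow> 'c::ab_group_add"
  assumes "\<And>u. additive_map (g u)"
  shows "lin_ext g (Poly_Mapping.single u c) = g u c"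
  using lin_ext_superset[of "{u}" "Poly_Mapping.single u c" g] additive_mapD(2)[OF assms] by simp

lemma sum_singles: "(\<Sum>u\<in>Poly_Mapping.keys p. Poly_Mapping.single u (Poly_Mapping.lookup p u)) = (p :: 'w \<Rightarrow>\<^sub>0 'k::ab_group_add)"
proof (rule poly_mapping_eqI)
  fix w
  have "Poly_Mapping.lookup (\<Sum>u\<in>Poly_Mapping.keys p. Poly_Mapping.single u (Poly_Mapping.lookup p u)) w
      = (\<Sum>u\<in>Poly_Mapping.keys p. if u = w then Poly_Mapping.lookup p u else 0)"
    unfolding lookup_sum by (intro sum.cong) (auto simp: lookup_single when_def)
  then show "Poly_Mapping.lookup (\<Sum>u\<in>Poly_Mapping.keys p. Poly_Mapping.single u (Poly_Mapping.lookup p u)) w = Poly_Mapping.lookup p w"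
    by (auto simp: in_keys_iff)
qed

lemma additive_eq_on_singles:
  fixes F G :: "('w \<Rightarrow>\<^sub>0 'k::ab_group_add) \<Rightarrow> 'c::ab_group_add"
  assumes "additive_map F" "additive_map G"
    and "\<And>u c. u \<in> Poly_Mapping.keys p \<Longrightarrow> F (Poly_Mapping.single u c) = G (Poly_Mapping.single u c)"
  shows "F p = G p"
proof -
  have "F (\<Sum>u\<in>Poly_Mapping.keys p. Poly_Mapping.single u (Poly_Mapping.lookup p u))
      = G (\<Sum>u\<in>Poly_Mapping.keys p. Poly_Mapping.single u (Poly_Mapping.lookup p u))"
    unfolding additive_mapD(5)[OF assms(1)] additive_mapD(5)[OF assms(2)] by (intro sum.cong) (auto simp: assms(3))
  then show ?thesis by (simp only: sum_singles)
qed

text \<open>The product of the monoid algebra.\<close>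

definition conv :: "('w, 'z) monoid_scheme \<Rightarrow> ('w \<Rightarrow>\<^sub>0 'k::field) \<Rightarrow> ('w \<Rightarrow>\<^sub>0 'k) \<Rightarrow> ('w \<Rightarrow>\<^sub>0 'k)" where
  "conv W p q = lin_ext (\<lambda>u a. lin_ext (\<lambda>v b. Poly_Mapping.single (u \<otimes>\<^bsub>W\<^esub> v) (a * b)) q) p"

lemma conv_additive: "additive_map (\<lambda>p. conv W p q)" "additive_map (conv W p)"
proof -
  have s: "additive_map (\<lambda>b. Poly_Mapping.single (u \<otimes>\<^bsub>W\<^esub> v) (a * b :: 'k::field))" for u v a
    by (simp add: additive_map_def distrib_left single_add)
  show "additive_map (\<lambda>p. conv W p q)"
    unfolding conv_def
    by (rule lin_ext_additive) (simp add: additive_map_def lin_ext_def distrib_right single_add sum.distrib)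
  show "additive_map (conv W p)"
    unfolding conv_def
    by (simp add: additive_map_def lin_ext_def[of _ p] additive_mapD(1)[OF lin_ext_additive[OF s]] sum.distrib)
qed

lemma conv_single: "conv W (Poly_Mapping.single u a) (Poly_Mapping.single v b) = Poly_Mapping.single (u \<otimes>\<^bsub>W\<^esub> v) (a * b)"
  unfolding conv_def
  by (subst lin_ext_single, simp add: additive_map_def lin_ext_def distrib_right single_add sum.distrib)
    (subst lin_ext_single, auto simp: additive_map_def distrib_left single_add)

lemma monoid_algebra_simps:
  "carrier (monoid_algebra W) = {p. Poly_Mapping.keys p \<subseteq> carrier W}"
  "p \<otimes>\<^bsub>monoid_algebra W\<^esub> q = conv W p q" "p \<oplus>\<^bsub>monoid_algebra W\<^esub> q = p + q"
  "\<zero>\<^bsub>monoid_algebra W\<^esub> = 0" "\<one>\<^bsub>monoid_algebra W\<^esub> = word \<one>\<^bsub>W\<^esub>"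
  by (simp_all add: monoid_algebra_def conv_def lin_ext_def)

lemma keys_sum_obtain:
  fixes f :: "'i \<Rightarrow> 'w \<Rightarrow>\<^sub>0 'k::ab_group_add"
  assumes "w \<in> Poly_Mapping.keys (sum f I)"
  obtains i where "i \<in> I" "w \<in> Poly_Mapping.keys (f i)"
  using assms
proof (induction I rule: infinite_finite_induct)
  case (insert j I)
  then show ?case using keys_add[of "f j" "sum f I"] by auto
qed auto

lemma keys_conv: "Poly_Mapping.keys (conv W p q) \<subseteq> (\<lambda>(u, v). u \<otimes>\<^bsub>W\<^esub> v) ` (Poly_Mapping.keys p \<times> Poly_Mapping.keys q)"
proof
  fix w assume "w \<in> Poly_Mapping.keys (conv W p q)"
  then show "w \<in> (\<lambda>(u, v). u \<otimes>\<^bsub>W\<^esub> v) ` (Poly_Mapping.keys p \<times> Poly_Mapping.keys q)"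
    unfolding conv_def lin_ext_def by (elim keys_sum_obtain) (auto split: if_splits)
qed

lemma conv_biadditive_eqI:
  fixes F G :: "('w \<Rightarrow>\<^sub>0 'k::ab_group_add) \<Rightarrow> ('v \<Rightarrow>\<^sub>0 'l::ab_group_add) \<Rightarrow> 'c::ab_group_add"
  assumes "\<And>q. additive_map (\<lambda>p. F p q)" "\<And>p. additive_map (F p)" "\<And>q. additive_map (\<lambda>p. G p q)" "\<And>p. additive_map (G p)"
    and "\<And>u a v b. u \<in> Poly_Mapping.keys p \<Longrightarrow> v \<in> Poly_Mapping.keys q \<Longrightarrow>
      F (Poly_Mapping.single u a) (Poly_Mapping.single v b) = G (Poly_Mapping.single u a) (Poly_Mapping.single v b)"
  shows "F p q = G p q"
  by (rule additive_eq_on_singles[OF assms(1,3)]) (rule additive_eq_on_singles[OF assms(2,4)], rule assms(5))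

lemma additive_map_compose: "additive_map F \<Longrightarrow> additive_map G \<Longrightarrow> additive_map (\<lambda>x. F (G x))"
  by (simp add: additive_map_def)

lemma monoid_algebra_ring:
  assumes "monoid W"
  shows "ring (monoid_algebra W :: ('w \<Rightarrow>\<^sub>0 'k::field) ring)"
proof -
  interpret W: monoid W by fact
  note c = conv_additive[of W]
  have assoc: "conv W (conv W p q) r = conv W p (conv W q r)"
    if "Poly_Mapping.keys p \<subseteq> carrier W" "Poly_Mapping.keys q \<subseteq> carrier W" "Poly_Mapping.keys r \<subseteq> carrier W"
    for p q r :: "'w \<Rightarrow>\<^sub>0 'k"
  proof (rule conv_biadditive_eqI[where F="\<lambda>p q. conv W (conv W p q) r" and G="\<lambda>p q. conv W p (conv W q r)"])
    fix u a v b assume uv: "u \<in> Poly_Mapping.keys p" "v \<in> Poly_Mapping.keys q"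
    show "conv W (conv W (Poly_Mapping.single u a) (Poly_Mapping.single v b)) r
        = conv W (Poly_Mapping.single u a) (conv W (Poly_Mapping.single v b) r)"
      by (rule additive_eq_on_singles) (use c uv that in \<open>auto intro: additive_map_compose simp: conv_single W.m_assoc subset_iff mult.assoc\<close>)
  qed (rule c additive_map_compose[OF c(1) c(1)] additive_map_compose[OF c(1) c(2)] additive_map_compose[OF c(2) c(1)] additive_map_compose[OF c(2) c(2)])+
  have one: "conv W (word \<one>\<^bsub>W\<^esub>) p = p" "conv W p (word \<one>\<^bsub>W\<^esub>) = p" if "Poly_Mapping.keys p \<subseteq> carrier W" for p :: "'w \<Rightarrow>\<^sub>0 'k"
  proof -
    have i: "additive_map (\<lambda>p :: 'w \<Rightarrow>\<^sub>0 'k. p)" by (simp add: additive_map_def)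
    show "conv W (word \<one>\<^bsub>W\<^esub>) p = p"
      by (rule additive_eq_on_singles[OF c(2) i]) (use that in \<open>auto simp: conv_single subset_iff\<close>)
    show "conv W p (word \<one>\<^bsub>W\<^esub>) = p"
      by (rule additive_eq_on_singles[OF c(1) i]) (use that in \<open>auto simp: conv_single subset_iff\<close>)
  qed
  show ?thesis
  proof (rule ringI)
    show "abelian_group (monoid_algebra W :: ('w \<Rightarrow>\<^sub>0 'k) ring)"
    proof (rule abelian_groupI)
      fix x :: "'w \<Rightarrow>\<^sub>0 'k" assume "x \<in> carrier (monoid_algebra W)"
      then show "\<exists>y\<in>carrier (monoid_algebra W). y \<oplus>\<^bsub>monoid_algebra W\<^esub> x = \<zero>\<^bsub>monoid_algebra W\<^esub>"
        by (intro bexI[of _ "- x"]) (auto simp: monoid_algebra_simps in_keys_iff subset_iff)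
    qed (auto simp: monoid_algebra_simps add.assoc add.commute dest!: subsetD[OF keys_add])
    show "Group.monoid (monoid_algebra W :: ('w \<Rightarrow>\<^sub>0 'k) ring)"
    proof (rule monoidI)
      fix p q :: "'w \<Rightarrow>\<^sub>0 'k" assume "p \<in> carrier (monoid_algebra W)" "q \<in> carrier (monoid_algebra W)"
      then show "p \<otimes>\<^bsub>monoid_algebra W\<^esub> q \<in> carrier (monoid_algebra W)"
        using W.m_closed by (auto simp: monoid_algebra_simps subset_iff dest!: subsetD[OF keys_conv])
    qed (simp_all add: monoid_algebra_simps assoc one)
  qed (simp_all add: monoid_algebra_simps additive_mapD(1)[OF c(1)] additive_mapD(1)[OF c(2)])
qed

lemma monoid_algebra_a_inv:
  assumes "monoid W" "p \<in> carrier (monoid_algebra W :: ('w \<Rightarrow>\<^sub>0 'k::field) ring)"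
  shows "\<ominus>\<^bsub>monoid_algebra W\<^esub> p = - p" "- p \<in> carrier (monoid_algebra W)"
    "q \<in> carrier (monoid_algebra W) \<Longrightarrow> p \<ominus>\<^bsub>monoid_algebra W\<^esub> q = p - q"
proof -
  interpret ring "monoid_algebra W :: ('w \<Rightarrow>\<^sub>0 'k) ring" by (rule monoid_algebra_ring[OF assms(1)])
  have *: "\<ominus>\<^bsub>monoid_algebra W\<^esub> q = - q" "- q \<in> carrier (monoid_algebra W)" if "q \<in> carrier (monoid_algebra W)" for q :: "'w \<Rightarrow>\<^sub>0 'k"
  proof -
    show 1: "- q \<in> carrier (monoid_algebra W)" using that by (auto simp: monoid_algebra_simps in_keys_iff subset_iff)
    show "\<ominus>\<^bsub>monoid_algebra W\<^esub> q = - q"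
      using minus_equality[of "- q" q] that 1 by (simp add: monoid_algebra_simps)
  qed
  show "\<ominus>\<^bsub>monoid_algebra W\<^esub> p = - p" "- p \<in> carrier (monoid_algebra W)" using *[OF assms(2)] by auto
  show "q \<in> carrier (monoid_algebra W) \<Longrightarrow> p \<ominus>\<^bsub>monoid_algebra W\<^esub> q = p - q"
    using *[of q] by (simp add: a_minus_def monoid_algebra_simps)
qed

section \<open>Homomorphisms and quotients\<close>

text \<open>Ring homomorphisms, without unit, from a ring with explicit carrier to a ring of the
  type class.\<close>

definition class_hom :: "('r, 'z) ring_scheme \<Rightarrow> ('r \<Rightarrow> 'c::ring) \<Rightarrow> bool" where
  "class_hom R F \<longleftrightarrow> (\<forall>x\<in>carrier R. \<forall>y\<in>carrier R. F (x \<oplus>\<^bsub>R\<^esub> y) = F x + F y \<and> F (x \<otimes>\<^bsub>R\<^esub> y) = F x * F y)"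

lemma class_homD:
  assumes "class_hom R F" "ring R"
  shows "x \<in> carrier R \<Longrightarrow> y \<in> carrier R \<Longrightarrow> F (x \<oplus>\<^bsub>R\<^esub> y) = F x + F y"
    "x \<in> carrier R \<Longrightarrow> y \<in> carrier R \<Longrightarrow> F (x \<otimes>\<^bsub>R\<^esub> y) = F x * F y" "F \<zero>\<^bsub>R\<^esub> = 0"
    "x \<in> carrier R \<Longrightarrow> F (\<ominus>\<^bsub>R\<^esub> x) = - F x"
    "x \<in> carrier R \<Longrightarrow> y \<in> carrier R \<Longrightarrow> F (x \<ominus>\<^bsub>R\<^esub> y) = F x - F y"
proof -
  interpret ring R by fact
  show 1: "F (x \<oplus>\<^bsub>R\<^esub> y) = F x + F y" "F (x \<otimes>\<^bsub>R\<^esub> y) = F x * F y"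
    if "x \<in> carrier R" "y \<in> carrier R" for x y
    using assms that by (auto simp: class_hom_def)
  show 0: "F \<zero>\<^bsub>R\<^esub> = 0" using 1(1)[of "\<zero>\<^bsub>R\<^esub>" "\<zero>\<^bsub>R\<^esub>"] by simp
  show 2: "F (\<ominus>\<^bsub>R\<^esub> x) = - F x" if "x \<in> carrier R" for x
    using 1(1)[of "\<ominus>\<^bsub>R\<^esub> x" x] that 0 by (simp add: l_neg eq_neg_iff_add_eq_0)
  show "x \<in> carrier R \<Longrightarrow> y \<in> carrier R \<Longrightarrow> F (x \<ominus>\<^bsub>R\<^esub> y) = F x - F y"
    by (simp add: a_minus_def 1 2)
qed

lemma class_hom_kernel:
  assumes F: "class_hom R F" "ring R"
  shows "ideal {x \<in> carrier R. F x = 0} R"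
proof (rule idealI)
  note h = class_homD[OF F]
  interpret ring R by fact
  show "ring R" by fact
  show "subgroup {x \<in> carrier R. F x = 0} (add_monoid R)"
    by (rule add.subgroupI) (auto simp: h a_inv_def[symmetric] intro!: exI[of _ "\<zero>\<^bsub>R\<^esub>"])
qed (use class_homD[OF F] ring.ring_simprules[OF F(2)] in auto)

lemma class_hom_kills_ideal:
  assumes "class_hom R F" "ring R" "G \<subseteq> carrier R" "\<forall>x\<in>G. F x = 0" "y \<in> genideal R G"
  shows "F y = 0"
  using ring.genideal_minimal[OF assms(2) class_hom_kernel[OF assms(1,2)], of G] assms(3-5) by auto

text \<open>The map induced on a quotient, by choice of representatives.\<close>

definition coset_map :: "('r \<Rightarrow> 'c) \<Rightarrow> 'r set \<Rightarrow> 'c" where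
  "coset_map F G = F (SOME x. x \<in> G)"

lemma coset_map_eq:
  assumes I: "ideal I R" and add: "\<And>x y. x \<in> carrier R \<Longrightarrow> y \<in> carrier R \<Longrightarrow> F (x \<oplus>\<^bsub>R\<^esub> y) = F x + (F y :: 'c::ab_group_add)"
    and 0: "\<And>x. x \<in> I \<Longrightarrow> F x = 0" and x: "x \<in> carrier R"
  shows "coset_map F (I +>\<^bsub>R\<^esub> x) = F x"
proof -
  interpret ideal I R by fact
  have *: "F z = F x" if "z \<in> I +>\<^bsub>R\<^esub> x" for z
  proof -
    obtain i where i: "i \<in> I" "z = i \<oplus>\<^bsub>R\<^esub> x" using \<open>z \<in> I +>\<^bsub>R\<^esub> x\<close> by (auto simp: a_r_coset_def r_coset_def)
    then show ?thesis using add[of i x] x a_Hcarr[OF i(1)] 0[OF i(1)] by simp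
  qed
  have "x \<in> I +>\<^bsub>R\<^esub> x" using a_rcos_self[OF x] .
  then show ?thesis unfolding coset_map_def by (intro *) (rule someI)
qed

lemma quotient_carrier: "carrier (R Quot I) = (\<lambda>x. I +>\<^bsub>R\<^esub> x) ` carrier R"
  by (auto simp: FactRing_def A_RCOSETS_def')

lemma quotient_ops:
  assumes I: "ideal I R" and "x \<in> carrier R" "y \<in> carrier R"
  shows "(I +>\<^bsub>R\<^esub> x) \<oplus>\<^bsub>R Quot I\<^esub> (I +>\<^bsub>R\<^esub> y) = I +>\<^bsub>R\<^esub> (x \<oplus>\<^bsub>R\<^esub> y)"
    "(I +>\<^bsub>R\<^esub> x) \<otimes>\<^bsub>R Quot I\<^esub> (I +>\<^bsub>R\<^esub> y) = I +>\<^bsub>R\<^esub> (x \<otimes>\<^bsub>R\<^esub> y)"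
    "(I +>\<^bsub>R\<^esub> x) \<ominus>\<^bsub>R Quot I\<^esub> (I +>\<^bsub>R\<^esub> y) = I +>\<^bsub>R\<^esub> (x \<ominus>\<^bsub>R\<^esub> y)"
    "I +>\<^bsub>R\<^esub> x \<in> carrier (R Quot I)" "\<one>\<^bsub>R Quot I\<^esub> = I +>\<^bsub>R\<^esub> \<one>\<^bsub>R\<^esub>"
proof -
  interpret ideal I R by fact
  interpret h: ring_hom_ring R "R Quot I" "(+>\<^bsub>R\<^esub>) I" by (rule rcos_ring_hom_ring)
  show "(I +>\<^bsub>R\<^esub> x) \<oplus>\<^bsub>R Quot I\<^esub> (I +>\<^bsub>R\<^esub> y) = I +>\<^bsub>R\<^esub> (x \<oplus>\<^bsub>R\<^esub> y)" "(I +>\<^bsub>R\<^esub> x) \<otimes>\<^bsub>R Quot I\<^esub> (I +>\<^bsub>R\<^esub> y) = I +>\<^bsub>R\<^esub> (x \<otimes>\<^bsub>R\<^esub> y)"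
    "I +>\<^bsub>R\<^esub> x \<in> carrier (R Quot I)" "\<one>\<^bsub>R Quot I\<^esub> = I +>\<^bsub>R\<^esub> \<one>\<^bsub>R\<^esub>"
    using assms by simp_all
  show "(I +>\<^bsub>R\<^esub> x) \<ominus>\<^bsub>R Quot I\<^esub> (I +>\<^bsub>R\<^esub> y) = I +>\<^bsub>R\<^esub> (x \<ominus>\<^bsub>R\<^esub> y)"
    using assms by (simp add: a_minus_def)
qed

lemma class_hom_quotient:
  assumes F: "class_hom R F" "ring R" and G: "G \<subseteq> carrier R" "\<forall>x\<in>G. F x = 0"
  shows "class_hom (R Quot genideal R G) (coset_map F)"
    "x \<in> carrier R \<Longrightarrow> coset_map F (genideal R G +>\<^bsub>R\<^esub> x) = F x"
proof -
  interpret ring R by fact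
  have I: "ideal (genideal R G) R" by (rule genideal_ideal[OF G(1)])
  note h = class_homD[OF F]
  show 1: "coset_map F (genideal R G +>\<^bsub>R\<^esub> x) = F x" if "x \<in> carrier R" for x
    by (rule coset_map_eq[OF I h(1) class_hom_kills_ideal[OF F G] that])
  show "class_hom (R Quot genideal R G) (coset_map F)"
    unfolding class_hom_def quotient_carrier by (auto simp: quotient_ops[OF I] 1 h)
qed

lemma class_hom_monoid_algebra:
  fixes g :: "'w \<Rightarrow> 'k::field \<Rightarrow> 'c::ring"
  assumes g: "\<And>u. additive_map (g u)"
    and mult: "\<And>u v a b. u \<in> carrier W \<Longrightarrow> v \<in> carrier W \<Longrightarrow> g (u \<otimes>\<^bsub>W\<^esub> v) (a * b) = g u a * g v b"
  shows "class_hom (monoid_algebra W) (lin_ext g)"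
  unfolding class_hom_def
proof (intro ballI conjI)
  note l = lin_ext_additive[of g, OF g] and c = conv_additive[of W]
  fix p q :: "'w \<Rightarrow>\<^sub>0 'k" assume pq: "p \<in> carrier (monoid_algebra W)" "q \<in> carrier (monoid_algebra W)"
  show "lin_ext g (p \<oplus>\<^bsub>monoid_algebra W\<^esub> q) = lin_ext g p + lin_ext g q"
    by (simp add: monoid_algebra_simps additive_mapD[OF l])
  have "lin_ext g (conv W p q) = lin_ext g p * lin_ext g q"
  proof (rule conv_biadditive_eqI[where F="\<lambda>p q. lin_ext g (conv W p q)" and G="\<lambda>p q. lin_ext g p * lin_ext g q"])
    show "additive_map (\<lambda>p. lin_ext g p * lin_ext g q)" "additive_map (\<lambda>q. lin_ext g p * lin_ext g q)" for p q
      using additive_mapD(1)[OF l] by (simp_all add: additive_map_def distrib_left distrib_right)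
    show "lin_ext g (conv W (Poly_Mapping.single u a) (Poly_Mapping.single v b)) =
       lin_ext g (Poly_Mapping.single u a) * lin_ext g (Poly_Mapping.single v b)"
      if "u \<in> Poly_Mapping.keys p" "v \<in> Poly_Mapping.keys q" for u v a b
      using that pq by (auto simp: conv_single lin_ext_single[of g, OF g] mult monoid_algebra_simps subset_iff)
  qed (rule additive_map_compose[OF l c(1)] additive_map_compose[OF l c(2)])+
  then show "lin_ext g (p \<otimes>\<^bsub>monoid_algebra W\<^esub> q) = lin_ext g p * lin_ext g q"
    by (simp add: monoid_algebra_simps)
qed

lemma coset_eq_ideal:
  assumes "ideal I R" "x \<in> carrier R"
  shows "I +>\<^bsub>R\<^esub> x = I \<longleftrightarrow> x \<in> I"
proof -
  interpret ideal I R by fact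
  show ?thesis
    using a_rcos_self[OF assms(2)] a_coset_join2[OF assms(2) a_subgroup] by blast
qed

lemma coset_mem_iff:
  assumes "ideal I R" "x \<in> carrier R" "y \<in> carrier R"
  shows "y \<in> I +>\<^bsub>R\<^esub> x \<longleftrightarrow> I +>\<^bsub>R\<^esub> y = I +>\<^bsub>R\<^esub> x"
proof -
  interpret ideal I R by fact
  show ?thesis
    using a_rcos_self[OF assms(3)] a_repr_independence[OF _ assms(2) a_subgroup, of y] by auto
qed

lemma quotient_zero: "\<zero>\<^bsub>R Quot I\<^esub> = I"
  by (simp add: FactRing_def)

text \<open>The class of an element in the quotient by generators and relations.\<close>

lemma class_hom_presentation:
  assumes R: "ring R" and G: "G \<subseteq> carrier R" and Q: "Q = R Quot (genideal R G)"
  shows "ring Q" "class_hom R (\<lambda>x. embed Q (genideal R G +>\<^bsub>R\<^esub> x))"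
    "x \<in> G \<Longrightarrow> embed Q (genideal R G +>\<^bsub>R\<^esub> x) = 0"
proof -
  have I: "ideal (genideal R G) R" using ring.genideal_ideal[OF R G] .
  show Qr: "ring Q" unfolding Q by (rule ideal.quotient_is_ring[OF I])
  show "class_hom R (\<lambda>x. embed Q (genideal R G +>\<^bsub>R\<^esub> x))"
    unfolding class_hom_def
  proof (intro ballI conjI)
    fix x y assume "x \<in> carrier R" "y \<in> carrier R"
    note q = quotient_ops[OF I this, folded Q] quotient_ops(4)[OF I \<open>y \<in> carrier R\<close> \<open>x \<in> carrier R\<close>, folded Q]
    show "embed Q (genideal R G +>\<^bsub>R\<^esub> (x \<oplus>\<^bsub>R\<^esub> y)) = embed Q (genideal R G +>\<^bsub>R\<^esub> x) + embed Q (genideal R G +>\<^bsub>R\<^esub> y)"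
      "embed Q (genideal R G +>\<^bsub>R\<^esub> (x \<otimes>\<^bsub>R\<^esub> y)) = embed Q (genideal R G +>\<^bsub>R\<^esub> x) * embed Q (genideal R G +>\<^bsub>R\<^esub> y)"
      unfolding q(1,2)[symmetric] by (rule embed_ops[OF Qr q(4) q(6)])+
  qed
  show "embed Q (genideal R G +>\<^bsub>R\<^esub> x) = 0" if "x \<in> G"
  proof -
    have "genideal R G +>\<^bsub>R\<^esub> x = \<zero>\<^bsub>Q\<^esub>"
      unfolding Q quotient_zero
      by (subst coset_eq_ideal[OF I]) (use that G ring.genideal_self[OF R G] in auto)
    then show ?thesis using embed_ops(3)[OF Qr ring.ring_simprules(2)[OF Qr] ring.ring_simprules(2)[OF Qr]] by simp
  qed
qed

section \<open>The tensor square of an algebra\<close>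

locale commutative_algebra =
  fixes scale :: "'k::field \<Rightarrow> 'a::comm_ring_1 \<Rightarrow> 'a"
  assumes k_alg: "k_algebra scale"
begin

abbreviation "PA \<equiv> (monoid_algebra pair_monoid :: ('a \<times> 'a \<Rightarrow>\<^sub>0 'k) ring)"
abbreviation "TS \<equiv> tensor_square scale"
abbreviation "TI \<equiv> tensor_ideal scale"

lemma pair_monoid_simps [simp]:
  "carrier (pair_monoid :: ('a \<times> 'a) monoid) = UNIV"
  "u \<otimes>\<^bsub>pair_monoid\<^esub> v = (fst u * fst v, snd u * snd v :: 'a)"
  "\<one>\<^bsub>pair_monoid\<^esub> = (1 :: 'a, 1 :: 'a)"
  by (auto simp: pair_monoid_def split: prod.splits)

lemma PA_cring: "cring PA"
proof -
  have m: "monoid (pair_monoid :: ('a \<times> 'a) monoid)" by (rule monoidI) (auto simp: mult.assoc)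
  have "conv pair_monoid p q = conv pair_monoid q p" for p q :: "'a \<times> 'a \<Rightarrow>\<^sub>0 'k"
    by (rule conv_biadditive_eqI[of "conv pair_monoid" "\<lambda>p q. conv pair_monoid q p"])
      (auto intro: conv_additive simp: conv_single mult.commute)
  then show ?thesis
    by (intro cring.intro monoid_algebra_ring[OF m] comm_monoid.intro comm_monoid_axioms.intro ring.is_monoid)
      (auto simp: monoid_algebra_simps)
qed

lemma PA_ring: "ring PA" using PA_cring by (simp add: cring_def)

lemma PA_carrier [simp]: "p \<in> carrier PA"
  by (simp add: monoid_algebra_simps)

lemma PA_minus [simp]: "p \<ominus>\<^bsub>PA\<^esub> q = p - q"
proof -
  have "monoid (pair_monoid :: ('a \<times> 'a) monoid)" by (rule monoidI) (auto simp: mult.assoc)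
  then show ?thesis by (intro monoid_algebra_a_inv) auto
qed

lemma TI_ideal: "ideal TI PA"
  unfolding tensor_ideal_def by (rule ring.genideal_ideal[OF PA_ring]) auto

lemma TS_cring: "cring TS"
  unfolding tensor_square_def by (rule ideal.quotient_is_cring[OF TI_ideal PA_cring])

lemma TS_ring: "ring TS" using TS_cring by (simp add: cring_def)

text \<open>The image of a formal combination of pairs in the tensor square.\<close>

definition bt :: "('a \<times> 'a \<Rightarrow>\<^sub>0 'k) \<Rightarrow> ('a, 'k) tensor cring_family" where
  "bt p = cembed TS (TI +>\<^bsub>PA\<^esub> p)"

text \<open>Pure tensors, as elements of a commutative ring of the type class.\<close>

definition tens :: "'a \<Rightarrow> 'a \<Rightarrow> ('a, 'k) tensor cring_family" where
  "tens x y = cembed TS (tensor scale x y)"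

lemma TS_elements: "TI +>\<^bsub>PA\<^esub> p \<in> carrier TS" "t \<in> carrier TS \<Longrightarrow> \<exists>p. t = TI +>\<^bsub>PA\<^esub> p"
  by (auto simp: tensor_square_def quotient_carrier)

lemma tensor_closed [simp]: "tensor scale x y \<in> carrier TS"
  by (simp add: tensor_def TS_elements)

lemma bt_word: "bt (word (x, y)) = tens x y"
  by (simp add: bt_def tens_def tensor_def)

lemma bt_additive: "additive_map bt"
  unfolding additive_map_def
proof (intro allI)
  fix p q :: "'a \<times> 'a \<Rightarrow>\<^sub>0 'k"
  have "TI +>\<^bsub>PA\<^esub> (p + q) = (TI +>\<^bsub>PA\<^esub> p) \<oplus>\<^bsub>TS\<^esub> (TI +>\<^bsub>PA\<^esub> q)"
    using quotient_ops(1)[OF TI_ideal, of p q] by (simp add: tensor_square_def monoid_algebra_simps)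
  then show "bt (p + q) = bt p + bt q"
    by (simp add: bt_def cembed_ops[OF TS_cring] TS_elements)
qed

lemma bt_conv: "bt (conv pair_monoid p q) = bt p * bt q"
proof -
  have "TI +>\<^bsub>PA\<^esub> (conv pair_monoid p q) = (TI +>\<^bsub>PA\<^esub> p) \<otimes>\<^bsub>TS\<^esub> (TI +>\<^bsub>PA\<^esub> q)"
    using quotient_ops(2)[OF TI_ideal, of p q] by (simp add: tensor_square_def monoid_algebra_simps)
  then show ?thesis
    by (simp add: bt_def cembed_ops[OF TS_cring] TS_elements)
qed

lemma bt_eq_0_iff: "bt p = 0 \<longleftrightarrow> p \<in> TI"
proof -
  have z: "cembed TS \<zero>\<^bsub>TS\<^esub> = 0" "\<zero>\<^bsub>TS\<^esub> \<in> carrier TS"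
    using cembed_ops(3)[OF TS_cring tensor_closed tensor_closed] ring.ring_simprules(2)[OF TS_ring] by auto
  have "bt p = 0 \<longleftrightarrow> TI +>\<^bsub>PA\<^esub> p = \<zero>\<^bsub>TS\<^esub>"
    using cembed_inj[OF TS_cring TS_elements(1) z(2), of p] z(1) by (auto simp: bt_def)
  also have "\<dots> \<longleftrightarrow> p \<in> TI"
    by (simp add: tensor_square_def quotient_zero coset_eq_ideal[OF TI_ideal])
  finally show ?thesis .
qed

lemma bt_rels: "p \<in> tensor_rels scale \<Longrightarrow> bt p = 0"
  using ring.genideal_self[OF PA_ring subsetI[OF PA_carrier], of "tensor_rels scale"]
  by (auto simp: bt_eq_0_iff tensor_ideal_def)

lemma tensor_relsI:
  "word (a + a', b) - word (a, b) - word (a', b) \<in> tensor_rels scale"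
  "word (a, b + b') - word (a, b) - word (a, b') \<in> tensor_rels scale"
  "word (scale c a, b) - Poly_Mapping.single (a, b) c \<in> tensor_rels scale"
  "word (a, scale c b) - Poly_Mapping.single (a, b) c \<in> tensor_rels scale"
  unfolding tensor_rels_def by blast+

lemma tens_balanced_family: "balanced scale tens"
  unfolding balanced_def
proof (intro conjI allI)
  note b = additive_mapD[OF bt_additive]
  fix x x' y y' :: 'a and c :: 'k
  have "bt (word (x + x', y) - word (x, y) - word (x', y)) = 0"
    by (intro bt_rels tensor_relsI)
  then show "tens (x + x') y = tens x y + tens x' y" by (simp add: b bt_word algebra_simps)
  have "bt (word (x, y + y') - word (x, y) - word (x, y')) = 0"
    by (intro bt_rels tensor_relsI)
  then show "tens x (y + y') = tens x y + tens x y'" by (simp add: b bt_word algebra_simps)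
  have "bt (word (scale c x, y) - Poly_Mapping.single (x, y) c) = 0"
    "bt (word (x, scale c y) - Poly_Mapping.single (x, y) c) = 0"
    by (intro bt_rels tensor_relsI)+
  then show "tens (scale c x) y = tens x (scale c y)" by (simp add: b bt_word)
qed

lemma bt_single: "bt (Poly_Mapping.single (x, y) c) = tens (scale c x) y"
proof -
  have "bt (word (scale c x, y) - Poly_Mapping.single (x, y) c) = 0"
    by (intro bt_rels tensor_relsI)+
  then show ?thesis by (simp add: additive_mapD[OF bt_additive] bt_word)
qed

lemma tens_mult_family: "tens a b * tens c d = tens (a * c) (b * d)"
  by (simp add: bt_word[symmetric] bt_conv[symmetric] conv_single)

text \<open>The universal property of the tensor square.\<close>

lemma tens_lift:
  fixes f :: "'a \<Rightarrow> 'a \<Rightarrow> 'c::ab_group_add"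
  assumes f: "balanced scale f"
  shows "\<exists>F. additive_map F \<and> (\<forall>x y. F (tens x y) = f x y)"
proof -
  note K = k_algebra_scale[OF k_alg]
  \<comment> \<open>the values of \<open>f\<close> are twisted by all pairs \<open>w\<close>, so that the common kernel is an ideal\<close>
  define g :: "'a \<times> 'a \<Rightarrow> 'a \<times> 'a \<Rightarrow> 'k \<Rightarrow> 'c" where
    "g w u a = f (scale a (fst u * fst w)) (snd u * snd w)" for w u a
  have fadd: "f (x + x') y = f x y + f x' y" "f x (y + y') = f x y + f x y'" "f (scale c x) y = f x (scale c y)" for x x' y y' c
    using f by (auto simp: balanced_def)
  have sc: "scale (a + b) x = scale a x + scale b x" for a b x
    using k_alg by (metis k_algebra_def vector_space.vector_space_assms(2))
  have g: "additive_map (g w u)" for w u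
    by (simp add: additive_map_def g_def fadd sc)
  note l = lin_ext_additive[of "g _", OF g]
  define Z where "Z = {p :: 'a \<times> 'a \<Rightarrow>\<^sub>0 'k. \<forall>w. lin_ext (g w) p = 0}"
  have left: "conv pair_monoid q p \<in> Z" if p: "p \<in> Z" for p q
    unfolding Z_def
  proof (intro CollectI allI)
    fix w
    have "lin_ext (g w) (conv pair_monoid q p) = 0"
    proof (rule additive_eq_on_singles[of "\<lambda>q. lin_ext (g w) (conv pair_monoid q p)" "\<lambda>q. 0"])
      fix u b
      have "lin_ext (g w) (conv pair_monoid (Poly_Mapping.single u b) p)
          = lin_ext (g (scale b (fst u) * fst w, snd u * snd w)) p"
      proof (rule additive_eq_on_singles[of "\<lambda>p. lin_ext (g w) (conv pair_monoid (Poly_Mapping.single u b) p)"])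
        fix v :: "'a \<times> 'a" and c
        have "scale (b * c) (fst u * fst v * fst w) = scale c (fst v * (scale b (fst u) * fst w))"
        proof -
          have "scale (b * c) (fst u * fst v * fst w) = scale c (scale b (fst u * (fst v * fst w)))"
            by (simp only: K(11) mult.assoc mult.commute[of b c])
          also have "\<dots> = scale c (fst v * (scale b (fst u) * fst w))"
            unfolding K(8)[of b "fst u"] by (simp only: mult.left_commute)
          finally show ?thesis .
        qed
        then show "lin_ext (g w) (conv pair_monoid (Poly_Mapping.single u b) (Poly_Mapping.single v c)) =
          lin_ext (g (scale b (fst u) * fst w, snd u * snd w)) (Poly_Mapping.single v c)"
          by (simp add: conv_single lin_ext_single[of "g _", OF g] g_def algebra_simps)
      qed (intro l additive_map_compose[OF l conv_additive(2)])+
      then show "lin_ext (g w) (conv pair_monoid (Poly_Mapping.single u b) p) = 0" using p by (simp add: Z_def)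
    qed (rule additive_map_compose[OF l conv_additive(1)], simp add: additive_map_def)
    then show "lin_ext (g w) (conv pair_monoid q p) = 0" .
  qed
  have "ideal Z PA"
  proof (rule idealI)
    show "ring PA" by (rule PA_ring)
    show "subgroup Z (add_monoid PA)"
    proof
      fix p assume p: "p \<in> Z"
      have "inv\<^bsub>add_monoid PA\<^esub> p = - p"
        using PA_minus[of 0 p] ring.ring_simprules(14)[OF PA_ring, of 0 p]
          ring.ring_simprules(8)[OF PA_ring, of "\<ominus>\<^bsub>PA\<^esub> p"] ring.ring_simprules(3)[OF PA_ring, of p]
        by (simp add: a_inv_def monoid_algebra_simps)
      then show "inv\<^bsub>add_monoid PA\<^esub> p \<in> Z" using p by (simp add: Z_def additive_mapD[OF l])
    qed (auto simp: Z_def monoid_algebra_simps additive_mapD[OF l])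
    fix p q assume "p \<in> Z"
    then show "q \<otimes>\<^bsub>PA\<^esub> p \<in> Z" "p \<otimes>\<^bsub>PA\<^esub> q \<in> Z"
      using left[of p q] cring.cring_simprules(14)[OF PA_cring, of p q] by (auto simp: monoid_algebra_simps)
  qed
  moreover have "tensor_rels scale \<subseteq> Z"
  proof -
    note e = additive_mapD[OF l] lin_ext_single[of "g _", OF g] g_def fst_conv snd_conv K(3)
    have "lin_ext (g w) (word (a + a', b) - word (a, b) - word (a', b)) = 0"
      "lin_ext (g w) (word (a, b + b') - word (a, b) - word (a, b')) = 0"
      "lin_ext (g w) (word (scale c a, b) - Poly_Mapping.single (a, b) c) = 0"
      "lin_ext (g w) (word (a, scale c b) - Poly_Mapping.single (a, b) c) = 0" for w a a' b b' c
      unfolding e by (simp_all add: distrib_right fadd(1,2) K(8)[symmetric] fadd(3))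
    then show ?thesis unfolding tensor_rels_def Z_def by blast
  qed
  ultimately have TZ: "TI \<subseteq> Z"
    unfolding tensor_ideal_def by (rule ring.genideal_minimal[OF PA_ring])
  define F0 where "F0 = coset_map (lin_ext (g (1, 1)))"
  have F0: "F0 (TI +>\<^bsub>PA\<^esub> p) = lin_ext (g (1, 1)) p" for p
    unfolding F0_def using TZ
    by (intro coset_map_eq[OF TI_ideal]) (auto simp: Z_def monoid_algebra_simps additive_mapD[OF l])
  have F0_add: "F0 (s \<oplus>\<^bsub>TS\<^esub> t) = F0 s + F0 t" if "s \<in> carrier TS" "t \<in> carrier TS" for s t
  proof -
    obtain p q where pq: "s = TI +>\<^bsub>PA\<^esub> p" "t = TI +>\<^bsub>PA\<^esub> q" using TS_elements(2) \<open>s \<in> carrier TS\<close> \<open>t \<in> carrier TS\<close> by metis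
    have "s \<oplus>\<^bsub>TS\<^esub> t = TI +>\<^bsub>PA\<^esub> (p + q)"
      using quotient_ops(1)[OF TI_ideal, of p q] by (simp add: pq tensor_square_def monoid_algebra_simps)
    then show ?thesis by (simp only: F0 pq additive_mapD[OF l])
  qed
  have "additive_map (\<lambda>u. F0 (ccomponent TS u))"
    by (simp add: additive_map_def ccomponent_ops[OF TS_cring] F0_add)
  moreover have "F0 (ccomponent TS (tens x y)) = f x y" for x y
  proof -
    have "ccomponent TS (tens x y) = TI +>\<^bsub>PA\<^esub> word (x, y)"
      by (simp add: tens_def ccomponent_ops[OF TS_cring] tensor_def TS_elements)
    then show ?thesis by (simp add: F0 lin_ext_single[of "g _", OF g] g_def K(3))
  qed
  ultimately show ?thesis by blast
qed

sublocale tensor_square_model scale tens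
  by (rule tensor_square_model.intro[OF k_alg tens_balanced_family tens_mult_family tens_lift tens_lift])

lemma bt_B: "bt p \<in> B"
proof -
  have "bt p = (\<Sum>u\<in>Poly_Mapping.keys p. bt (Poly_Mapping.single u (Poly_Mapping.lookup p u)))"
    by (simp only: additive_mapD(5)[OF bt_additive, symmetric] sum_singles)
  also have "\<dots> \<in> B" by (intro B_sum) (metis bt_single B_tens prod.exhaust)
  finally show ?thesis .
qed

lemma B_eq: "B = cembed TS ` carrier TS"
proof
  show "cembed TS ` carrier TS \<subseteq> B" using TS_elements(2) bt_B by (fastforce simp: bt_def)
  show "B \<subseteq> cembed TS ` carrier TS"
  proof
    fix p assume "p \<in> B"
    then have "\<exists>q. p = bt q"
    proof induction
      case zero then show ?case using additive_mapD(2)[OF bt_additive] by metis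
    next
      case (step p x y)
      then obtain q where "p = bt q" by blast
      then have "tens x y + p = bt (word (x, y) + q)" by (simp only: additive_mapD[OF bt_additive] bt_word)
      then show ?case by blast
    qed
    then show "p \<in> cembed TS ` carrier TS" using TS_elements(1) by (auto simp: bt_def)
  qed
qed

lemma cembed_TS:
  "s \<in> carrier TS \<Longrightarrow> cembed TS s \<in> B" "p \<in> B \<Longrightarrow> cembed TS (ccomponent TS p) = p" "p \<in> B \<Longrightarrow> ccomponent TS p \<in> carrier TS"
  "s \<in> carrier TS \<Longrightarrow> ccomponent TS (cembed TS s) = s"
  using ccomponent_ops[OF TS_cring] by (auto simp: B_eq)

lemma cembed_TS_eq_iff: "s \<in> carrier TS \<Longrightarrow> t \<in> carrier TS \<Longrightarrow> s = t \<longleftrightarrow> cembed TS s = cembed TS t"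
  using cembed_inj[OF TS_cring] by blast

lemma coset_bt: "TI +>\<^bsub>PA\<^esub> p = {q. bt q = bt p}"
  using cembed_TS_eq_iff[OF TS_elements(1) TS_elements(1)]
  by (auto simp: bt_def coset_mem_iff[OF TI_ideal])

lemma tensor_mult_eq:
  assumes "t \<in> carrier TS"
  shows "tensor_mult scale t = tmult (cembed TS t)"
proof -
  obtain p where p: "t = TI +>\<^bsub>PA\<^esub> p" using TS_elements(2)[OF assms] by blast
  define g where "g = (\<lambda>(a, b) c. scale c (a * b) :: 'a)"
  have g: "additive_map (g u)" for u
    by (cases u) (simp add: g_def additive_map_def scale_left_distrib)
  have 1: "(\<Sum>(a, b)\<in>Poly_Mapping.keys q. scale (Poly_Mapping.lookup q (a, b)) (a * b)) = lin_ext g q" for q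
    unfolding lin_ext_def g_def by (intro sum.cong) auto
  have 2: "lin_ext g q = tmult (bt q)" for q
    by (rule additive_eq_on_singles[OF lin_ext_additive[OF g] additive_map_compose[OF tmult(1) bt_additive]])
      (unfold lin_ext_single[OF g], auto simp: g_def bt_single tmult_simps K(8))
  have "(\<lambda>p. \<Sum>(a, b)\<in>Poly_Mapping.keys p. scale (Poly_Mapping.lookup p (a, b)) (a * b)) ` t = {tmult (bt p)}"
    unfolding p coset_bt by (auto simp: 1 2)
  then show ?thesis by (simp add: tensor_mult_def p bt_def)
qed

lemma tensor_flip_eq:
  assumes "t \<in> carrier TS"
  shows "tensor_flip t \<in> carrier TS" "cembed TS (tensor_flip t) = tflip (cembed TS t)"
proof -
  obtain p where p: "t = TI +>\<^bsub>PA\<^esub> p" using TS_elements(2)[OF assms] by blast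
  define s where "s = (Poly_Mapping.map_key prod.swap :: ('a \<times> 'a \<Rightarrow>\<^sub>0 'k) \<Rightarrow> _)"
  have s: "additive_map s" by (simp add: additive_map_def s_def map_key_plus)
  have ss: "s (Poly_Mapping.single (x, y) c) = Poly_Mapping.single (y, x) c" for x y c
    using map_key_single[of prod.swap "(y, x)" c] by (simp add: s_def)
  have inv: "s (s q) = q" for q
    using additive_eq_on_singles[of "\<lambda>q. s (s q)" "\<lambda>q. q" q] by (auto simp: additive_map_def additive_mapD[OF s] ss)
  have bs: "bt (s q) = tflip (bt q)" for q
    by (rule additive_eq_on_singles[OF additive_map_compose[OF bt_additive s] additive_map_compose[OF tflip(1) bt_additive]])
      (auto simp: ss bt_single tflip_simps tens_scale)
  have "tensor_flip t = TI +>\<^bsub>PA\<^esub> s p"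
  proof
    show "tensor_flip t \<subseteq> TI +>\<^bsub>PA\<^esub> s p"
      unfolding tensor_flip_def p coset_bt by (auto simp: bs simp flip: s_def)
    show "TI +>\<^bsub>PA\<^esub> s p \<subseteq> tensor_flip t"
    proof
      fix q assume "q \<in> TI +>\<^bsub>PA\<^esub> s p"
      then have "bt (s q) = bt p" by (simp add: coset_bt bs tflip_tflip bt_B)
      then show "q \<in> tensor_flip t"
        unfolding tensor_flip_def p coset_bt s_def[symmetric] by (intro image_eqI[of _ _ "s q"]) (auto simp: inv)
    qed
  qed
  then show "tensor_flip t \<in> carrier TS" "cembed TS (tensor_flip t) = tflip (cembed TS t)"
    using bs[of p] by (auto simp: TS_elements p bt_def)
qed

text \<open>The maps \<open>cl\<close> and \<open>un\<close> identify double derivations, whose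
  values are cosets, with double derivations in the model.\<close>

definition cl :: "('a, 'k) double_derivation \<Rightarrow> 'a \<Rightarrow> ('a, 'k) tensor cring_family" where
  "cl \<Theta> = (\<lambda>x. cembed TS (\<Theta> x))"

definition un :: "('a \<Rightarrow> ('a, 'k) tensor cring_family) \<Rightarrow> ('a, 'k) double_derivation" where
  "un \<Psi> = (\<lambda>x. ccomponent TS (\<Psi> x))"

lemma double_der_iff: "\<Theta> \<in> double_der scale \<longleftrightarrow> (\<forall>x. \<Theta> x \<in> carrier TS) \<and> cl \<Theta> \<in> DD"
proof (cases "\<forall>x. \<Theta> x \<in> carrier TS")
  case True
  note s = ring.ring_simprules(1,5)[OF TS_ring]
  have c: "tensor scale x y \<otimes>\<^bsub>TS\<^esub> \<Theta> z \<otimes>\<^bsub>TS\<^esub> tensor scale x' y' \<in> carrier TS" for x y x' y' z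
    using True by (intro s) auto
  have B: "cembed TS (\<Theta> x) \<in> B" for x using True cembed_TS(1) by blast
  have *: "cembed TS (tensor scale x 1) * cembed TS (\<Theta> y) * cembed TS (tensor scale 1 1) = cembed TS (tensor scale x 1) * cembed TS (\<Theta> y)"
    "cembed TS (tensor scale 1 1) * cembed TS (\<Theta> x) * cembed TS (tensor scale 1 y) = cembed TS (tensor scale 1 y) * cembed TS (\<Theta> x)" for x y
    using tens_unit[OF B_mult[OF B_tens B], of x 1 y] tens_unit[OF B, of x]
    by (simp_all add: tens_def[symmetric] mult.commute)
  show ?thesis
    using True c B
    by (simp add: double_der_def DD_def cembed_TS_eq_iff outer_act_def s cembed_ops[OF TS_cring] cl_def * tens_def)
next
  case False
  then show ?thesis by (auto simp: double_der_def)
qed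

lemma cl_DD: "\<Theta> \<in> double_der scale \<Longrightarrow> cl \<Theta> \<in> DD"
  by (simp add: double_der_iff)

lemma cl_un: "\<Psi> \<in> DD \<Longrightarrow> cl (un \<Psi>) = \<Psi>"
  by (auto simp: cl_def un_def cembed_TS DD_props(1))

lemma un_double_der: "\<Psi> \<in> DD \<Longrightarrow> un \<Psi> \<in> double_der scale"
  unfolding double_der_iff by (simp add: cl_un) (simp add: un_def cembed_TS DD_props(1))

lemma un_cl: "\<Theta> \<in> double_der scale \<Longrightarrow> un (cl \<Theta>) = \<Theta>"
  by (auto simp: double_der_iff cl_def un_def cembed_TS)

lemma cl_inj: "\<Theta> \<in> double_der scale \<Longrightarrow> \<Psi> \<in> double_der scale \<Longrightarrow> cl \<Theta> = cl \<Psi> \<Longrightarrow> \<Theta> = \<Psi>"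
  using un_cl by metis

abbreviation "DM \<equiv> double_der_bimod scale"

lemma DM_carrier [simp]: "carrier DM = double_der scale"
  by (simp add: double_der_bimod_def)

lemma cl_bimod:
  assumes "\<Theta> \<in> double_der scale"
  shows "lact DM b \<Theta> \<in> double_der scale" "cl (lact DM b \<Theta>) = (\<lambda>x. tens 1 b * cl \<Theta> x)"
    "ract DM \<Theta> b \<in> double_der scale" "cl (ract DM \<Theta> b) = (\<lambda>x. tens b 1 * cl \<Theta> x)"
    "\<Psi> \<in> double_der scale \<Longrightarrow> madd DM \<Theta> \<Psi> \<in> double_der scale"
    "\<Psi> \<in> double_der scale \<Longrightarrow> cl (madd DM \<Theta> \<Psi>) = (\<lambda>x. cl \<Theta> x + cl \<Psi> x)"
proof -
  have c: "\<Theta> x \<in> carrier TS" if "\<Theta> \<in> double_der scale" for \<Theta> x using that by (simp add: double_der_iff)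
  note s = ring.ring_simprules(1,5)[OF TS_ring]
  have u: "tens 1 1 * cl \<Theta> x = cl \<Theta> x" "cl \<Theta> x * tens 1 1 = cl \<Theta> x" for x
    using tens_unit[OF DD_props(1)[OF cl_DD[OF assms]]] by (auto simp: mult.commute)
  have inn: "inner_act scale a (\<Theta> x) b \<in> carrier TS" "cembed TS (inner_act scale a (\<Theta> x) b) = tens 1 a * cl \<Theta> x * tens b 1" for a b x
    using c[OF assms] by (simp_all add: inner_act_def s cembed_ops[OF TS_cring] tens_def cl_def)
  show 2: "cl (lact DM b \<Theta>) = (\<lambda>x. tens 1 b * cl \<Theta> x)"
  proof
    fix x
    have "cl (lact DM b \<Theta>) x = cembed TS (inner_act scale b (\<Theta> x) 1)" by (simp add: cl_def double_der_bimod_def)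
    then show "cl (lact DM b \<Theta>) x = tens 1 b * cl \<Theta> x" by (simp add: inn mult.assoc u)
  qed
  show 4: "cl (ract DM \<Theta> b) = (\<lambda>x. tens b 1 * cl \<Theta> x)"
  proof
    fix x
    have "cl (ract DM \<Theta> b) x = cembed TS (inner_act scale 1 (\<Theta> x) b)" by (simp add: cl_def double_der_bimod_def)
    then show "cl (ract DM \<Theta> b) x = tens b 1 * cl \<Theta> x" by (simp add: inn u mult.commute)
  qed
  show "lact DM b \<Theta> \<in> double_der scale" "ract DM \<Theta> b \<in> double_der scale"
    unfolding double_der_iff 2 4 using DD_mult[OF B_tens cl_DD[OF assms]]
    by (auto simp: double_der_bimod_def inn)
  assume P: "\<Psi> \<in> double_der scale"
  show 6: "cl (madd DM \<Theta> \<Psi>) = (\<lambda>x. cl \<Theta> x + cl \<Psi> x)"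
    using c[OF P] c[OF assms] by (auto simp: cl_def double_der_bimod_def cembed_ops[OF TS_cring])
  show "madd DM \<Theta> \<Psi> \<in> double_der scale"
    unfolding double_der_iff 6 using DD_add[OF cl_DD[OF assms] cl_DD[OF P]] c[OF P] c[OF assms]
    by (auto simp: double_der_bimod_def s)
qed

lemma dd_Delta: "dd_Delta scale \<in> double_der scale" "cl (dd_Delta scale) = delta"
proof -
  show 1: "cl (dd_Delta scale) = delta"
    by (auto simp: cl_def dd_Delta_def delta_def cembed_ops[OF TS_cring] tens_def)
  show "dd_Delta scale \<in> double_der scale"
    unfolding double_der_iff 1
    by (auto simp: dd_Delta_def delta_DD intro!: ring.ring_simprules(4)[OF TS_ring])
qed

end

lemma class_hom_coset:
  assumes R: "ring R" and I: "ideal I R" and K: "class_hom (R Quot I) K"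
  shows "class_hom R (\<lambda>x. K (I +>\<^bsub>R\<^esub> x))" "x \<in> I \<Longrightarrow> K (I +>\<^bsub>R\<^esub> x) = 0"
proof -
  have Q: "ring (R Quot I)" by (rule ideal.quotient_is_ring[OF I])
  show "class_hom R (\<lambda>x. K (I +>\<^bsub>R\<^esub> x))"
    unfolding class_hom_def
  proof (intro ballI conjI)
    fix x y assume xy: "x \<in> carrier R" "y \<in> carrier R"
    show "K (I +>\<^bsub>R\<^esub> (x \<oplus>\<^bsub>R\<^esub> y)) = K (I +>\<^bsub>R\<^esub> x) + K (I +>\<^bsub>R\<^esub> y)"
      "K (I +>\<^bsub>R\<^esub> (x \<otimes>\<^bsub>R\<^esub> y)) = K (I +>\<^bsub>R\<^esub> x) * K (I +>\<^bsub>R\<^esub> y)"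
      unfolding quotient_ops(1,2)[OF I xy, symmetric]
      using class_homD(1,2)[OF K Q quotient_ops(4)[OF I xy] quotient_ops(4)[OF I xy(2,1)]] by simp_all
  qed
  assume x: "x \<in> I"
  then have "x \<in> carrier R" using ideal.Icarr[OF I] by blast
  then have "I +>\<^bsub>R\<^esub> x = \<zero>\<^bsub>R Quot I\<^esub>" using x by (simp add: coset_eq_ideal[OF I] quotient_zero)
  then show "K (I +>\<^bsub>R\<^esub> x) = 0" using class_homD(3)[OF K Q] by simp
qed

lemma class_hom_sum_singles:
  fixes H :: "('w \<Rightarrow>\<^sub>0 'k::field) \<Rightarrow> 'c::ring"
  assumes W: "monoid W" and H: "class_hom (monoid_algebra W) H" and p: "p \<in> carrier (monoid_algebra W)"
  shows "H p = (\<Sum>w\<in>Poly_Mapping.keys p. H (Poly_Mapping.single w (Poly_Mapping.lookup p w)))"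
proof -
  note R = monoid_algebra_ring[OF W, where 'k='k]
  note h = class_homD[OF H R]
  have "(\<Sum>w\<in>F. Poly_Mapping.single w (Poly_Mapping.lookup p w)) \<in> carrier (monoid_algebra W) \<and>
    H (\<Sum>w\<in>F. Poly_Mapping.single w (Poly_Mapping.lookup p w)) = (\<Sum>w\<in>F. H (Poly_Mapping.single w (Poly_Mapping.lookup p w)))"
    if "finite F" "F \<subseteq> carrier W" for F
    using that
  proof (induction F)
    case empty
    show ?case using h(3) ring.ring_simprules(2)[OF R] by (simp add: monoid_algebra_simps(4))
  next
    case (insert w F)
    then have c: "Poly_Mapping.single w (Poly_Mapping.lookup p w) \<in> carrier (monoid_algebra W)"
      by (auto simp: monoid_algebra_simps(1) split: if_splits)
    show ?case using insert h(1)[OF c] ring.ring_simprules(1)[OF R c] c by (auto simp: monoid_algebra_simps(3))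
  qed
  from this[of "Poly_Mapping.keys p"] show ?thesis using p by (simp add: sum_singles monoid_algebra_simps(1))
qed

lemma foldl_times_start: "foldl (\<lambda>x m. x * h m) (x * y) ms = x * foldl (\<lambda>x m. x * h m) y (ms :: 'm list)" for x y :: "'c::ring"
  by (induction ms rule: rev_induct) (auto simp: mult.assoc)

lemma foldl_times_additive: "additive_map (\<lambda>x :: 'c::ring. foldl (\<lambda>x m. x * h m) x ms)"
  by (induction ms rule: rev_induct) (auto simp: additive_map_def distrib_right)

lemma foldl_times_commute:
  fixes z :: "'c::ring"
  assumes "z * x = x * z" "\<And>m. m \<in> set ms \<Longrightarrow> z * h m = h m * z"
  shows "z * foldl (\<lambda>x m. x * h m) x ms = foldl (\<lambda>x m. x * h m) x ms * z"
  using assms(2)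
proof (induction ms rule: rev_induct)
  case (snoc m ms)
  then have c: "z * foldl (\<lambda>x m. x * h m) x ms = foldl (\<lambda>x m. x * h m) x ms * z" "z * h m = h m * z" by auto
  have "z * (foldl (\<lambda>x m. x * h m) x ms * h m) = foldl (\<lambda>x m. x * h m) x ms * (z * h m)"
    by (simp only: mult.assoc[symmetric] c(1))
  then show ?case by (simp add: c(2) mult.assoc)
qed (simp add: assms(1))

section \<open>The algebra of differential operators on half-forms\<close>

text \<open>The coordinate ring of a smooth affine curve.\<close>

locale affine_curve =
  fixes scale :: "'k::{alg_closed_field, field_char_0} \<Rightarrow> 'a::comm_ring_1 \<Rightarrow> 'a"
  assumes smooth_curve: "smooth_affine_curve scale"
begin

sublocale commutative_algebra scale
  by (rule commutative_algebra.intro) (use smooth_curve in \<open>simp add: smooth_affine_curve_def\<close>)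

sublocale tensor_square_curve scale tens
  by (intro tensor_square_curve.intro tensor_square_model_axioms tensor_square_curve_axioms.intro smooth_curve)

abbreviation "HW \<equiv> half_words scale"
abbreviation "HA \<equiv> (monoid_algebra HW :: ('a half_gen list \<Rightarrow>\<^sub>0 'k) ring)"
abbreviation "HD \<equiv> half_diffop scale"

lemma HW_simps [simp]: "carrier HW = lists (range Fn \<union> Lie ` der scale)" "u \<otimes>\<^bsub>HW\<^esub> v = u @ v" "\<one>\<^bsub>HW\<^esub> = []"
  by (simp_all add: half_words_def)

lemma Lie_mem_iff [simp]: "Lie \<xi> \<in> Lie ` der scale \<longleftrightarrow> \<xi> \<in> der scale"
  by auto

lemma HW_monoid: "monoid HW" by (rule monoidI) auto

lemmas HA_ring = monoid_algebra_ring[OF HW_monoid, where 'k='k]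

lemma HA_single [simp]: "u \<in> lists (range Fn \<union> Lie ` der scale) \<Longrightarrow> Poly_Mapping.single u c \<in> carrier HA"
  by (auto simp: monoid_algebra_simps split: if_splits)

lemma HA_minus: "p \<in> carrier HA \<Longrightarrow> q \<in> carrier HA \<Longrightarrow> p - q \<in> carrier HA"
  using monoid_algebra_a_inv(3)[OF HW_monoid, of p q] ring.ring_simprules(4)[OF HA_ring, of p q] by simp

lemma half_rels_carrier: "half_rels scale \<subseteq> carrier HA"
  unfolding half_rels_def by (auto intro!: HA_minus HA_single simp: der_add der_scale der_bracket der_mult)

text \<open>The images in the type-class ring of formal combinations of words, of functions and of
  Lie derivatives.\<close>

definition hcl :: "('a half_gen list \<Rightarrow>\<^sub>0 'k) \<Rightarrow> ('a half_gen list \<Rightarrow>\<^sub>0 'k) set ring_family" where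
  "hcl p = embed HD (half_class scale p)"

lemma HD_ring: "ring HD" and hcl_hom: "class_hom HA hcl" and hcl_rels: "p \<in> half_rels scale \<Longrightarrow> hcl p = 0"
  using class_hom_presentation[OF HA_ring half_rels_carrier, of HD]
  by (simp_all add: half_diffop_def half_ideal_def half_class_def[abs_def] hcl_def[abs_def])

lemma half_class_closed: "p \<in> carrier HA \<Longrightarrow> half_class scale p \<in> carrier HD"
  and HD_elements: "t \<in> carrier HD \<Longrightarrow> \<exists>p\<in>carrier HA. t = half_class scale p"
  by (auto simp: half_diffop_def quotient_carrier half_class_def)

lemma hcl_ops:
  assumes "p \<in> carrier HA" "q \<in> carrier HA"
  shows "hcl (p + q) = hcl p + hcl q" "hcl (conv HW p q) = hcl p * hcl q" "hcl (p - q) = hcl p - hcl q"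
  using class_homD(1,2,5)[OF hcl_hom HA_ring, of p q] assms monoid_algebra_a_inv(3)[OF HW_monoid assms(1,2)]
  by (simp_all add: monoid_algebra_simps(2,3))

definition fun_op :: "'a \<Rightarrow> ('a half_gen list \<Rightarrow>\<^sub>0 'k) set ring_family" where "fun_op f = hcl (word [Fn f])"
definition Lie_op :: "('a \<Rightarrow> 'a) \<Rightarrow> ('a half_gen list \<Rightarrow>\<^sub>0 'k) set ring_family" where "Lie_op \<xi> = hcl (word [Lie \<xi>])"

lemma fun_op_embed: "fun_op f = embed HD (half_fun scale f)" "half_fun scale f \<in> carrier HD"
  by (auto simp: fun_op_def half_fun_def hcl_def intro!: half_class_closed HA_single)

lemma Lie_embed: "Lie_op \<xi> = embed HD (half_lie scale \<xi>)" "\<xi> \<in> der scale \<Longrightarrow> half_lie scale \<xi> \<in> carrier HD"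
  by (auto simp: Lie_op_def half_lie_def hcl_def intro!: half_class_closed HA_single)

lemma hcl_append:
  assumes "u \<in> carrier HW" "v \<in> carrier HW"
  shows "hcl (Poly_Mapping.single (u @ v) (a * b)) = hcl (Poly_Mapping.single u a) * hcl (Poly_Mapping.single v b)"
  using hcl_ops(2)[of "Poly_Mapping.single u a" "Poly_Mapping.single v b"] assms by (simp add: conv_single)

lemma hcl_eqI1: "p - q \<in> half_rels scale \<Longrightarrow> p \<in> carrier HA \<Longrightarrow> q \<in> carrier HA \<Longrightarrow> hcl p = hcl q"
  using hcl_ops(3)[of p q] hcl_rels by auto

lemma hcl_eqI2: "p - q - r \<in> half_rels scale \<Longrightarrow> p \<in> carrier HA \<Longrightarrow> q \<in> carrier HA \<Longrightarrow> r \<in> carrier HA \<Longrightarrow> hcl p = hcl q + hcl r"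
  using hcl_ops(3)[OF HA_minus, of p q r] hcl_ops(3)[of p q] hcl_rels[of "p - q - r"] by (simp add: algebra_simps)

lemma half_relsI:
  "word [Fn (f + g)] - word [Fn f] - word [Fn g] \<in> half_rels scale"
  "word [Fn (scale c f)] - Poly_Mapping.single [Fn f] c \<in> half_rels scale"
  "word [Fn (f * g)] - word [Fn f, Fn g] \<in> half_rels scale"
  "word [Fn 1] - word [] \<in> half_rels scale"
  "\<xi> \<in> der scale \<Longrightarrow> \<eta> \<in> der scale \<Longrightarrow> word [Lie (\<lambda>x. \<xi> x + \<eta> x)] - word [Lie \<xi>] - word [Lie \<eta>] \<in> half_rels scale"
  "\<xi> \<in> der scale \<Longrightarrow> word [Lie (\<lambda>x. scale c (\<xi> x))] - Poly_Mapping.single [Lie \<xi>] c \<in> half_rels scale"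
  "\<xi> \<in> der scale \<Longrightarrow> word [Lie \<xi>, Fn f] - word [Fn f, Lie \<xi>] - word [Fn (\<xi> f)] \<in> half_rels scale"
  "\<xi> \<in> der scale \<Longrightarrow> \<eta> \<in> der scale \<Longrightarrow>
    word [Lie \<xi>, Lie \<eta>] - word [Lie \<eta>, Lie \<xi>] - word [Lie (\<lambda>x. \<xi> (\<eta> x) - \<eta> (\<xi> x))] \<in> half_rels scale"
  "\<xi> \<in> der scale \<Longrightarrow> word [Lie (\<lambda>x. f * \<xi> x)] - word [Fn f, Lie \<xi>] - Poly_Mapping.single [Fn (\<xi> f)] (1/2) \<in> half_rels scale"
  unfolding half_rels_def by blast+

lemma fun_op_scale: "hcl (Poly_Mapping.single [Fn f] c) = fun_op (scale c f)"
  unfolding fun_op_def by (rule hcl_eqI1[symmetric, OF half_relsI(2)]) auto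

lemma hcl_word_Nil: "hcl (word []) = fun_op 1"
  unfolding fun_op_def by (rule hcl_eqI1[symmetric, OF half_relsI(4)]) auto

lemma fun_op_ops: "fun_op (f + g) = fun_op f + fun_op g" "fun_op (f * g) = fun_op f * fun_op g"
proof -
  show "fun_op (f + g) = fun_op f + fun_op g" unfolding fun_op_def by (rule hcl_eqI2[OF half_relsI(1)]) auto
  have "fun_op (f * g) = hcl (word [Fn f, Fn g])" unfolding fun_op_def by (rule hcl_eqI1[OF half_relsI(3)]) auto
  then show "fun_op (f * g) = fun_op f * fun_op g" using hcl_append[of "[Fn f]" "[Fn g]" 1 1] by (simp add: fun_op_def)
qed

lemma fun_op_additive: "additive_map fun_op" by (simp add: additive_map_def fun_op_ops)

lemma fun_op_commute: "fun_op f * fun_op g = fun_op g * fun_op f"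
  by (simp add: fun_op_ops(2)[symmetric] mult.commute)

lemma Lie_ops:
  assumes "\<xi> \<in> der scale"
  shows "\<eta> \<in> der scale \<Longrightarrow> Lie_op (\<lambda>x. \<xi> x + \<eta> x) = Lie_op \<xi> + Lie_op \<eta>"
    "Lie_op \<xi> * fun_op f = fun_op f * Lie_op \<xi> + fun_op (\<xi> f)"
    "Lie_op (\<lambda>x. f * \<xi> x) = fun_op f * Lie_op \<xi> + fun_op (scale (1/2) (\<xi> f))"
proof -
  show "Lie_op (\<lambda>x. \<xi> x + \<eta> x) = Lie_op \<xi> + Lie_op \<eta>" if "\<eta> \<in> der scale"
    unfolding Lie_op_def using assms that by (intro hcl_eqI2 half_relsI) (auto simp: der_add)
  have a: "hcl (word [Fn f, Lie \<xi>]) = fun_op f * Lie_op \<xi>" "hcl (word [Lie \<xi>, Fn f]) = Lie_op \<xi> * fun_op f"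
    using hcl_append[of "[Fn f]" "[Lie \<xi>]" 1 1] hcl_append[of "[Lie \<xi>]" "[Fn f]" 1 1] assms
    by (simp_all add: fun_op_def Lie_op_def)
  have "hcl (word [Lie \<xi>, Fn f]) = hcl (word [Fn f, Lie \<xi>]) + fun_op (\<xi> f)"
    unfolding fun_op_def using assms by (intro hcl_eqI2 half_relsI) auto
  then show "Lie_op \<xi> * fun_op f = fun_op f * Lie_op \<xi> + fun_op (\<xi> f)" by (simp only: a)
  have "Lie_op (\<lambda>x. f * \<xi> x) = hcl (word [Fn f, Lie \<xi>]) + hcl (Poly_Mapping.single [Fn (\<xi> f)] (1/2))"
    unfolding Lie_op_def using assms by (intro hcl_eqI2 half_relsI) (auto simp: der_mult)
  then show "Lie_op (\<lambda>x. f * \<xi> x) = fun_op f * Lie_op \<xi> + fun_op (scale (1/2) (\<xi> f))" by (simp only: a fun_op_scale)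
qed

lemma fun_op_1: "p \<in> carrier HA \<Longrightarrow> fun_op 1 * hcl p = hcl p" "p \<in> carrier HA \<Longrightarrow> hcl p * fun_op 1 = hcl p"
proof -
  assume p: "p \<in> carrier HA"
  have "conv HW (word []) p = p" "conv HW p (word []) = p"
    using ring.ring_simprules(12)[OF HA_ring p] monoid.r_one[OF ring.is_monoid[OF HA_ring] p] by (simp_all add: monoid_algebra_simps(2,5))
  then show "fun_op 1 * hcl p = hcl p" "hcl p * fun_op 1 = hcl p"
    using hcl_ops(2)[of "word []" p] hcl_ops(2)[of p "word []"] p by (simp_all add: hcl_word_Nil)
qed

lemma fun_op_1_gen: "fun_op 1 * fun_op f = fun_op f" "fun_op 1 * Lie_op \<xi> = Lie_op \<xi>" if "\<xi> \<in> der scale"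
  using fun_op_1(1)[of "word [Fn f]"] fun_op_1(1)[of "word [Lie \<xi>]"] that by (auto simp: fun_op_def Lie_op_def)

text \<open>Homomorphisms from the algebra of half-form operators are determined by their values on the generators.\<close>

lemma half_hom_single:
  fixes H :: "('a half_gen list \<Rightarrow>\<^sub>0 'k) \<Rightarrow> 'c::ring"
  assumes H: "class_hom HA H" and 0: "\<And>p. p \<in> half_rels scale \<Longrightarrow> H p = 0" and w: "w \<in> carrier HW"
  shows "H (Poly_Mapping.single w c) = foldl (\<lambda>x l. x * H (word [l])) (H (word [Fn (scale c 1)])) w"
  using w
proof (induction w rule: rev_induct)
  case Nil
  note h = class_homD[OF H HA_ring]
  have eq: "H p = H q" if "p - q \<in> half_rels scale" "p \<in> carrier HA" "q \<in> carrier HA" for p q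
    using h(5)[OF that(2,3)] monoid_algebra_a_inv(3)[OF HW_monoid that(2,3)] 0[OF that(1)] by simp
  have "Poly_Mapping.single [] c \<in> carrier HA" "word [] \<in> carrier HA" "word [Fn 1] \<in> carrier HA" by auto
  from h(2)[OF this(1,2)] h(2)[OF this(1,3)]
  have "H (Poly_Mapping.single [] c) = H (Poly_Mapping.single [Fn 1] c)"
    using eq[OF half_relsI(4)] by (auto simp: monoid_algebra_simps(2) conv_single)
  also have "\<dots> = H (word [Fn (scale c 1)])"
    by (rule eq[OF half_relsI(2), symmetric]) auto
  finally show ?case by simp
next
  case (snoc l w)
  have "H (Poly_Mapping.single (w @ [l]) c) = H (Poly_Mapping.single w c) * H (word [l])"
    using class_homD(2)[OF H HA_ring, of "Poly_Mapping.single w c" "word [l]"] snoc.prems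
    by (auto simp: monoid_algebra_simps(2) conv_single)
  then show ?case using snoc by simp
qed

lemma half_hom_eqI:
  fixes H H' :: "('a half_gen list \<Rightarrow>\<^sub>0 'k) set \<Rightarrow> 'c::ring"
  assumes H: "class_hom HD H" "class_hom HD H'"
    and gen: "\<And>f. H (half_fun scale f) = H' (half_fun scale f)" "\<And>\<xi>. \<xi> \<in> der scale \<Longrightarrow> H (half_lie scale \<xi>) = H' (half_lie scale \<xi>)"
    and t: "t \<in> carrier HD"
  shows "H t = H' t"
proof -
  have I: "ideal (half_ideal scale) HA"
    unfolding half_ideal_def by (rule ring.genideal_ideal[OF HA_ring half_rels_carrier])
  note hom = class_hom_coset(1)[OF HA_ring I, folded half_diffop_def half_class_def]
  have kill: "K (half_class scale p) = 0" if "class_hom HD K" "p \<in> half_rels scale" for K :: "('a half_gen list \<Rightarrow>\<^sub>0 'k) set \<Rightarrow> 'c" and p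
    using class_hom_coset(2)[OF HA_ring I, folded half_diffop_def half_class_def, OF that(1), of p]
      that(2) ring.genideal_self[OF HA_ring half_rels_carrier] by (auto simp: half_ideal_def)
  obtain p where p: "p \<in> carrier HA" "t = half_class scale p" using HD_elements[OF t] by blast
  have ext: "H (half_class scale (Poly_Mapping.single w c)) = H' (half_class scale (Poly_Mapping.single w c))"
    if w: "w \<in> carrier HW" for w c
  proof -
    have "H (half_class scale (word [l])) = H' (half_class scale (word [l]))" if "l \<in> set w" for l
      using w that gen by (auto simp: half_fun_def half_lie_def lists_eq_set)
    moreover have "H (half_class scale (word [Fn (scale c 1)])) = H' (half_class scale (word [Fn (scale c 1)]))"
      using gen(1)[of "scale c 1"] by (simp add: half_fun_def)
    moreover note half_hom_single[OF hom[OF H(1)] kill[OF H(1)] w, of c] half_hom_single[OF hom[OF H(2)] kill[OF H(2)] w, of c]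
    ultimately show ?thesis by (simp cong: foldl_cong)
  qed
  note sum = class_hom_sum_singles[OF HW_monoid hom p(1)]
  show ?thesis
    unfolding p(2) sum[OF H(1)] sum[OF H(2)] using p(1) by (intro sum.cong refl ext) (auto simp: monoid_algebra_simps(1))
qed

end

section \<open>The algebra \<open>\<Pi>\<^sup>1\<close>\<close>

context affine_curve begin

abbreviation "TW \<equiv> tensor_words DM"
abbreviation "TA \<equiv> (monoid_algebra TW :: (('a, ('a, 'k) double_derivation) tensor_word \<Rightarrow>\<^sub>0 'k) ring)"
abbreviation "TT \<equiv> tensor_algebra scale DM"
abbreviation "PI \<equiv> pi1 scale"

lemma ract_ops:
  assumes "\<Theta> \<in> double_der scale"
  shows "ract DM \<Theta> 1 = \<Theta>" "ract DM (ract DM \<Theta> a) b = ract DM \<Theta> (a * b)"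
proof -
  note c = cl_bimod[OF assms] and d = DD_props(1)[OF cl_DD[OF assms]]
  show "ract DM \<Theta> 1 = \<Theta>" by (rule cl_inj) (auto simp: c assms tens_unit d)
  show "ract DM (ract DM \<Theta> a) b = ract DM \<Theta> (a * b)"
  proof (rule cl_inj)
    have "tens b 1 * (tens a 1 * cl \<Theta> x) = tens (a * b) 1 * cl \<Theta> x" for x
      unfolding mult.assoc[symmetric] tens_mult by (simp add: mult.commute)
    then show "cl (ract DM (ract DM \<Theta> a) b) = cl (ract DM \<Theta> (a * b))"
      by (simp only: c(4) cl_bimod(4)[OF c(3)])
  qed (intro c(3) cl_bimod(3)[OF c(3)])+
qed

lemma TW_carrier: "(a, ms) \<in> carrier TW \<longleftrightarrow> set ms \<subseteq> double_der scale"
  by (simp add: tensor_words_def)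

lemma TW_mult:
  "(a, []) \<otimes>\<^bsub>TW\<^esub> (b, ns) = (a * b, ns)"
  "(a, ms @ [m]) \<otimes>\<^bsub>TW\<^esub> (b, ns) = (a, ms @ ract DM m b # ns)"
  by (simp_all add: tensor_words_def)

lemma TW_one: "\<one>\<^bsub>TW\<^esub> = (1, [])"
  by (simp add: tensor_words_def)

lemma TW_monoid: "monoid TW"
proof (rule monoidI)
  fix u v w assume "u \<in> carrier TW" "v \<in> carrier TW" "w \<in> carrier TW"
  moreover obtain a ms b ns c ls where uvw: "u = (a, ms)" "v = (b, ns)" "w = (c, ls)" by (cases u, cases v, cases w) auto
  ultimately have s: "set ms \<subseteq> double_der scale" "set ns \<subseteq> double_der scale" "set ls \<subseteq> double_der scale"
    by (auto simp: TW_carrier)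
  show "u \<otimes>\<^bsub>TW\<^esub> v \<in> carrier TW"
    using s cl_bimod(3) unfolding uvw by (cases ms rule: rev_cases) (auto simp: TW_mult TW_carrier)
  show "u \<otimes>\<^bsub>TW\<^esub> v \<otimes>\<^bsub>TW\<^esub> w = u \<otimes>\<^bsub>TW\<^esub> (v \<otimes>\<^bsub>TW\<^esub> w)"
  proof (cases ms rule: rev_cases)
    case Nil
    then show ?thesis unfolding uvw by (cases ns rule: rev_cases) (auto simp: TW_mult mult.assoc)
  next
    case ms: (snoc ms' m)
    show ?thesis
    proof (cases ns rule: rev_cases)
      case Nil
      then show ?thesis unfolding uvw ms using s ms by (simp add: TW_mult ract_ops)
    next
      case (snoc ns' n)
      have "(a, ms' @ ract DM m b # ns' @ [n]) \<otimes>\<^bsub>TW\<^esub> (c, ls) = (a, (ms' @ ract DM m b # ns') @ ract DM n c # ls)"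
        using TW_mult(2)[of a "ms' @ ract DM m b # ns'" n c ls] by simp
      then show ?thesis unfolding uvw ms snoc by (simp add: TW_mult)
    qed
  qed
  show "\<one>\<^bsub>TW\<^esub> \<otimes>\<^bsub>TW\<^esub> u = u" by (simp add: TW_one uvw TW_mult)
  show "u \<otimes>\<^bsub>TW\<^esub> \<one>\<^bsub>TW\<^esub> = u"
    using s unfolding TW_one uvw by (cases ms rule: rev_cases) (auto simp: TW_mult ract_ops)
qed (simp add: TW_one TW_carrier)

lemmas TA_ring = monoid_algebra_ring[OF TW_monoid, where 'k='k]

lemma TA_single [simp]: "set ms \<subseteq> double_der scale \<Longrightarrow> Poly_Mapping.single (a, ms) c \<in> carrier TA"
  by (auto simp: monoid_algebra_simps TW_carrier split: if_splits)

lemma TA_minus: "p \<in> carrier TA \<Longrightarrow> q \<in> carrier TA \<Longrightarrow> p - q \<in> carrier TA"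
  using monoid_algebra_a_inv(3)[OF TW_monoid, of p q] ring.ring_simprules(4)[OF TA_ring, of p q] by simp

lemma tensor_rels_carrier: "tensor_algebra_rels scale DM \<subseteq> carrier TA"
  unfolding tensor_algebra_rels_def by (auto intro!: TA_minus TA_single simp: cl_bimod)

lemma tensor_algebra_relsI:
  "word (a + b, []) - word (a, []) - word (b, []) \<in> tensor_algebra_rels scale DM"
  "word (scale c a, []) - Poly_Mapping.single (a, []) c \<in> tensor_algebra_rels scale DM"
  "m \<in> double_der scale \<Longrightarrow> m' \<in> double_der scale \<Longrightarrow> word (1, [madd DM m m']) - word (1, [m]) - word (1, [m']) \<in> tensor_algebra_rels scale DM"
  "m \<in> double_der scale \<Longrightarrow> word (a, [m]) - word (1, [lact DM a m]) \<in> tensor_algebra_rels scale DM"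
  unfolding tensor_algebra_rels_def DM_carrier by blast+

text \<open>The images of formal combinations of words in \<open>\<Pi>\<^sup>1\<close> and in its
  type-class copy.\<close>

definition tc :: "(('a, ('a, 'k) double_derivation) tensor_word \<Rightarrow>\<^sub>0 'k) \<Rightarrow> ('a, 'k) pi1" where
  "tc p = pi1_class scale (tensor_algebra_class scale DM p)"

definition pc :: "(('a, ('a, 'k) double_derivation) tensor_word \<Rightarrow>\<^sub>0 'k) \<Rightarrow> ('a, 'k) pi1 ring_family" where
  "pc p = embed PI (tc p)"

lemma TT_ideal: "ideal (tensor_algebra_ideal scale DM) TA"
  unfolding tensor_algebra_ideal_def by (rule ring.genideal_ideal[OF TA_ring tensor_rels_carrier])

lemma TT_ring: "ring TT"
  unfolding tensor_algebra_def by (rule ideal.quotient_is_ring[OF TT_ideal])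

lemma TT_class_closed: "p \<in> carrier TA \<Longrightarrow> tensor_algebra_class scale DM p \<in> carrier TT"
  and TT_elements: "t \<in> carrier TT \<Longrightarrow> \<exists>p\<in>carrier TA. t = tensor_algebra_class scale DM p"
  by (auto simp: tensor_algebra_def quotient_carrier tensor_algebra_class_def)

text \<open>The relation \<open>\<Delta> - 1\<close>.\<close>

definition delta_rel where
  "delta_rel = tensor_algebra_class scale DM (word (1, [dd_Delta scale])) \<ominus>\<^bsub>TT\<^esub> \<one>\<^bsub>TT\<^esub>"

lemma delta_rel: "delta_rel \<in> carrier TT"
  unfolding delta_rel_def
  by (intro ring.ring_simprules(4,6)[OF TT_ring] TT_class_closed TA_single) (simp add: dd_Delta)

lemma PI_def': "PI = TT Quot pi1_ideal scale" "pi1_ideal scale = genideal TT {delta_rel}"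
  by (simp_all add: pi1_def pi1_ideal_def delta_rel_def Let_def)

lemma PI_ideal: "ideal (pi1_ideal scale) TT"
  unfolding PI_def' by (rule ring.genideal_ideal[OF TT_ring]) (use delta_rel in simp)

lemma PI_ring: "ring PI"
  unfolding PI_def'(1) by (rule ideal.quotient_is_ring[OF PI_ideal])

lemma tc_closed: "p \<in> carrier TA \<Longrightarrow> tc p \<in> carrier PI"
  and PI_elements: "t \<in> carrier PI \<Longrightarrow> \<exists>p\<in>carrier TA. t = tc p"
proof -
  show "p \<in> carrier TA \<Longrightarrow> tc p \<in> carrier PI"
    using TT_class_closed by (auto simp: PI_def'(1) quotient_carrier tc_def pi1_class_def)
  assume "t \<in> carrier PI"
  then obtain s where "s \<in> carrier TT" "t = pi1_class scale s" by (auto simp: PI_def'(1) quotient_carrier pi1_class_def)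
  then show "\<exists>p\<in>carrier TA. t = tc p" using TT_elements by (auto simp: tc_def)
qed

lemma PI_hom:
  assumes K: "class_hom PI K"
  shows "class_hom TA (\<lambda>p. K (tc p))" "p \<in> tensor_algebra_rels scale DM \<Longrightarrow> K (tc p) = 0"
    "K (tc (word (1, [dd_Delta scale]))) = K (tc (word (1, [])))"
proof -
  have K1: "class_hom TT (\<lambda>x. K (pi1_class scale x))" and 1: "x \<in> pi1_ideal scale \<Longrightarrow> K (pi1_class scale x) = 0" for x
    using class_hom_coset[OF TT_ring PI_ideal K[unfolded PI_def'(1)]] by (simp_all add: pi1_class_def)
  have K2: "class_hom TA (\<lambda>p. K (tc p))" and 2: "p \<in> tensor_algebra_ideal scale DM \<Longrightarrow> K (tc p) = 0" for p
    using class_hom_coset[OF TA_ring TT_ideal K1[unfolded tensor_algebra_def]]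
    by (simp_all add: tc_def tensor_algebra_class_def)
  show "class_hom TA (\<lambda>p. K (tc p))" by (rule K2)
  show "p \<in> tensor_algebra_rels scale DM \<Longrightarrow> K (tc p) = 0"
    using 2 ring.genideal_self[OF TA_ring tensor_rels_carrier] by (auto simp: tensor_algebra_ideal_def)
  have "delta_rel \<in> pi1_ideal scale"
    unfolding PI_def'(2) using ring.genideal_self[OF TT_ring, of "{delta_rel}"] delta_rel by simp
  then have "K (pi1_class scale delta_rel) = 0" by (rule 1)
  moreover have "\<one>\<^bsub>TT\<^esub> = tensor_algebra_class scale DM (word (1, []))"
    using quotient_ops(5)[OF TT_ideal, of "word (1, [])" "word (1, [])"]
    by (simp add: tensor_algebra_def tensor_algebra_class_def monoid_algebra_simps(5) TW_one)
  ultimately show "K (tc (word (1, [dd_Delta scale]))) = K (tc (word (1, [])))"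
    using class_homD(5)[OF K1 TT_ring, of "tensor_algebra_class scale DM (word (1, [dd_Delta scale]))" "\<one>\<^bsub>TT\<^esub>"]
      TT_class_closed[OF TA_single[of "[dd_Delta scale]" 1 1]] TT_class_closed[OF TA_single[of "[]" 1 1]] dd_Delta(1)
    by (simp add: tc_def delta_rel_def)
qed

lemma embed_PI_hom: "class_hom PI (embed PI)"
  unfolding class_hom_def using embed_ops[OF PI_ring] by blast

lemmas pc_hom = PI_hom[OF embed_PI_hom, folded pc_def]

text \<open>Homomorphisms from the tensor algebra are determined by their values on \<open>A\<close> and on the bimodule.\<close>

lemma tensor_hom_single:
  fixes H :: "(('a, ('a, 'k) double_derivation) tensor_word \<Rightarrow>\<^sub>0 'k) \<Rightarrow> 'c::ring"
  assumes H: "class_hom TA H" and 0: "\<And>p. p \<in> tensor_algebra_rels scale DM \<Longrightarrow> H p = 0" and ms: "set ms \<subseteq> double_der scale"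
  shows "H (Poly_Mapping.single (a, ms) c) = foldl (\<lambda>x m. x * H (word (1, [m]))) (H (word (scale c a, []))) ms"
  using ms
proof (induction ms rule: rev_induct)
  case Nil
  have p: "word (scale c a, []) \<in> carrier TA" "Poly_Mapping.single (a, []) c \<in> carrier TA" by auto
  show ?case
    using class_homD(5)[OF H TA_ring p] monoid_algebra_a_inv(3)[OF TW_monoid p] 0[OF tensor_algebra_relsI(2), of c a] by simp
next
  case (snoc m ms)
  have "(a, ms) \<otimes>\<^bsub>TW\<^esub> (1, [m]) = (a, ms @ [m])"
    using snoc.prems by (cases ms rule: rev_cases) (auto simp: TW_mult ract_ops)
  then have "H (Poly_Mapping.single (a, ms @ [m]) c) = H (Poly_Mapping.single (a, ms) c) * H (word (1, [m]))"
    using class_homD(2)[OF H TA_ring, of "Poly_Mapping.single (a, ms) c" "word (1, [m])"] snoc.prems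
    by (auto simp: monoid_algebra_simps(2) conv_single)
  then show ?case using snoc by simp
qed

lemma pi1_gens: "pi1_fun scale a = tc (word (a, []))" "pi1_dd scale \<Theta> = tc (word (1, [\<Theta>]))"
  by (simp_all add: pi1_fun_def pi1_dd_def tc_def)

lemma pi1_gens_closed: "pi1_fun scale a \<in> carrier PI" "\<Theta> \<in> double_der scale \<Longrightarrow> pi1_dd scale \<Theta> \<in> carrier PI"
  by (auto simp: pi1_gens intro!: tc_closed TA_single)

lemma pi1_hom_eqI:
  fixes H H' :: "('a, 'k) pi1 \<Rightarrow> 'c::ring"
  assumes H: "class_hom PI H" "class_hom PI H'"
    and gen: "\<And>f. H (pi1_fun scale f) = H' (pi1_fun scale f)" "\<And>\<Theta>. \<Theta> \<in> double_der scale \<Longrightarrow> H (pi1_dd scale \<Theta>) = H' (pi1_dd scale \<Theta>)"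
    and t: "t \<in> carrier PI"
  shows "H t = H' t"
proof -
  obtain p where p: "p \<in> carrier TA" "t = tc p" using PI_elements[OF t] by blast
  have ext: "H (tc (Poly_Mapping.single w c)) = H' (tc (Poly_Mapping.single w c))"
    if w: "w \<in> carrier TW" for w c
  proof -
    obtain a ms where [simp]: "w = (a, ms)" by (cases w)
    have ms: "set ms \<subseteq> double_der scale" using w by (simp add: TW_carrier)
    have "H (tc (word (1, [m]))) = H' (tc (word (1, [m])))" if "m \<in> set ms" for m
      using ms that gen(2) by (auto simp: pi1_gens)
    moreover note gen(1)[of "scale c a", unfolded pi1_gens]
      tensor_hom_single[OF PI_hom(1,2)[OF H(1)] ms, of a c] tensor_hom_single[OF PI_hom(1,2)[OF H(2)] ms, of a c]
    ultimately show ?thesis by (simp cong: foldl_cong)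
  qed
  show ?thesis
    unfolding p(2) class_hom_sum_singles[OF TW_monoid PI_hom(1)[OF H(1)] p(1)] class_hom_sum_singles[OF TW_monoid PI_hom(1)[OF H(2)] p(1)]
    using p(1) by (intro sum.cong refl ext) (auto simp: monoid_algebra_simps(1))
qed

text \<open>The images in the type-class copy of \<open>\<Pi>\<^sup>1\<close> of functions and of
  double derivations.\<close>

definition Jf :: "'a \<Rightarrow> ('a, 'k) pi1 ring_family" where "Jf a = pc (word (a, []))"
definition Th :: "('a \<Rightarrow> ('a, 'k) tensor cring_family) \<Rightarrow> ('a, 'k) pi1 ring_family" where "Th \<Psi> = pc (word (1, [un \<Psi>]))"

lemma Jf_embed: "Jf a = embed PI (pi1_fun scale a)" "\<Theta> \<in> double_der scale \<Longrightarrow> Th (cl \<Theta>) = embed PI (pi1_dd scale \<Theta>)"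
  by (simp_all add: Jf_def Th_def pc_def pi1_gens un_cl)

lemma pc_ops:
  assumes "p \<in> carrier TA" "q \<in> carrier TA"
  shows "pc (p + q) = pc p + pc q" "pc (conv TW p q) = pc p * pc q" "pc (p - q) = pc p - pc q"
  using class_homD(1,2,5)[OF pc_hom(1) TA_ring, of p q] assms monoid_algebra_a_inv(3)[OF TW_monoid assms(1,2)]
  by (simp_all add: monoid_algebra_simps(2,3))

lemma Jf_ops: "Jf (a + b) = Jf a + Jf b" "Jf (a * b) = Jf a * Jf b"
proof -
  have "word (a + b, []) - word (a, []) \<in> carrier TA" by (intro TA_minus) auto
  from pc_ops(3)[OF this, of "word (b, [])"] pc_ops(3)[of "word (a + b, [])" "word (a, [])"] pc_hom(2)[OF tensor_algebra_relsI(1), of a b]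
  show "Jf (a + b) = Jf a + Jf b" by (simp add: Jf_def algebra_simps)
  show "Jf (a * b) = Jf a * Jf b"
    using pc_ops(2)[of "word (a, [])" "word (b, [])"] by (simp add: Jf_def conv_single TW_mult)
qed

lemma Jf_additive: "additive_map Jf" by (simp add: additive_map_def Jf_ops)

lemma Jf_commute: "Jf f * Jf g = Jf g * Jf f"
  by (simp add: Jf_ops(2)[symmetric] mult.commute)

lemma Th_add:
  assumes "\<Psi> \<in> DD" "\<Psi>' \<in> DD"
  shows "Th (\<lambda>x. \<Psi> x + \<Psi>' x) = Th \<Psi> + Th \<Psi>'"
proof -
  note u = un_double_der[OF assms(1)] un_double_der[OF assms(2)]
  have eq: "un (\<lambda>x. \<Psi> x + \<Psi>' x) = madd DM (un \<Psi>) (un \<Psi>')"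
    by (rule cl_inj) (auto simp: cl_bimod u cl_un assms DD_add un_double_der)
  have p: "word (1, [madd DM (un \<Psi>) (un \<Psi>')]) \<in> carrier TA" "word (1, [un \<Psi>]) \<in> carrier TA" "word (1, [un \<Psi>']) \<in> carrier TA"
    using u by (auto simp: cl_bimod)
  from pc_ops(3)[OF TA_minus[OF p(1,2)] p(3)] pc_ops(3)[OF p(1,2)] pc_hom(2)[OF tensor_algebra_relsI(3)[OF u]]
  show ?thesis by (simp add: Th_def eq algebra_simps)
qed

lemma Th_bimodule:
  assumes "\<Psi> \<in> DD"
  shows "Th (\<lambda>x. tens c b * \<Psi> x) = Jf b * Th \<Psi> * Jf c"
proof -
  note u = un_double_der[OF assms]
  have l: "Jf b * Th \<Phi> = Th (\<lambda>x. tens 1 b * \<Phi> x)" if \<Phi>: "\<Phi> \<in> DD" for \<Phi>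
  proof -
    note u = un_double_der[OF \<Phi>]
    have eq: "un (\<lambda>x. tens 1 b * \<Phi> x) = lact DM b (un \<Phi>)"
      by (rule cl_inj) (auto simp: cl_bimod u cl_un \<Phi> DD_mult un_double_der)
    have p: "word (b, [un \<Phi>]) \<in> carrier TA" "word (1, [lact DM b (un \<Phi>)]) \<in> carrier TA" "word (b, []) \<in> carrier TA" "word (1, [un \<Phi>]) \<in> carrier TA"
      using u by (auto simp: cl_bimod)
    show ?thesis
      using pc_ops(3)[OF p(1,2)] pc_hom(2)[OF tensor_algebra_relsI(4)[OF u]] pc_ops(2)[OF p(3,4)]
      by (simp add: Th_def Jf_def eq conv_single TW_mult)
  qed
  have eq: "un (\<lambda>x. tens c 1 * \<Psi> x) = ract DM (un \<Psi>) c"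
    by (rule cl_inj) (auto simp: cl_bimod u cl_un assms DD_mult un_double_der)
  have "(1, [un \<Psi>]) \<otimes>\<^bsub>TW\<^esub> (c, []) = (1, [ract DM (un \<Psi>) c])" using TW_mult(2)[of 1 "[]" "un \<Psi>" c "[]"] by simp
  then have r: "Th \<Psi> * Jf c = Th (\<lambda>x. tens c 1 * \<Psi> x)"
    using pc_ops(2)[of "word (1, [un \<Psi>])" "word (c, [])"] u by (simp add: Th_def Jf_def eq conv_single)
  show ?thesis
    using l[OF DD_mult[OF B_tens assms], of c 1] by (simp add: mult.assoc r mult.assoc[symmetric, of "tens _ _"] tens_mult)
qed

lemma Th_delta: "Th delta = Jf 1"
proof -
  have "un delta = dd_Delta scale" using un_cl[OF dd_Delta(1)] by (simp add: dd_Delta)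
  then show ?thesis using pc_hom(3) by (simp add: Th_def Jf_def)
qed

lemma Th_zero: "Th (\<lambda>x. 0) = 0"
proof -
  have z: "(\<lambda>x. 0) \<in> DD" using DD_mult[OF B.zero delta_DD] by simp
  show ?thesis using Th_add[OF z z] by simp
qed

lemma Th_mult_delta:
  assumes "s \<in> B"
  shows "Th (\<lambda>x. s * delta x) = Jf (tmult s)"
  using assms
proof induction
  case zero then show ?case by (simp add: Th_zero tmult_simps additive_mapD[OF Jf_additive])
next
  case (step p x y)
  have "Th (\<lambda>z. tens x y * delta z) = Jf (x * y)"
    unfolding Th_bimodule[OF delta_DD] Th_delta by (simp add: Jf_ops(2)[symmetric] mult.commute)
  then show ?case
    using Th_add[OF DD_mult[OF B_tens delta_DD] DD_mult[OF step(1) delta_DD], of x y] step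
    by (simp add: distrib_right tmult_simps Jf_ops)
qed

lemma pc_1: "p \<in> carrier TA \<Longrightarrow> Jf 1 * pc p = pc p" "p \<in> carrier TA \<Longrightarrow> pc p * Jf 1 = pc p"
proof -
  assume p: "p \<in> carrier TA"
  have "conv TW (word (1, [])) p = p" "conv TW p (word (1, [])) = p"
    using ring.ring_simprules(12)[OF TA_ring p] monoid.r_one[OF ring.is_monoid[OF TA_ring] p]
    by (simp_all add: monoid_algebra_simps(2,5) TW_one)
  then show "Jf 1 * pc p = pc p" "pc p * Jf 1 = pc p"
    using pc_ops(2)[of "word (1, [])" p] pc_ops(2)[of p "word (1, [])"] p by (simp_all add: Jf_def)
qed

lemma Jf_1_Th: "\<Psi> \<in> DD \<Longrightarrow> Jf 1 * Th \<Psi> = Th \<Psi>" "\<Psi> \<in> DD \<Longrightarrow> Th \<Psi> * Jf 1 = Th \<Psi>" "Jf 1 * Jf a = Jf a"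
  using pc_1[of "word (1, [un \<Psi>])"] un_double_der[of \<Psi>] pc_1(1)[of "word (a, [])"] by (auto simp: Th_def Jf_def)

text \<open>Since \<open>(a \<otimes> 1 - 1 \<otimes> a) \<Theta> = \<Theta>(a) \<Delta>\<close> and \<open>\<Delta> = 1\<close>, the commutator with \<open>\<Theta>\<close> is the vector
  field \<open>a \<mapsto> \<Theta>'(a) \<Theta>''(a)\<close>.\<close>

lemma Th_commutator:
  assumes \<Psi>: "\<Psi> \<in> DD"
  shows "Th \<Psi> * Jf a = Jf a * Th \<Psi> + Jf (tmult (\<Psi> a))"
proof -
  have "tens a 1 * \<Psi> x = tens 1 a * \<Psi> x + \<Psi> a * delta x" for x
    using DD_proportional[OF \<Psi>, of a x] by (simp add: delta_def algebra_simps)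
  then have "Th (\<lambda>x. tens a 1 * \<Psi> x) = Th (\<lambda>x. tens 1 a * \<Psi> x) + Th (\<lambda>x. \<Psi> a * delta x)"
    using Th_add[OF DD_mult[OF B_tens \<Psi>] DD_mult[OF DD_props(1)[OF \<Psi>] delta_DD]] by simp
  then show ?thesis
    unfolding Th_bimodule[OF \<Psi>] Th_mult_delta[OF DD_props(1)[OF \<Psi>]]
    by (simp only: Jf_1_Th(1,2)[OF \<Psi>] mult.assoc)
qed

text \<open>Two symmetric lifts of a vector field differ by a multiple \<open>s \<Delta>\<close>,
  with \<open>s\<close> antisymmetric modulo the annihilator of \<open>\<Delta>\<close>. Its class
  is the restriction of \<open>s\<close> to the diagonal, which vanishes.\<close>

lemma Th_symmetric_unique:
  assumes "\<Psi> \<in> DD" "\<And>a. tflip (\<Psi> a) = \<Psi> a" "\<Psi>' \<in> DD" "\<And>a. tflip (\<Psi>' a) = \<Psi>' a"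
    and eq: "\<And>a. tmult (\<Psi> a) = tmult (\<Psi>' a)"
  shows "Th \<Psi> = Th \<Psi>'"
proof -
  define N where "N x = \<Psi> x + (- tens 1 1) * \<Psi>' x" for x
  have N: "N \<in> DD" unfolding N_def[abs_def] by (intro DD_add DD_mult assms B_minus B_tens)
  have Nx: "N x = \<Psi> x - \<Psi>' x" for x using tens_unit[OF DD_props(1)[OF assms(3)]] by (simp add: N_def)
  have "tmult (N x) = 0" for x by (simp add: Nx tmult_simps eq)
  then obtain s where s: "s \<in> B" "\<And>x. N x = s * delta x" using DD_kernel[OF N] by blast
  have "tflip (N x) = - (tflip s * delta x)" for x
    unfolding s(2) by (simp add: tflip_mult s delta_def tflip_simps algebra_simps)
  moreover have "tflip (N x) = N x" for x by (simp add: Nx tflip_simps assms)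
  ultimately have "s * delta x = - (tflip s * delta x)" for x using s(2)[of x] by metis
  then have "(s + tflip s) * delta x = 0" for x by (simp add: distrib_right)
  then have "tmult (s + tflip s) = 0" using s by (intro delta_multiple_zero B_add tflip_B)
  then have "scale (1 / 2) (tmult s + tmult s) = 0" using s by (simp add: tmult_simps tmult_tflip K(10))
  moreover have "scale (1 / 2) (tmult s + tmult s) = scale (1 / 2 + 1 / 2) (tmult s)"
    by (simp only: scale_right_distrib scale_left_distrib)
  ultimately have "tmult s = 0" by simp
  then have "Th N = 0"
    using Th_mult_delta[OF s(1)] by (simp add: s(2)[symmetric] additive_mapD[OF Jf_additive])
  moreover have "\<Psi> = (\<lambda>x. \<Psi>' x + N x)" by (simp add: Nx)
  ultimately show ?thesis using Th_add[OF assms(3) N] by simp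
qed

text \<open>The class of the symmetric lifts of a vector field.\<close>

definition sym_lift :: "('a \<Rightarrow> 'a) \<Rightarrow> 'a \<Rightarrow> ('a, 'k) tensor cring_family" where
  "sym_lift \<xi> = (SOME \<Psi>. \<Psi> \<in> DD \<and> (\<forall>a. tflip (\<Psi> a) = \<Psi> a) \<and> (\<forall>a. tmult (\<Psi> a) = \<xi> a))"

definition theta :: "('a \<Rightarrow> 'a) \<Rightarrow> ('a, 'k) pi1 ring_family" where
  "theta \<xi> = Th (sym_lift \<xi>)"

lemma sym_lift:
  assumes "\<xi> \<in> der scale"
  shows "sym_lift \<xi> \<in> DD" "tflip (sym_lift \<xi> a) = sym_lift \<xi> a" "tmult (sym_lift \<xi> a) = \<xi> a"
  using someI_ex[of "\<lambda>\<Psi>. \<Psi> \<in> DD \<and> (\<forall>a. tflip (\<Psi> a) = \<Psi> a) \<and> (\<forall>a. tmult (\<Psi> a) = \<xi> a)"] symmetric_lift[OF assms]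
  unfolding sym_lift_def by blast+

lemma theta_eq:
  assumes "\<Psi> \<in> DD" "\<And>a. tflip (\<Psi> a) = \<Psi> a" "\<And>a. tmult (\<Psi> a) = \<xi> a"
  shows "theta \<xi> = Th \<Psi>"
proof -
  have "\<xi> = (\<lambda>a. tmult (\<Psi> a))" using assms(3) by auto
  then have "\<xi> \<in> der scale" using tmult_DD[OF assms(1)] by simp
  then show ?thesis unfolding theta_def by (intro Th_symmetric_unique sym_lift assms) (auto simp: sym_lift assms)
qed

lemma theta_commutator: "\<xi> \<in> der scale \<Longrightarrow> theta \<xi> * Jf f = Jf f * theta \<xi> + Jf (\<xi> f)"
  using Th_commutator[OF sym_lift(1)] by (simp add: theta_def sym_lift)

lemma theta_add:
  assumes "\<xi> \<in> der scale" "\<eta> \<in> der scale"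
  shows "theta (\<lambda>x. \<xi> x + \<eta> x) = theta \<xi> + theta \<eta>"
  unfolding theta_def[of \<xi>] theta_def[of \<eta>] Th_add[OF sym_lift(1)[OF assms(1)] sym_lift(1)[OF assms(2)], symmetric]
  by (intro theta_eq DD_add) (auto simp: sym_lift assms tflip_simps tmult_simps)

text \<open>The symmetric lift of \<open>f \<xi>\<close> is the product of the lift of
  \<open>\<xi>\<close> with the mean of \<open>f \<otimes> 1\<close> and \<open>1 \<otimes>
  f\<close>. This is the origin of the term \<open>\<xi>(f)/2\<close> of half-forms.\<close>

lemma theta_mult:
  assumes \<xi>: "\<xi> \<in> der scale"
  shows "theta (\<lambda>x. f * \<xi> x) = Jf f * theta \<xi> + Jf (scale (1/2) (\<xi> f))"
proof -
  define h where "h = scale (1/2) (1 :: 'a)"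
  have hh: "h + h = 1" by (simp add: h_def scale_left_distrib[symmetric])
  have hx: "h * x = scale (1/2) x" for x unfolding h_def by (rule K(4)[symmetric])
  note l = sym_lift[OF \<xi>]
  have m: "(\<lambda>x. tens (f * h) 1 * sym_lift \<xi> x) \<in> DD" "(\<lambda>x. tens h f * sym_lift \<xi> x) \<in> DD"
    by (intro DD_mult B_tens l)+
  have hf: "tens (f * h) 1 = tens f h" "tens h f = tens 1 (f * h)"
    using tens_scale[of "1/2" f 1] tens_scale[of "1/2" 1 f] by (simp_all only: mult.commute[of f h] hx) (simp_all only: h_def)
  have "theta (\<lambda>x. f * \<xi> x) = Th (\<lambda>x. tens (f * h) 1 * sym_lift \<xi> x + tens h f * sym_lift \<xi> x)"
  proof (rule theta_eq)
    show "tflip (tens (f * h) 1 * sym_lift \<xi> a + tens h f * sym_lift \<xi> a) = tens (f * h) 1 * sym_lift \<xi> a + tens h f * sym_lift \<xi> a" for a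
      unfolding hf(1) by (simp add: tflip_simps tflip_mult DD_props(1)[OF l(1)] l add.commute)
    have "tmult (tens (f * h) 1 * sym_lift \<xi> a + tens h f * sym_lift \<xi> a) = (h + h) * (f * \<xi> a)" for a
      by (simp add: tmult_simps tmult_mult DD_props(1)[OF l(1)] l algebra_simps)
    then show "tmult (tens (f * h) 1 * sym_lift \<xi> a + tens h f * sym_lift \<xi> a) = f * \<xi> a" for a by (simp add: hh)
  qed (rule DD_add[OF m])
  also have "\<dots> = Jf 1 * theta \<xi> * Jf (f * h) + Jf f * theta \<xi> * Jf h"
    unfolding Th_add[OF m] by (simp only: Th_bimodule[OF l(1)] theta_def)
  also have "Jf 1 * theta \<xi> = theta \<xi>" unfolding theta_def by (rule Jf_1_Th(1)[OF l(1)])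
  also have "theta \<xi> * Jf (f * h) + Jf f * theta \<xi> * Jf h = Jf f * Jf h * theta \<xi> + Jf (\<xi> (f * h)) + Jf f * (Jf h * theta \<xi> + Jf (\<xi> h))"
    unfolding theta_commutator[OF \<xi>, of "f * h"]
    by (simp only: mult.assoc theta_commutator[OF \<xi>, of h] Jf_ops(2))
  also have "\<dots> = Jf (f * (h + h)) * theta \<xi> + Jf (\<xi> (f * h))"
  proof -
    have "\<xi> h = 0" unfolding h_def by (rule derD(7)[OF \<xi>])
    then show ?thesis
      by (simp only: Jf_ops distrib_left distrib_right mult.assoc additive_mapD(2)[OF Jf_additive] mult_zero_right add_0_left add_0_right ac_simps)
  qed
  also have "\<xi> (f * h) = scale (1/2) (\<xi> f)"
    using derD(7)[OF \<xi>, of "1/2"] by (simp add: derD(3)[OF \<xi>] hx mult.commute[of "\<xi> f"] flip: h_def)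
  finally show ?thesis by (simp add: hh)
qed

end

context affine_curve begin

text \<open>The obstruction \<open>[\<theta>(\<xi>), \<theta>(\<eta>)] - \<theta>([\<xi>, \<eta>])\<close> is bilinear over \<open>A\<close> and alternating. Since the vector
  fields have rank one, it vanishes.\<close>

definition curv :: "('a \<Rightarrow> 'a) \<Rightarrow> ('a \<Rightarrow> 'a) \<Rightarrow> ('a, 'k) pi1 ring_family" where
  "curv \<xi> \<eta> = theta \<xi> * theta \<eta> - theta \<eta> * theta \<xi> - theta (\<lambda>x. \<xi> (\<eta> x) - \<eta> (\<xi> x))"

lemma theta_zero: "theta (\<lambda>x. 0) = 0"
proof -
  have "(\<lambda>x. 0) \<in> DD" using DD_mult[OF B.zero delta_DD] by simp
  then show ?thesis using theta_eq[of "\<lambda>x. 0" "\<lambda>x. 0"] Th_zero by (simp add: tflip_simps tmult_simps)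
qed

lemma curv_self: "curv \<xi> \<xi> = 0"
  by (simp add: curv_def theta_zero)

lemma curv_swap:
  assumes "\<xi> \<in> der scale" "\<eta> \<in> der scale"
  shows "curv \<xi> \<eta> = - curv \<eta> \<xi>"
  using theta_add[OF der_bracket[OF assms] der_bracket[OF assms(2,1)]]
  by (simp add: curv_def theta_zero eq_neg_iff_add_eq_0 algebra_simps)

lemma curv_mult_left:
  assumes \<xi>: "\<xi> \<in> der scale" and \<eta>: "\<eta> \<in> der scale"
  shows "curv (\<lambda>x. f * \<xi> x) \<eta> = Jf f * curv \<xi> \<eta>"
proof -
  define br where "br = (\<lambda>x. \<xi> (\<eta> x) - \<eta> (\<xi> x))"
  define J2 where "J2 x = Jf (scale (1/2) x)" for x
  have br: "br \<in> der scale" unfolding br_def by (rule der_bracket[OF \<xi> \<eta>])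
  have J2: "J2 (x - y) = J2 x - J2 y" "J2 (- x) = - J2 x" for x y
    by (simp_all add: J2_def scale_right_diff_distrib additive_mapD[OF Jf_additive])
  have t: "theta (\<lambda>x. g * \<zeta> x) = Jf g * theta \<zeta> + J2 (\<zeta> g)" if "\<zeta> \<in> der scale" for g \<zeta>
    unfolding J2_def by (rule theta_mult[OF that])
  have "(\<lambda>x. f * \<xi> (\<eta> x) - \<eta> (f * \<xi> x)) = (\<lambda>x. f * br x + (- \<eta> f) * \<xi> x)"
    by (simp add: br_def derD(3)[OF \<eta>] algebra_simps)
  then have "theta (\<lambda>x. f * \<xi> (\<eta> x) - \<eta> (f * \<xi> x)) = theta (\<lambda>x. f * br x) + theta (\<lambda>x. (- \<eta> f) * \<xi> x)"
    by (simp only: theta_add[OF der_mult[OF br] der_mult[OF \<xi>]])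
  also have "\<dots> = Jf f * theta br + J2 (br f) - Jf (\<eta> f) * theta \<xi> - J2 (\<xi> (\<eta> f))"
    unfolding t[OF br] t[OF \<xi>] derD(5)[OF \<xi>] J2 additive_mapD(3)[OF Jf_additive] by simp
  finally have b: "theta (\<lambda>x. f * \<xi> (\<eta> x) - \<eta> (f * \<xi> x)) = Jf f * theta br + J2 (br f) - Jf (\<eta> f) * theta \<xi> - J2 (\<xi> (\<eta> f))" .
  have c: "theta \<eta> * Jf f = Jf f * theta \<eta> + Jf (\<eta> f)" by (rule theta_commutator[OF \<eta>])
  have c2: "theta \<eta> * J2 (\<xi> f) = J2 (\<xi> f) * theta \<eta> + J2 (\<eta> (\<xi> f))"
    unfolding J2_def theta_commutator[OF \<eta>] derD(2)[OF \<eta>] by simp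
  have "curv (\<lambda>x. f * \<xi> x) \<eta> = (Jf f * theta \<xi> + J2 (\<xi> f)) * theta \<eta> - theta \<eta> * (Jf f * theta \<xi> + J2 (\<xi> f))
      - (Jf f * theta br + J2 (br f) - Jf (\<eta> f) * theta \<xi> - J2 (\<xi> (\<eta> f)))"
    unfolding curv_def b t[OF \<xi>] ..
  also have "\<dots> = Jf f * theta \<xi> * theta \<eta> + J2 (\<xi> f) * theta \<eta> - theta \<eta> * Jf f * theta \<xi> - theta \<eta> * J2 (\<xi> f)
      - Jf f * theta br - J2 (br f) + Jf (\<eta> f) * theta \<xi> + J2 (\<xi> (\<eta> f))"
    by (simp add: algebra_simps)
  also have "\<dots> = Jf f * (theta \<xi> * theta \<eta> - theta \<eta> * theta \<xi> - theta br)"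
    unfolding c c2 by (simp add: br_def J2 algebra_simps)
  finally show ?thesis by (simp add: curv_def br_def)
qed

lemma curv_zero:
  assumes \<xi>: "\<xi> \<in> der scale" and \<eta>: "\<eta> \<in> der scale"
  shows "curv \<xi> \<eta> = 0"
proof -
  obtain n :: nat and \<zeta> a where u: "\<And>i. i < n \<Longrightarrow> \<zeta> i \<in> der scale" "(\<Sum>i<n. \<zeta> i (a i)) = 1"
    using derivations_generate by blast
  define L where "L = {f. Jf f * curv \<xi> \<eta> = 0}"
  have L: "ideal_of UNIV L"
    unfolding ideal_of_def L_def
    by (auto simp: Jf_ops distrib_right mult.assoc additive_mapD[OF Jf_additive])
  have sq: "\<zeta> i (a i) * \<zeta> i (a i) \<in> L" if "i < n" for i
  proof -
    define v where "v = \<zeta> i (a i)"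
    note z = u(1)[OF that]
    \<comment> \<open>all vector fields become multiples of \<open>\<zeta>\<^sub>i\<close> after multiplication with \<open>v\<close>\<close>
    have e: "(\<lambda>x. v * \<xi> x) = (\<lambda>x. \<xi> (a i) * \<zeta> i x)" "(\<lambda>x. v * \<eta> x) = (\<lambda>x. \<eta> (a i) * \<zeta> i x)"
      using der_proportional[OF z \<xi>, of "a i"] der_proportional[OF z \<eta>, of "a i"] by (auto simp: v_def mult.commute)
    have "Jf v * (Jf v * curv \<xi> \<eta>) = Jf v * - (Jf v * curv \<eta> \<xi>)" by (simp add: curv_swap[OF \<xi> \<eta>])
    also have "Jf v * curv \<eta> \<xi> = Jf (\<eta> (a i)) * curv (\<zeta> i) \<xi>"
      by (simp only: curv_mult_left[OF \<eta> \<xi>, symmetric] e curv_mult_left[OF z \<xi>])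
    also have "Jf v * - (Jf (\<eta> (a i)) * curv (\<zeta> i) \<xi>) = Jf (\<eta> (a i)) * (Jf v * curv \<xi> (\<zeta> i))"
      by (simp add: curv_swap[OF \<xi> z] mult.assoc[symmetric] Jf_commute)
    also have "Jf v * curv \<xi> (\<zeta> i) = Jf (\<xi> (a i)) * curv (\<zeta> i) (\<zeta> i)"
      by (simp only: curv_mult_left[OF \<xi> z, symmetric] e curv_mult_left[OF z z])
    finally show ?thesis by (simp add: L_def curv_self v_def Jf_ops mult.assoc)
  qed
  have "1 \<in> L"
  proof (rule ccontr)
    assume "1 \<notin> L"
    obtain ev t P z where e: "point_on scale {} UNIV ev" "\<forall>x\<in>L. ev x = 0" "ev t = 0"
      "\<forall>x. ev x = 0 \<longrightarrow> (\<exists>a. x - a * t \<in> ideal_prod type_ring {x. ev x = 0} {x. ev x = 0})"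
      "prime_set P" "\<forall>x\<in>P. ev x = 0" "ev z = 0" "z \<notin> P"
      by (rule smooth_affine_curve_point[OF smooth_curve L \<open>1 \<notin> L\<close>])
    note p = point_onD[OF e(1) k subring_UNIV, simplified]
    have "ev (\<zeta> i (a i)) = 0" if "i < n" for i using e(2) sq[OF that] by (auto simp: p)
    then have "ev (\<Sum>i<n. \<zeta> i (a i)) = 0" by (simp add: p)
    then show False by (simp add: u(2) p)
  qed
  moreover have "Jf 1 * curv \<xi> \<eta> = curv \<xi> \<eta>"
    using Jf_1_Th(1) sym_lift(1) \<xi> \<eta> der_bracket[OF \<xi> \<eta>]
    by (simp add: curv_def theta_def right_diff_distrib mult.assoc[symmetric])
  ultimately show ?thesis by (simp add: L_def)
qed

section \<open>The isomorphism\<close>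

text \<open>The image \<open>\<ell>\<^sub>\<xi> + \<alpha>(\<Theta>)\<close> of a double
  derivation \<open>\<Theta>\<close> with vector field \<open>\<xi>\<close>.\<close>

definition psi :: "('a, 'k) double_derivation \<Rightarrow> ('a half_gen list \<Rightarrow>\<^sub>0 'k) set ring_family" where
  "psi \<Theta> = Lie_op (\<lambda>x. tmult (cl \<Theta> x)) + fun_op (alpha (cl \<Theta>))"

lemma Lie_op_zero: "Lie_op (\<lambda>x. 0) = 0"
proof -
  have "(\<lambda>x. 0) \<in> der scale" using vector_space_axioms by (simp add: der_iff)
  from Lie_ops(1)[OF this this] show ?thesis by simp
qed

lemma psi_add:
  assumes "\<Theta> \<in> double_der scale" "\<Psi> \<in> double_der scale"
  shows "psi (madd DM \<Theta> \<Psi>) = psi \<Theta> + psi \<Psi>"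
  unfolding psi_def cl_bimod(6)[OF assms] alpha_add[OF assms[THEN cl_DD]] tmult_simps
    Lie_ops(1)[OF tmult_DD[OF cl_DD[OF assms(1)]] tmult_DD[OF cl_DD[OF assms(2)]]] fun_op_ops
  by (simp add: algebra_simps)

lemma psi_bimodule:
  assumes \<Theta>: "\<Theta> \<in> double_der scale"
  shows "psi (lact DM b \<Theta>) = fun_op b * psi \<Theta>" "psi (ract DM \<Theta> b) = psi \<Theta> * fun_op b"
proof -
  define \<xi> where "\<xi> = (\<lambda>x. tmult (cl \<Theta> x))"
  have \<xi>: "\<xi> \<in> der scale" unfolding \<xi>_def by (rule tmult_DD[OF cl_DD[OF \<Theta>]])
  have m: "tmult (tens x y * cl \<Theta> z) = x * y * \<xi> z" for x y z
    by (simp add: \<xi>_def tmult_mult DD_props(1)[OF cl_DD[OF \<Theta>]] tmult_simps)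
  have a: "alpha (\<lambda>x. tens x' y' * cl \<Theta> x) = y' * x' * alpha (cl \<Theta>) + scale (1/2) (y' * \<xi> x' - x' * \<xi> y')" for x' y'
    unfolding \<xi>_def by (rule alpha_mult[OF cl_DD[OF \<Theta>]])
  have h: "fun_op (scale (1/2) x) + fun_op (scale (1/2) x) = fun_op x" for x
  proof -
    have "scale (1/2) x + scale (1/2) x = x" by (simp add: scale_left_distrib[symmetric])
    then show ?thesis by (simp only: fun_op_ops(1)[symmetric])
  qed
  show "psi (lact DM b \<Theta>) = fun_op b * psi \<Theta>"
    unfolding psi_def cl_bimod(2)[OF \<Theta>] m a
    by (simp add: Lie_ops(3)[OF \<xi>] derD[OF \<xi>] fun_op_ops additive_mapD[OF fun_op_additive] algebra_simps flip: \<xi>_def)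
  show "psi (ract DM \<Theta> b) = psi \<Theta> * fun_op b"
    unfolding psi_def cl_bimod(4)[OF \<Theta>] m a
    using h[of "\<xi> b"] fun_op_commute[of b]
    by (simp add: Lie_ops(2,3)[OF \<xi>] derD[OF \<xi>] fun_op_ops distrib_right distrib_left algebra_simps flip: \<xi>_def)
qed

lemma psi_delta: "psi (dd_Delta scale) = fun_op 1"
  by (simp add: psi_def dd_Delta(2) tmult_delta Lie_op_zero alpha_delta)

lemma fun_op_1_psi: "\<Theta> \<in> double_der scale \<Longrightarrow> fun_op 1 * psi \<Theta> = psi \<Theta>"
  using fun_op_1_gen[OF tmult_DD[OF cl_DD]] by (simp add: psi_def distrib_left)

lemma fun_op_const_central:
  assumes "\<Theta> \<in> double_der scale"
  shows "fun_op (scale c 1) * psi \<Theta> = psi \<Theta> * fun_op (scale c 1)"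
  using Lie_ops(2)[OF tmult_DD[OF cl_DD[OF assms]], of "scale c 1"] derD(7)[OF tmult_DD[OF cl_DD[OF assms]], of c]
  by (simp add: psi_def distrib_left distrib_right fun_op_commute[of "scale c 1"] additive_mapD[OF fun_op_additive])

text \<open>The word \<open>c (a, [m\<^sub>1, \<dots>, m\<^sub>n])\<close> is sent to the product
  of \<open>c a\<close> and of the images of the \<open>m\<^sub>i\<close>.\<close>

definition gP :: "('a, ('a, 'k) double_derivation) tensor_word \<Rightarrow> 'k \<Rightarrow> ('a half_gen list \<Rightarrow>\<^sub>0 'k) set ring_family" where
  "gP w c = foldl (\<lambda>x m. x * psi m) (fun_op (scale c (fst w))) (snd w)"

text \<open>The homomorphism from \<open>\<Pi>\<^sup>1\<close>; its two quotients are taken one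
  after the other.\<close>

definition FP :: "('a, 'k) pi1 \<Rightarrow> ('a half_gen list \<Rightarrow>\<^sub>0 'k) set ring_family" where
  "FP = coset_map (coset_map (lin_ext gP))"

lemma gP_additive: "additive_map (gP w)"
  unfolding gP_def additive_map_def
  by (simp add: scale_left_distrib fun_op_ops additive_mapD(1)[OF foldl_times_additive])

lemma gP_mult:
  assumes "u \<in> carrier TW" "v \<in> carrier TW"
  shows "gP (u \<otimes>\<^bsub>TW\<^esub> v) (c * d) = gP u c * gP v d"
proof -
  obtain a ms b ns where uv: "u = (a, ms)" "v = (b, ns)" by (cases u, cases v) auto
  have s: "set ms \<subseteq> double_der scale" "set ns \<subseteq> double_der scale" using assms by (auto simp: uv TW_carrier)
  have sc: "scale (c * d) x = scale d 1 * scale c x" for c d :: 'k and x :: 'a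
    using K(11)[of d c x] K(4)[of d "scale c x"] by (simp add: mult.commute)
  show ?thesis
  proof (cases ms rule: rev_cases)
    case Nil
    have "fun_op (scale (c * d) (a * b)) = fun_op (scale c a) * fun_op (scale d b)"
    proof -
      have "scale c a * scale d b = scale d (scale c a * b)" by (rule K(9)[symmetric])
      also have "\<dots> = scale d (scale c (a * b))" by (simp only: K(8))
      also have "\<dots> = scale (d * c) (a * b)" by (rule K(11))
      finally show ?thesis by (simp only: fun_op_ops(2)[symmetric] mult.commute[of c d])
    qed
    then show ?thesis by (simp add: uv Nil TW_mult gP_def foldl_times_start)
  next
    case (snoc ms' m)
    have m: "m \<in> double_der scale" "set ms' \<subseteq> double_der scale" using s snoc by auto
    define z where "z = fun_op (scale d 1)"
    define R where "R = foldl (\<lambda>x m. x * psi m) (fun_op (scale c a)) ms"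
    have zR: "z * R = R * z"
      unfolding z_def R_def
      by (rule foldl_times_commute) (use s fun_op_const_central in \<open>auto simp: fun_op_commute\<close>)
    have db: "fun_op (scale d b) = z * fun_op b" using K(4)[of d b] by (simp add: z_def fun_op_ops(2)[symmetric])
    have "foldl (\<lambda>x m. x * psi m) (fun_op (scale (c * d) a)) ms = z * R"
      unfolding R_def z_def sc fun_op_ops foldl_times_start ..
    then have "foldl (\<lambda>x m. x * psi m) (fun_op (scale (c * d) a)) (ms' @ [ract DM m b]) = R * (z * fun_op b)"
      by (simp add: snoc psi_bimodule(2)[OF m(1)] mult.assoc[symmetric] zR)
    then have "foldl (\<lambda>x m. x * psi m) (fun_op (scale (c * d) a)) (ms' @ ract DM m b # ns) = foldl (\<lambda>x m. x * psi m) (R * fun_op (scale d b)) ns"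
      by (simp add: db)
    then show ?thesis
      unfolding uv snoc TW_mult gP_def fst_conv snd_conv foldl_times_start R_def[unfolded snoc] .
  qed
qed

lemma FP: "class_hom PI FP" "p \<in> carrier TA \<Longrightarrow> FP (tc p) = lin_ext gP p"
proof -
  note add = additive_mapD[OF lin_ext_additive[of gP, OF gP_additive]] and sing = lin_ext_single[of gP, OF gP_additive]
  have h: "class_hom TA (lin_ext gP)" by (rule class_hom_monoid_algebra[OF gP_additive gP_mult])
  have kill: "\<forall>p\<in>tensor_algebra_rels scale DM. lin_ext gP p = 0"
    unfolding tensor_algebra_rels_def
    by (auto simp: add sing gP_def K(3) fun_op_ops psi_add psi_bimodule mult.assoc[symmetric] distrib_left)
      (simp add: fun_op_ops(2)[symmetric])
  note q = class_hom_quotient[OF h TA_ring tensor_rels_carrier kill, folded tensor_algebra_ideal_def,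
    folded tensor_algebra_def tensor_algebra_class_def]
  have q2: "coset_map (lin_ext gP) (tensor_algebra_class scale DM p) = lin_ext gP p" if "p \<in> carrier TA" for p
    using q(2)[OF that] .
  have one: "\<one>\<^bsub>TT\<^esub> = tensor_algebra_class scale DM (word (1, []))"
    using quotient_ops(5)[OF TT_ideal, of "word (1, [])" "word (1, [])"]
    by (simp add: tensor_algebra_def tensor_algebra_class_def monoid_algebra_simps(5) TW_one)
  have "coset_map (lin_ext gP) delta_rel = lin_ext gP (word (1, [dd_Delta scale])) - lin_ext gP (word (1, []))"
    unfolding delta_rel_def one
    using class_homD(5)[OF q(1) TT_ring TT_class_closed TT_class_closed, of "word (1, [dd_Delta scale])" "word (1, [])"] dd_Delta(1)
    by (simp add: q2)
  also have "\<dots> = 0" by (simp add: sing gP_def K(3) psi_delta fun_op_ops(2)[symmetric])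
  finally have d: "\<forall>x\<in>{delta_rel}. coset_map (lin_ext gP) x = 0" by simp
  have "{delta_rel} \<subseteq> carrier TT" using delta_rel by simp
  note r = class_hom_quotient[OF q(1) TT_ring this d, folded PI_def'(2), folded PI_def'(1) FP_def pi1_class_def]
  show "class_hom PI FP" by (rule r)
  show "p \<in> carrier TA \<Longrightarrow> FP (tc p) = lin_ext gP p"
    by (simp only: tc_def r(2)[OF TT_class_closed] q2)
qed

lemma FP_gens: "FP (pi1_fun scale a) = fun_op a" "\<Theta> \<in> double_der scale \<Longrightarrow> FP (pi1_dd scale \<Theta>) = psi \<Theta>"
  by (simp_all add: pi1_gens FP(2) lin_ext_single[of gP, OF gP_additive] gP_def K(3) fun_op_1_psi)

text \<open>The inverse homomorphism.\<close>

fun gam :: "'a half_gen \<Rightarrow> ('a, 'k) pi1 ring_family" where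
  "gam (Fn f) = Jf f"
| "gam (Lie \<xi>) = theta \<xi>"

definition gD :: "'a half_gen list \<Rightarrow> 'k \<Rightarrow> ('a, 'k) pi1 ring_family" where
  "gD w c = foldl (\<lambda>x l. x * gam l) (Jf (scale c 1)) w"

definition FD :: "('a half_gen list \<Rightarrow>\<^sub>0 'k) set \<Rightarrow> ('a, 'k) pi1 ring_family" where
  "FD = coset_map (lin_ext gD)"

lemma gD_additive: "additive_map (gD w)"
  unfolding gD_def additive_map_def
  by (simp add: scale_left_distrib Jf_ops additive_mapD(1)[OF foldl_times_additive])

lemma Jf_const_central:
  assumes "l \<in> range Fn \<union> Lie ` der scale"
  shows "Jf (scale c 1) * gam l = gam l * Jf (scale c 1)"
  using assms by (auto simp: Jf_commute theta_commutator derD(7) additive_mapD(2)[OF Jf_additive])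

lemma gD_mult:
  assumes "u \<in> carrier HW" "v \<in> carrier HW"
  shows "gD (u \<otimes>\<^bsub>HW\<^esub> v) (c * d) = gD u c * gD v d"
proof -
  have z: "Jf (scale d 1) * gD u c = gD u c * Jf (scale d 1)"
    unfolding gD_def
    by (rule foldl_times_commute) (use assms in \<open>auto simp: Jf_commute intro!: Jf_const_central\<close>)
  have "gD u (c * d) = Jf (scale d 1) * gD u c"
    unfolding gD_def foldl_times_start[symmetric] Jf_ops(2)[symmetric] K(2)[symmetric] by (simp only: mult.commute)
  then show ?thesis using z by (simp add: gD_def foldl_times_start[symmetric])
qed

lemma Jf_1_gam: "l \<in> range Fn \<union> Lie ` der scale \<Longrightarrow> Jf 1 * gam l = gam l"
  using Jf_1_Th(1)[OF sym_lift(1)] Jf_1_Th(3) un_double_der by (auto simp: theta_def Jf_ops(2)[symmetric])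

lemma FD: "class_hom HD FD" "p \<in> carrier HA \<Longrightarrow> FD (half_class scale p) = lin_ext gD p"
proof -
  note add = additive_mapD[OF lin_ext_additive[of gD, OF gD_additive]] and sing = lin_ext_single[of gD, OF gD_additive]
  have h: "class_hom HA (lin_ext gD)" by (rule class_hom_monoid_algebra[OF gD_additive gD_mult])
  have f: "gD [Fn f] c = Jf (scale c f)" for f c
    using K(4)[of c f] by (simp add: gD_def Jf_ops(2)[symmetric])
  have 0: "gD [] 1 = Jf 1" by (simp add: gD_def K(3))
  have l: "gD [Lie \<xi>] c = theta (\<lambda>x. scale c (\<xi> x))" if "\<xi> \<in> der scale" for \<xi> c
  proof -
    have "theta (\<lambda>x. scale c 1 * \<xi> x) = Jf (scale c 1) * theta \<xi>"
      by (simp add: theta_mult[OF that] derD(7)[OF that] K(10) additive_mapD[OF Jf_additive])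
    moreover have "(\<lambda>x. scale c 1 * \<xi> x) = (\<lambda>x. scale c (\<xi> x))" by (intro ext K(4)[symmetric])
    ultimately show ?thesis by (simp add: gD_def)
  qed
  have two: "gD [x, y] 1 = gam x * gam y" if "x \<in> range Fn \<union> Lie ` der scale" for x y
    using Jf_1_gam[OF that] by (simp add: gD_def K(3))
  have br: "theta \<xi> * theta \<eta> - theta \<eta> * theta \<xi> - theta (\<lambda>x. \<xi> (\<eta> x) - \<eta> (\<xi> x)) = 0"
    if "\<xi> \<in> der scale" "\<eta> \<in> der scale" for \<xi> \<eta>
    using curv_zero[OF that] by (simp add: curv_def)
  have "lin_ext gD (word [Fn (f + g)] - word [Fn f] - word [Fn g]) = 0"
    "lin_ext gD (word [Fn (scale c f)] - Poly_Mapping.single [Fn f] c) = 0"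
    "lin_ext gD (word [Fn (f * g)] - word [Fn f, Fn g]) = 0"
    "lin_ext gD (word [Fn 1] - word []) = 0" for f g c
    unfolding add sing by (simp_all add: f 0 two K(3) Jf_ops)
  moreover have "lin_ext gD (word [Lie (\<lambda>x. \<xi> x + \<eta> x)] - word [Lie \<xi>] - word [Lie \<eta>]) = 0"
    "lin_ext gD (word [Lie \<xi>, Lie \<eta>] - word [Lie \<eta>, Lie \<xi>] - word [Lie (\<lambda>x. \<xi> (\<eta> x) - \<eta> (\<xi> x))]) = 0"
    if "\<xi> \<in> der scale" "\<eta> \<in> der scale" for \<xi> \<eta>
    unfolding add sing using that
    by (simp_all add: l two K(3) der_add der_bracket theta_add br)
  moreover have "lin_ext gD (word [Lie (\<lambda>x. scale c (\<xi> x))] - Poly_Mapping.single [Lie \<xi>] c) = 0"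
    "lin_ext gD (word [Lie \<xi>, Fn f] - word [Fn f, Lie \<xi>] - word [Fn (\<xi> f)]) = 0"
    "lin_ext gD (word [Lie (\<lambda>x. f * \<xi> x)] - word [Fn f, Lie \<xi>] - Poly_Mapping.single [Fn (\<xi> f)] (1/2)) = 0"
    if "\<xi> \<in> der scale" for \<xi> f c
    unfolding add sing using that
    by (simp_all add: l f two K(3) der_scale der_mult theta_commutator theta_mult)
  ultimately have kill: "\<forall>p\<in>half_rels scale. lin_ext gD p = 0"
    unfolding half_rels_def by blast
  note q = class_hom_quotient[OF h HA_ring half_rels_carrier kill, folded half_ideal_def, folded half_diffop_def half_class_def FD_def]
  show "class_hom HD FD" "p \<in> carrier HA \<Longrightarrow> FD (half_class scale p) = lin_ext gD p" using q by simp_all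
qed

lemma FD_gens: "FD (half_fun scale f) = Jf f" "\<xi> \<in> der scale \<Longrightarrow> FD (half_lie scale \<xi>) = theta \<xi>"
  by (simp_all add: half_fun_def half_lie_def FD(2) lin_ext_single[of gD, OF gD_additive] gD_def K(3) Jf_ops(2)[symmetric])
    (use Jf_1_gam[of "Lie \<xi>"] in auto)

end

section \<open>Filtrations\<close>

lemma words_upto_carrier: "p \<in> words_upto W len n \<Longrightarrow> p \<in> carrier (monoid_algebra W)"
  by (auto simp: words_upto_def monoid_algebra_simps(1))

lemma words_upto_exhaust:
  assumes "p \<in> carrier (monoid_algebra W)"
  shows "\<exists>n. p \<in> words_upto W len n"
proof -
  have "p \<in> words_upto W len (Max (len ` Poly_Mapping.keys p))"
    using assms by (auto simp: words_upto_def monoid_algebra_simps(1) intro!: Max_ge)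
  then show ?thesis by blast
qed

lemma words_upto_add: "p \<in> words_upto W len n \<Longrightarrow> q \<in> words_upto W len n \<Longrightarrow> p + q \<in> words_upto W len n"
  using keys_add[of p q] by (fastforce simp: words_upto_def)

lemma words_upto_zero: "0 \<in> words_upto W len n"
  by (simp add: words_upto_def)

lemma words_upto_mono: "p \<in> words_upto W len n \<Longrightarrow> n \<le> m \<Longrightarrow> p \<in> words_upto W len m"
  by (auto simp: words_upto_def)

lemma words_upto_conv:
  assumes "monoid W" "\<And>u v. u \<in> carrier W \<Longrightarrow> v \<in> carrier W \<Longrightarrow> len (u \<otimes>\<^bsub>W\<^esub> v) \<le> len u + len v"
    and p: "p \<in> words_upto W len i" "q \<in> words_upto W len j"
  shows "conv W p q \<in> words_upto W len (i + j)"
  unfolding words_upto_def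
proof (intro CollectI ballI)
  fix w assume "w \<in> Poly_Mapping.keys (conv W p q)"
  then obtain u v where uv: "w = u \<otimes>\<^bsub>W\<^esub> v" "u \<in> Poly_Mapping.keys p" "v \<in> Poly_Mapping.keys q"
    using keys_conv[of W p q] by auto
  then have c: "u \<in> carrier W" "len u \<le> i" "v \<in> carrier W" "len v \<le> j" using p by (auto simp: words_upto_def)
  then show "w \<in> carrier W \<and> len w \<le> i + j"
    using assms(2)[OF c(1,3)] monoid.m_closed[OF assms(1) c(1,3)] by (simp add: uv)
qed

context affine_curve begin

abbreviation "len_half \<equiv> (\<lambda>w. length (filter (\<lambda>x. case x of Fn f \<Rightarrow> False | Lie \<xi> \<Rightarrow> True) w)) :: 'a half_gen list \<Rightarrow> nat"
abbreviation "len_tensor \<equiv> (\<lambda>(a, ms). length ms) :: ('a, ('a, 'k) double_derivation) tensor_word \<Rightarrow> nat"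

text \<open>The filtrations, transported to the type-class rings.\<close>

definition HF where "HF n = hcl ` words_upto HW len_half n"
definition PF where "PF n = pc ` words_upto TW len_tensor n"

lemma HF_eq: "HF n = embed HD ` half_filt scale n"
  by (auto simp: HF_def half_filt_def hcl_def image_image)

lemma PF_eq: "PF n = embed PI ` pi1_filt scale n"
  by (auto simp: PF_def pi1_filt_def tensor_algebra_filt_def pc_def tc_def image_image)

lemma HF_ops:
  shows "x \<in> HF n \<Longrightarrow> y \<in> HF n \<Longrightarrow> x + y \<in> HF n" "0 \<in> HF n" "x \<in> HF n \<Longrightarrow> n \<le> m \<Longrightarrow> x \<in> HF m"
    "x \<in> HF n \<Longrightarrow> y \<in> HF m \<Longrightarrow> x * y \<in> HF (n + m)" "fun_op f \<in> HF 0" "\<xi> \<in> der scale \<Longrightarrow> Lie_op \<xi> \<in> HF 1"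
proof -
  note c = words_upto_carrier[of _ HW]
  show "x + y \<in> HF n" if xy: "x \<in> HF n" "y \<in> HF n"
  proof -
    obtain p q where "p \<in> words_upto HW len_half n" "q \<in> words_upto HW len_half n" "x = hcl p" "y = hcl q" using xy by (auto simp: HF_def)
    then show ?thesis unfolding HF_def using hcl_ops(1)[OF c c, of p len_half n q len_half n] words_upto_add
      by (intro image_eqI[of _ _ "p + q"]) auto
  qed
  show "0 \<in> HF n" unfolding HF_def
    using words_upto_zero class_homD(3)[OF hcl_hom HA_ring] by (intro image_eqI[of _ _ 0]) (auto simp: monoid_algebra_simps(4))
  show "x \<in> HF n \<Longrightarrow> n \<le> m \<Longrightarrow> x \<in> HF m" unfolding HF_def using words_upto_mono by blast
  show "x * y \<in> HF (n + m)" if xy: "x \<in> HF n" "y \<in> HF m"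
  proof -
    obtain p q where "p \<in> words_upto HW len_half n" "q \<in> words_upto HW len_half m" "x = hcl p" "y = hcl q" using xy by (auto simp: HF_def)
    then show ?thesis unfolding HF_def
      using hcl_ops(2)[OF c c, of p len_half n q len_half m] words_upto_conv[OF HW_monoid, of len_half p n q m]
      by (intro image_eqI[of _ _ "conv HW p q"]) auto
  qed
  show "fun_op f \<in> HF 0" unfolding HF_def fun_op_def by (intro imageI) (auto simp: words_upto_def)
  show "\<xi> \<in> der scale \<Longrightarrow> Lie_op \<xi> \<in> HF 1" unfolding HF_def Lie_op_def by (intro imageI) (auto simp: words_upto_def)
qed

lemma len_tensor_mult:
  assumes "u \<in> carrier TW" "v \<in> carrier TW"
  shows "len_tensor (u \<otimes>\<^bsub>TW\<^esub> v) \<le> len_tensor u + len_tensor v"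
proof -
  obtain a ms b ns where "u = (a, ms)" "v = (b, ns)" by (cases u, cases v) auto
  then show ?thesis by (cases ms rule: rev_cases) (auto simp: TW_mult)
qed

lemma PF_ops:
  shows "x \<in> PF n \<Longrightarrow> y \<in> PF n \<Longrightarrow> x + y \<in> PF n" "0 \<in> PF n" "x \<in> PF n \<Longrightarrow> n \<le> m \<Longrightarrow> x \<in> PF m"
    "x \<in> PF n \<Longrightarrow> y \<in> PF m \<Longrightarrow> x * y \<in> PF (n + m)" "Jf f \<in> PF 0" "\<Psi> \<in> DD \<Longrightarrow> Th \<Psi> \<in> PF 1"
proof -
  note c = words_upto_carrier[of _ TW]
  show "x + y \<in> PF n" if xy: "x \<in> PF n" "y \<in> PF n"
  proof -
    obtain p q where "p \<in> words_upto TW len_tensor n" "q \<in> words_upto TW len_tensor n" "x = pc p" "y = pc q" using xy by (auto simp: PF_def)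
    then show ?thesis unfolding PF_def using pc_ops(1)[OF c c, of p len_tensor n q len_tensor n] words_upto_add
      by (intro image_eqI[of _ _ "p + q"]) auto
  qed
  show "0 \<in> PF n" unfolding PF_def
    using words_upto_zero class_homD(3)[OF pc_hom(1) TA_ring] by (intro image_eqI[of _ _ 0]) (auto simp: monoid_algebra_simps(4))
  show "x \<in> PF n \<Longrightarrow> n \<le> m \<Longrightarrow> x \<in> PF m" unfolding PF_def using words_upto_mono by blast
  show "x * y \<in> PF (n + m)" if xy: "x \<in> PF n" "y \<in> PF m"
  proof -
    obtain p q where "p \<in> words_upto TW len_tensor n" "q \<in> words_upto TW len_tensor m" "x = pc p" "y = pc q" using xy by (auto simp: PF_def)
    moreover from this have "conv TW p q \<in> words_upto TW len_tensor (n + m)"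
      by (intro words_upto_conv[where len=len_tensor] TW_monoid len_tensor_mult)
    ultimately show ?thesis unfolding PF_def
      using pc_ops(2)[OF c c, of p len_tensor n q len_tensor m]
      by (intro image_eqI[of _ _ "conv TW p q"]) auto
  qed
  show "Jf f \<in> PF 0" unfolding PF_def Jf_def by (intro imageI) (auto simp: words_upto_def TW_carrier)
  show "\<Psi> \<in> DD \<Longrightarrow> Th \<Psi> \<in> PF 1"
    unfolding PF_def Th_def by (intro imageI) (auto simp: words_upto_def TW_carrier un_double_der)
qed

lemma psi_HF: "\<Theta> \<in> double_der scale \<Longrightarrow> psi \<Theta> \<in> HF 1"
  unfolding psi_def by (intro HF_ops(1) HF_ops(6) tmult_DD cl_DD HF_ops(3)[OF HF_ops(5)]) auto

lemma gP_HF: "set ms \<subseteq> double_der scale \<Longrightarrow> gP (a, ms) c \<in> HF (length ms)"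
  unfolding gP_def
proof (induction ms rule: rev_induct)
  case (snoc m ms)
  then show ?case using HF_ops(4)[OF _ psi_HF[of m], of _ "length ms"] by simp
qed (simp add: HF_ops(5))

lemma FP_filtration:
  assumes "p \<in> words_upto TW len_tensor n"
  shows "FP (tc p) \<in> HF n"
proof -
  have "(\<Sum>w\<in>F. gP w (Poly_Mapping.lookup p w)) \<in> HF n" if "finite F" "F \<subseteq> Poly_Mapping.keys p" for F
    using that
  proof (induction F)
    case (insert w F)
    obtain a ms where w: "w = (a, ms)" by (cases w)
    have "w \<in> carrier TW \<and> len_tensor w \<le> n" using insert.prems assms unfolding words_upto_def by blast
    then have "set ms \<subseteq> double_der scale" "length ms \<le> n" by (simp_all add: w TW_carrier)
    then have "gP w (Poly_Mapping.lookup p w) \<in> HF n" unfolding w by (intro HF_ops(3)[OF gP_HF])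
    then show ?case using insert by (simp add: HF_ops(1))
  qed (simp add: HF_ops(2))
  then show ?thesis using FP(2)[OF words_upto_carrier[OF assms]] by (simp add: lin_ext_def)
qed

lemma gD_PF: "w \<in> carrier HW \<Longrightarrow> gD w c \<in> PF (len_half w)"
  unfolding gD_def
proof (induction w rule: rev_induct)
  case (snoc l w)
  then have IH: "foldl (\<lambda>x l. x * gam l) (Jf (scale c 1)) w \<in> PF (len_half w)" by simp
  show ?case
  proof (cases l)
    case (Fn f)
    then show ?thesis using PF_ops(4)[OF IH PF_ops(5)[of f]] by simp
  next
    case (Lie \<xi>)
    then have "\<xi> \<in> der scale" using snoc.prems by auto
    then show ?thesis using PF_ops(4)[OF IH PF_ops(6)[OF sym_lift(1)[of \<xi>]]] Lie by (simp add: theta_def)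
  qed
qed (simp add: PF_ops(5))

lemma FD_filtration:
  assumes "p \<in> words_upto HW len_half n"
  shows "FD (half_class scale p) \<in> PF n"
proof -
  have "(\<Sum>w\<in>F. gD w (Poly_Mapping.lookup p w)) \<in> PF n" if "finite F" "F \<subseteq> Poly_Mapping.keys p" for F
    using that
  proof (induction F)
    case (insert w F)
    have "w \<in> carrier HW" "len_half w \<le> n" using insert.prems assms unfolding words_upto_def by blast+
    then have "gD w (Poly_Mapping.lookup p w) \<in> PF n" by (intro PF_ops(3)[OF gD_PF])
    then show ?case using insert by (simp add: PF_ops(1))
  qed (simp add: PF_ops(2))
  then show ?thesis using FD(2)[OF words_upto_carrier[OF assms]] by (simp add: lin_ext_def)
qed

text \<open>The two homomorphisms, read in the rings with explicit carrier.\<close>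

definition phi :: "('a, 'k) pi1 \<Rightarrow> ('a half_gen list \<Rightarrow>\<^sub>0 'k) set" where "phi t = Rep_ring_family (FP t) HD"
definition chi :: "('a half_gen list \<Rightarrow>\<^sub>0 'k) set \<Rightarrow> ('a, 'k) pi1" where "chi t = Rep_ring_family (FD t) PI"

lemma embed_phi:
  assumes "t \<in> carrier PI"
  shows "embed HD (phi t) = FP t" "phi t \<in> carrier HD"
proof -
  obtain p n where "p \<in> words_upto TW len_tensor n" "t = tc p" using PI_elements[OF assms] words_upto_exhaust by blast
  then have "FP t \<in> HF n" using FP_filtration by blast
  then obtain q where "q \<in> words_upto HW len_half n" "FP t = embed HD (half_class scale q)" by (auto simp: HF_def hcl_def)
  moreover from this have "half_class scale q \<in> carrier HD" using half_class_closed words_upto_carrier by blast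
  ultimately show "embed HD (phi t) = FP t" "phi t \<in> carrier HD"
    using component_embed_self[OF HD_ring] by (auto simp: phi_def)
qed

lemma embed_chi:
  assumes "t \<in> carrier HD"
  shows "embed PI (chi t) = FD t" "chi t \<in> carrier PI"
proof -
  obtain p n where "p \<in> words_upto HW len_half n" "t = half_class scale p" using HD_elements[OF assms] words_upto_exhaust by blast
  then have "FD t \<in> PF n" using FD_filtration by blast
  then obtain q where "q \<in> words_upto TW len_tensor n" "FD t = embed PI (tc q)" by (auto simp: PF_def pc_def)
  moreover from this have "tc q \<in> carrier PI" using tc_closed words_upto_carrier by blast
  ultimately show "embed PI (chi t) = FD t" "chi t \<in> carrier PI"
    using component_embed_self[OF PI_ring] by (auto simp: chi_def)
qed

lemma embed_HD_eq: "s \<in> carrier HD \<Longrightarrow> t \<in> carrier HD \<Longrightarrow> embed HD s = embed HD t \<Longrightarrow> s = t"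
  using embed_inj[OF HD_ring] .

lemma embed_PI_eq: "s \<in> carrier PI \<Longrightarrow> t \<in> carrier PI \<Longrightarrow> embed PI s = embed PI t \<Longrightarrow> s = t"
  using embed_inj[OF PI_ring] .

lemma phi_ops:
  assumes "s \<in> carrier PI" "t \<in> carrier PI"
  shows "phi (s \<oplus>\<^bsub>PI\<^esub> t) = phi s \<oplus>\<^bsub>HD\<^esub> phi t" "phi (s \<otimes>\<^bsub>PI\<^esub> t) = phi s \<otimes>\<^bsub>HD\<^esub> phi t"
proof -
  note r = ring.ring_simprules[OF PI_ring] and d = ring.ring_simprules[OF HD_ring]
  note e = embed_ops(1,2)[OF HD_ring embed_phi(2)[OF assms(1)] embed_phi(2)[OF assms(2)]]
  note h = class_homD(1,2)[OF FP(1) PI_ring assms]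
  show "phi (s \<oplus>\<^bsub>PI\<^esub> t) = phi s \<oplus>\<^bsub>HD\<^esub> phi t"
    by (rule embed_HD_eq) (simp_all add: embed_phi assms r(1,5) d(1,5) e h)
  show "phi (s \<otimes>\<^bsub>PI\<^esub> t) = phi s \<otimes>\<^bsub>HD\<^esub> phi t"
    by (rule embed_HD_eq) (simp_all add: embed_phi assms r(1,5) d(1,5) e h)
qed

lemma chi_ops:
  assumes "s \<in> carrier HD" "t \<in> carrier HD"
  shows "chi (s \<oplus>\<^bsub>HD\<^esub> t) = chi s \<oplus>\<^bsub>PI\<^esub> chi t" "chi (s \<otimes>\<^bsub>HD\<^esub> t) = chi s \<otimes>\<^bsub>PI\<^esub> chi t"
proof -
  note r = ring.ring_simprules[OF HD_ring] and d = ring.ring_simprules[OF PI_ring]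
  note e = embed_ops(1,2)[OF PI_ring embed_chi(2)[OF assms(1)] embed_chi(2)[OF assms(2)]]
  note h = class_homD(1,2)[OF FD(1) HD_ring assms]
  show "chi (s \<oplus>\<^bsub>HD\<^esub> t) = chi s \<oplus>\<^bsub>PI\<^esub> chi t"
    by (rule embed_PI_eq) (simp_all add: embed_chi assms r(1,5) d(1,5) e h)
  show "chi (s \<otimes>\<^bsub>HD\<^esub> t) = chi s \<otimes>\<^bsub>PI\<^esub> chi t"
    by (rule embed_PI_eq) (simp_all add: embed_chi assms r(1,5) d(1,5) e h)
qed

lemma phi_fun: "phi (pi1_fun scale f) = half_fun scale f"
  by (rule embed_HD_eq) (simp_all add: embed_phi pi1_gens_closed FP_gens fun_op_embed)

lemma phi_dd:
  assumes "\<Theta> \<in> double_der scale"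
  shows "phi (pi1_dd scale \<Theta>) = half_lie scale (\<lambda>x. tmult (cl \<Theta> x)) \<oplus>\<^bsub>HD\<^esub> half_fun scale (alpha (cl \<Theta>))"
proof (rule embed_HD_eq)
  note l = Lie_embed(2)[OF tmult_DD[OF cl_DD[OF assms]]]
  note c = pi1_gens_closed(2)[OF assms]
  show "phi (pi1_dd scale \<Theta>) \<in> carrier HD" by (rule embed_phi(2)[OF c])
  show "half_lie scale (\<lambda>x. tmult (cl \<Theta> x)) \<oplus>\<^bsub>HD\<^esub> half_fun scale (alpha (cl \<Theta>)) \<in> carrier HD"
    by (rule ring.ring_simprules(1)[OF HD_ring l fun_op_embed(2)])
  show "embed HD (phi (pi1_dd scale \<Theta>)) = embed HD (half_lie scale (\<lambda>x. tmult (cl \<Theta> x)) \<oplus>\<^bsub>HD\<^esub> half_fun scale (alpha (cl \<Theta>)))"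
    unfolding embed_phi(1)[OF c] FP_gens(2)[OF assms] psi_def embed_ops(1)[OF HD_ring l fun_op_embed(2)]
    by (simp only: Lie_embed(1) fun_op_embed(1))
qed

lemma chi_fun: "chi (half_fun scale f) = pi1_fun scale f"
  by (rule embed_PI_eq) (simp_all add: embed_chi fun_op_embed FD_gens pi1_gens_closed Jf_embed)

lemma chi_lie:
  assumes "\<xi> \<in> der scale"
  shows "chi (half_lie scale \<xi>) = pi1_dd scale (un (sym_lift \<xi>))"
proof (rule embed_PI_eq)
  note u = un_double_der[OF sym_lift(1)[OF assms]]
  show "chi (half_lie scale \<xi>) \<in> carrier PI" by (rule embed_chi(2)[OF Lie_embed(2)[OF assms]])
  show "pi1_dd scale (un (sym_lift \<xi>)) \<in> carrier PI" by (rule pi1_gens_closed(2)[OF u])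
  show "embed PI (chi (half_lie scale \<xi>)) = embed PI (pi1_dd scale (un (sym_lift \<xi>)))"
    unfolding embed_chi(1)[OF Lie_embed(2)[OF assms]] FD_gens(2)[OF assms] Jf_embed(2)[OF u, symmetric]
    by (simp add: cl_un sym_lift(1)[OF assms] theta_def)
qed

text \<open>A double derivation is the sum of a symmetric one and of a multiple of \<open>\<Delta>\<close>, whose class
  is a function.\<close>

lemma Th_decomposition:
  assumes "\<Psi> \<in> DD"
  shows "Th \<Psi> = theta (\<lambda>x. tmult (\<Psi> x)) + Jf (alpha \<Psi>)"
proof -
  obtain \<Phi> s where d: "\<Phi> \<in> DD" "\<And>a. tflip (\<Phi> a) = \<Phi> a" "\<And>a. tmult (\<Phi> a) = tmult (\<Psi> a)"
    "s \<in> B" "\<And>a. \<Psi> a = \<Phi> a + s * delta a" "alpha \<Psi> = tmult s"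
    using symmetric_decomposition[OF assms] by metis
  have "\<Psi> = (\<lambda>a. \<Phi> a + s * delta a)" using d(5) by auto
  then have "Th \<Psi> = Th \<Phi> + Th (\<lambda>a. s * delta a)" using Th_add[OF d(1) DD_mult[OF d(4) delta_DD]] by simp
  then show ?thesis using Th_mult_delta[OF d(4)] theta_eq[OF d(1-3)] by (simp add: d(6))
qed

lemma chi_phi:
  assumes "t \<in> carrier PI"
  shows "chi (phi t) = t"
proof -
  have h: "class_hom PI (\<lambda>t. FD (phi t))"
    unfolding class_hom_def using class_homD(1,2)[OF FD(1) HD_ring] by (auto simp: phi_ops embed_phi)
  have "FD (phi t) = embed PI t"
  proof (rule pi1_hom_eqI[OF h embed_PI_hom _ _ assms])
    show "FD (phi (pi1_fun scale f)) = embed PI (pi1_fun scale f)" for f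
      by (simp add: phi_fun FD_gens Jf_embed)
    show "FD (phi (pi1_dd scale \<Theta>)) = embed PI (pi1_dd scale \<Theta>)" if "\<Theta> \<in> double_der scale" for \<Theta>
    proof -
      note l = tmult_DD[OF cl_DD[OF that]]
      show ?thesis
        unfolding phi_dd[OF that] class_homD(1)[OF FD(1) HD_ring Lie_embed(2)[OF l] fun_op_embed(2)] FD_gens(1) FD_gens(2)[OF l]
          Jf_embed(2)[OF that, symmetric] Th_decomposition[OF cl_DD[OF that]] ..
    qed
  qed
  then show ?thesis using assms embed_chi[OF embed_phi(2)[OF assms]] by (intro embed_PI_eq) auto
qed

lemma phi_chi:
  assumes "t \<in> carrier HD"
  shows "phi (chi t) = t"
proof -
  have h: "class_hom HD (\<lambda>t. FP (chi t))"
    unfolding class_hom_def using class_homD(1,2)[OF FP(1) PI_ring] by (auto simp: chi_ops embed_chi)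
  have h': "class_hom HD (embed HD)"
    unfolding class_hom_def using embed_ops[OF HD_ring] by blast
  have "FP (chi t) = embed HD t"
  proof (rule half_hom_eqI[OF h h' _ _ assms])
    show "FP (chi (half_fun scale f)) = embed HD (half_fun scale f)" for f
      by (simp add: chi_fun FP_gens fun_op_embed)
    show "FP (chi (half_lie scale \<xi>)) = embed HD (half_lie scale \<xi>)" if \<xi>: "\<xi> \<in> der scale" for \<xi>
    proof -
      note s = sym_lift[OF \<xi>]
      have "alpha (sym_lift \<xi>) = 0" by (rule alpha_symmetric) (auto simp: s)
      then show ?thesis
        by (simp add: chi_lie[OF \<xi>] FP_gens(2)[OF un_double_der[OF s(1)]] psi_def cl_un[OF s(1)] s(3)
            additive_mapD[OF fun_op_additive] Lie_embed(1))
    qed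
  qed
  then show ?thesis using assms embed_phi[OF embed_chi(2)[OF assms]] by (intro embed_HD_eq) auto
qed

lemma pi1_filt_carrier: "pi1_filt scale n \<subseteq> carrier PI"
proof
  fix y assume "y \<in> pi1_filt scale n"
  then obtain p where "p \<in> words_upto TW len_tensor n" "y = tc p"
    by (auto simp: pi1_filt_def tensor_algebra_filt_def tc_def)
  then show "y \<in> carrier PI" using tc_closed[OF words_upto_carrier] by blast
qed

lemma half_filt_carrier: "half_filt scale n \<subseteq> carrier HD"
  using words_upto_carrier[of _ HW] half_class_closed by (auto simp: half_filt_def)

lemma phi_filtration: "phi ` pi1_filt scale n = half_filt scale n"
proof
  show "phi ` pi1_filt scale n \<subseteq> half_filt scale n"
  proof
    fix y assume "y \<in> phi ` pi1_filt scale n"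
    then obtain p where p: "p \<in> words_upto TW len_tensor n" "y = phi (tc p)"
      by (auto simp: pi1_filt_def tensor_algebra_filt_def tc_def)
    note c = tc_closed[OF words_upto_carrier[OF p(1)]]
    have "embed HD y \<in> embed HD ` half_filt scale n"
      using FP_filtration[OF p(1)] embed_phi(1)[OF c] by (simp add: p(2) HF_eq)
    then obtain z where z: "z \<in> half_filt scale n" "embed HD y = embed HD z" by auto
    then have "y = z" using half_filt_carrier embed_phi(2)[OF c] by (intro embed_HD_eq) (auto simp: p(2))
    then show "y \<in> half_filt scale n" using z by simp
  qed
  show "half_filt scale n \<subseteq> phi ` pi1_filt scale n"
  proof
    fix y assume y: "y \<in> half_filt scale n"
    then have yc: "y \<in> carrier HD" using half_filt_carrier by blast
    obtain p where p: "p \<in> words_upto HW len_half n" "y = half_class scale p"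
      using y by (auto simp: half_filt_def)
    have "embed PI (chi y) \<in> embed PI ` pi1_filt scale n"
      using FD_filtration[OF p(1)] embed_chi(1)[OF yc] by (simp add: p(2) PF_eq)
    then obtain z where z: "z \<in> pi1_filt scale n" "embed PI (chi y) = embed PI z" by auto
    then have "chi y = z" using pi1_filt_carrier embed_chi(2)[OF yc] by (intro embed_PI_eq) auto
    then show "y \<in> phi ` pi1_filt scale n" using z phi_chi[OF yc] by force
  qed
qed

lemma one_PI: "\<one>\<^bsub>PI\<^esub> = pi1_fun scale 1" and one_HD: "\<one>\<^bsub>HD\<^esub> = half_fun scale 1"
proof -
  have o: "\<one>\<^bsub>TT\<^esub> = tensor_algebra_class scale DM (word (1, []))"
    using quotient_ops(5)[OF TT_ideal, of "word (1, [])" "word (1, [])"]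
    by (simp add: tensor_algebra_def tensor_algebra_class_def monoid_algebra_simps(5) TW_one)
  show "\<one>\<^bsub>PI\<^esub> = pi1_fun scale 1"
    using quotient_ops(5)[OF PI_ideal ring.ring_simprules(6)[OF TT_ring] ring.ring_simprules(6)[OF TT_ring]]
    by (simp add: PI_def'(1) o pi1_fun_def pi1_class_def)
  have I: "ideal (half_ideal scale) HA"
    unfolding half_ideal_def by (rule ring.genideal_ideal[OF HA_ring half_rels_carrier])
  have "\<one>\<^bsub>HD\<^esub> = half_class scale (word [])"
    using quotient_ops(5)[OF I ring.ring_simprules(6)[OF HA_ring] ring.ring_simprules(6)[OF HA_ring]]
    by (simp add: half_diffop_def half_class_def monoid_algebra_simps(5))
  moreover have "half_class scale (word []) = half_fun scale 1"
    using hcl_word_Nil by (intro embed_HD_eq) (auto simp: hcl_def fun_op_embed intro!: half_class_closed)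
  ultimately show "\<one>\<^bsub>HD\<^esub> = half_fun scale 1" by simp
qed

lemma phi_iso: "phi \<in> ring_iso PI HD"
proof (rule ring_iso_memI)
  show "bij_betw phi (carrier PI) (carrier HD)"
    by (rule bij_betw_byWitness[of _ chi]) (auto simp: chi_phi phi_chi embed_phi embed_chi)
qed (simp_all add: embed_phi phi_ops one_PI one_HD phi_fun)

lemma symmetric_iff:
  assumes "\<Theta> \<in> double_der scale"
  shows "tensor_flip (\<Theta> a) = \<Theta> a \<longleftrightarrow> tflip (cl \<Theta> a) = cl \<Theta> a"
proof -
  have t: "\<Theta> a \<in> carrier TS" using assms by (simp add: double_der_iff)
  show ?thesis
    using cembed_TS_eq_iff[OF tensor_flip_eq(1)[OF t] t] tensor_flip_eq(2)[OF t] by (simp add: cl_def)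
qed

lemma tmult_cl: "\<Theta> \<in> double_der scale \<Longrightarrow> tmult (cl \<Theta> a) = tensor_mult scale (\<Theta> a)"
  using tensor_mult_eq[of "\<Theta> a"] by (simp add: double_der_iff cl_def)

lemma phi_normalized: "canonically_normalized scale phi"
  unfolding canonically_normalized_def
proof (intro conjI allI ballI impI)
  show "phi (pi1_fun scale f) = half_fun scale f" for f by (rule phi_fun)
  fix \<Theta> :: "('a, 'k) double_derivation" assume \<Theta>: "\<Theta> \<in> double_der scale" "\<forall>a. tensor_flip (\<Theta> a) = \<Theta> a"
  have c: "phi (pi1_dd scale \<Theta>) \<in> carrier HD" by (intro embed_phi pi1_gens_closed \<Theta>)
  have l: "(\<lambda>x. tmult (cl \<Theta> x)) \<in> der scale" by (rule tmult_DD[OF cl_DD[OF \<Theta>(1)]])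
  have "alpha (cl \<Theta>) = 0" using \<Theta> symmetric_iff[OF \<Theta>(1)] by (intro alpha_symmetric cl_DD) auto
  then have "FP (pi1_dd scale \<Theta>) = Lie_op (\<lambda>x. tmult (cl \<Theta> x))"
    by (simp add: FP_gens \<Theta>(1) psi_def additive_mapD[OF fun_op_additive])
  then have "phi (pi1_dd scale \<Theta>) = half_lie scale (\<lambda>x. tmult (cl \<Theta> x))"
    using c Lie_embed(2)[OF l] embed_phi(1)[OF pi1_gens_closed(2)[OF \<Theta>(1)]]
    by (intro embed_HD_eq) (simp_all add: Lie_embed(1))
  then show "phi (pi1_dd scale \<Theta>) = half_lie scale (\<lambda>a. tensor_mult scale (\<Theta> a))"
    by (simp add: tmult_cl[OF \<Theta>(1)])
qed

text \<open>A normalized isomorphism is prescribed on \<open>A\<close> and on the symmetric double derivations,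
  which generate \<open>\<Pi>\<^sup>1\<close>.\<close>

lemma normalized_unique:
  assumes iso: "\<psi> \<in> ring_iso PI HD" "\<psi>' \<in> ring_iso PI HD"
    and norm: "canonically_normalized scale \<psi>" "canonically_normalized scale \<psi>'"
    and t: "t \<in> carrier PI"
  shows "\<psi> t = \<psi>' t"
proof -
  have hom: "class_hom PI (\<lambda>t. embed HD (f t))" if "f \<in> ring_iso PI HD" for f
    unfolding class_hom_def
  proof (intro ballI conjI)
    fix x y assume xy: "x \<in> carrier PI" "y \<in> carrier PI"
    note i = ring_iso_memE[OF that]
    show "embed HD (f (x \<oplus>\<^bsub>PI\<^esub> y)) = embed HD (f x) + embed HD (f y)"
      "embed HD (f (x \<otimes>\<^bsub>PI\<^esub> y)) = embed HD (f x) * embed HD (f y)"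
      using i(1)[OF xy(1)] i(1)[OF xy(2)] i(2,3)[OF xy] embed_ops(1,2)[OF HD_ring, of "f x" "f y"] by auto
  qed
  have "embed HD (\<psi> t) = embed HD (\<psi>' t)"
  proof (rule pi1_hom_eqI[OF hom[OF iso(1)] hom[OF iso(2)] _ _ t])
    show f: "embed HD (\<psi> (pi1_fun scale f)) = embed HD (\<psi>' (pi1_fun scale f))" for f
      using norm by (simp add: canonically_normalized_def)
    fix \<Theta> assume \<Theta>: "\<Theta> \<in> double_der scale"
    define \<Phi> where "\<Phi> = un (sym_lift (\<lambda>x. tmult (cl \<Theta> x)))"
    note s = sym_lift[OF tmult_DD[OF cl_DD[OF \<Theta>]]]
    have \<Phi>: "\<Phi> \<in> double_der scale" and cl\<Phi>: "cl \<Phi> = sym_lift (\<lambda>x. tmult (cl \<Theta> x))"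
      unfolding \<Phi>_def by (rule un_double_der[OF s(1)]) (rule cl_un[OF s(1)])
    have sym: "tensor_flip (\<Phi> a) = \<Phi> a" for a
      using symmetric_iff[OF \<Phi>, of a] s(2)[of a] by (simp add: cl\<Phi>)
    have "embed PI (pi1_dd scale \<Theta>) = embed PI (pi1_dd scale \<Phi> \<oplus>\<^bsub>PI\<^esub> pi1_fun scale (alpha (cl \<Theta>)))"
      unfolding embed_ops(1)[OF PI_ring pi1_gens_closed(2)[OF \<Phi>] pi1_gens_closed(1)]
      using Th_decomposition[OF cl_DD[OF \<Theta>]] Jf_embed(2)[OF \<Theta>] Jf_embed(2)[OF \<Phi>] Jf_embed(1)[of "alpha (cl \<Theta>)"]
      by (simp add: theta_def cl\<Phi>)
    then have eq: "pi1_dd scale \<Theta> = pi1_dd scale \<Phi> \<oplus>\<^bsub>PI\<^esub> pi1_fun scale (alpha (cl \<Theta>))"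
      by (intro embed_PI_eq pi1_gens_closed \<Theta> ring.ring_simprules(1)[OF PI_ring] \<Phi>)
    have "\<psi> (pi1_dd scale \<Phi>) = \<psi>' (pi1_dd scale \<Phi>)"
      using norm \<Phi> sym by (simp add: canonically_normalized_def)
    then show "embed HD (\<psi> (pi1_dd scale \<Theta>)) = embed HD (\<psi>' (pi1_dd scale \<Theta>))"
      unfolding eq
      using class_homD(1)[OF hom[OF iso(1)] PI_ring pi1_gens_closed(2)[OF \<Phi>] pi1_gens_closed(1)]
        class_homD(1)[OF hom[OF iso(2)] PI_ring pi1_gens_closed(2)[OF \<Phi>] pi1_gens_closed(1)] f by simp
  qed
  then show ?thesis using ring_iso_memE(1)[OF iso(1) t] ring_iso_memE(1)[OF iso(2) t] by (intro embed_HD_eq)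
qed

end

theorem theorem13p4p3:
  fixes scale :: "'k::{alg_closed_field, field_char_0} \<Rightarrow> 'a::comm_ring_1 \<Rightarrow> 'a"
  assumes "smooth_affine_curve scale"
  shows "\<exists>!\<phi>. \<phi> \<in> extensional (carrier (pi1 scale)) \<and>
    filtered_algebra_iso
      (pi1 scale) (\<lambda>c. pi1_fun scale (scale c 1)) (pi1_filt scale)
      (half_diffop scale) (\<lambda>c. half_fun scale (scale c 1)) (half_filt scale) \<phi> \<and>
    canonically_normalized scale \<phi>"
proof -
  interpret affine_curve scale by (rule affine_curve.intro[OF assms])
  define \<phi> where "\<phi> = restrict phi (carrier PI)"
  have \<phi>: "\<phi> t = phi t" if "t \<in> carrier PI" for t using that by (simp add: \<phi>_def)
  have "\<phi> \<in> ring_iso PI HD"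
    unfolding \<phi>_def by (rule ring.ring_iso_restrict[OF PI_ring phi_iso]) simp
  moreover have "\<phi> (pi1_fun scale (scale c 1)) = half_fun scale (scale c 1)" for c
    by (simp add: \<phi> pi1_gens_closed phi_fun)
  moreover have "\<phi> ` pi1_filt scale n = half_filt scale n" for n
    using pi1_filt_carrier[of n] by (subst phi_filtration[symmetric]) (auto simp: \<phi> intro!: image_cong)
  moreover have "canonically_normalized scale \<phi>"
    using phi_normalized by (auto simp: canonically_normalized_def \<phi> pi1_gens_closed)
  ultimately have ex: "\<phi> \<in> extensional (carrier PI) \<and> filtered_algebra_iso
      PI (\<lambda>c. pi1_fun scale (scale c 1)) (pi1_filt scale)
      HD (\<lambda>c. half_fun scale (scale c 1)) (half_filt scale) \<phi> \<and> canonically_normalized scale \<phi>"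
    by (simp add: filtered_algebra_iso_def \<phi>_def)
  show ?thesis
  proof (rule ex1I[of _ \<phi>])
    fix \<psi> assume \<psi>: "\<psi> \<in> extensional (carrier PI) \<and> filtered_algebra_iso
      PI (\<lambda>c. pi1_fun scale (scale c 1)) (pi1_filt scale)
      HD (\<lambda>c. half_fun scale (scale c 1)) (half_filt scale) \<psi> \<and> canonically_normalized scale \<psi>"
    show "\<psi> = \<phi>"
    proof (rule extensionalityI)
      show "\<psi> t = \<phi> t" if "t \<in> carrier PI" for t
        using \<psi> ex by (intro normalized_unique[OF _ _ _ _ that]) (auto simp: filtered_algebra_iso_def)
    qed (use \<psi> ex in auto)
  qed (rule ex)
qed

end
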